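(* Let $n\ge 2$, $1\le p<\infty$ and $0<s<1$. If $\Omega\subset\mathbb{R}^n$ is an admissible bounded domain, then $$\widetilde W^{s,p}(\Omega) = (L^p(\Omega), W^{1,p}(\Omega))_{s,p}.$$
   Context: A domain is a nonempty connected open set. For a bounded domain $\Omega\subset\mathbb{R}^n$, $d(x)$ denotes the distance from $x\in\Omega$ to $\partial\Omega$. The space $\widetilde W^{s,p}(\Omega)$ is the set of $f\in L^p(\Omega)$ such that $$|f|_{\widetilde W^{s,p}(\Omega)} = \Big( \int_\Omega \int_{|x-y|<\frac{d(x)}{2}} \frac{|f(x)-f(y)|^p}{|x-y|^{n+sp}}\,dy\,dx \Big)^{1/p}<\infty .$$ The real interpolation space $(L^p(\Omega), W^{1,p}(\Omega))_{s,p}$ is the set of $f\in L^p(\Omega)+W^{1,p}(\Omega)$ such that $$|f|_{(L^p(\Omega), W^{1,p}(\Omega))_{s,p}} = \Big\{ \int_0^\infty \big(\ell^{-s}K(\ell,f)\big)^p\,\frac{d\ell}{\ell}\Big\}^{1/p}<\infty,$$ where $K(\ell,f)=\inf\{\|g\|_{L^p(\Omega)}+\ell\|h\|_{W^{1,p}(\Omega)} : f=g+h,\ g\in L^p(\Omega),\ h\in W^{1,p}(\Omega)\}$. John domain: a bounded domain $U\subset\mathbb{R}^n$ is a John domain with constants $\lambda,k>0$ if there exist $x_0\in U$ and a family of rectifiable curves $\gamma(t,y)\in U$, $0\le t\le 1$, $y\in U$, such that (i) $\gamma(0,y)=y$ and $\gamma(1,y)=x_0$; (ii) $\operatorname{dist}(\gamma(t,y),\partial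 U)\ge\lambda t$ for all $t\in[0,1]$; (iii) $|\dot\gamma(t,y)|\le k$, where the dot denotes the derivative in $t$. Admissible domain: a bounded domain $\Omega\subset\mathbb{R}^n$ is admissible if there exist $\tau>0$ and constants (below: $C,\lambda,k,c>0$) such that for each $0<\ell<\tau$ there are a covering $\Omega=\bigcup_j\Omega_{\ell,j}$ by subdomains (allowed to overlap) and an associated partition of unity $\{\psi_{\ell,j}\}_j$ (i.e. $\psi_{\ell,j}\in W^{1,\infty}(\Omega)$, $\psi_{\ell,j}=0$ on $\Omega\setminus\Omega_{\ell,j}$, and $\sum_j\psi_{\ell,j}=1$ on $\Omega$), such that, with constants independent of $\ell$ and $j$: (1) $\sum_j\chi_{\Omega_{\ell,j}}(x)\le C$ for all $x\in\mathbb{R}^n$; (2) $\|\psi_{\ell,j}\|_\infty\le C$ and $\|\nabla\psi_{\ell,j}\|_\infty\le C\ell^{-1}$ for every $j$; (3) each $\Omega_{\ell,j}$ is a John domain with constants of order $\ell$, that is, with constants $\lambda\ell$ and $k\ell$; (4) $\operatorname{diam}(\Omega_{\ell,j})\sim\ell$, that is, $c^{-1}\ell\le\operatorname{diam}(\Omega_{\ell,j})\le c\,\ell$ for every $j$. *)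

theory Defs
  imports "HOL-Analysis.Analysis" "HOL-Probability.Essential_Supremum"
begin

text \<open>
  Elements of the function spaces below are functions on the whole type, and only their
  values on \<open>\<Omega>\<close> matter, up to null sets. Each space is closed under changing a function outside
  \<open>\<Omega>\<close> or on a null set, so equality of two spaces as sets of functions is the same as equality as
  sets of almost-everywhere classes on \<open>\<Omega>\<close>.
\<close>

definition domain_on :: "'a::euclidean_space set \<Rightarrow> bool"
  where "domain_on U \<longleftrightarrow> U \<noteq> {} \<and> connected U \<and> open U"

definition bdist :: "'a::euclidean_space set \<Rightarrow> 'a \<Rightarrow> real"
  where "bdist U x = infdist x (frontier U)"


subsection \<open>Lebesgue spaces\<close>

definition Lp_space :: "'a::euclidean_space set \<Rightarrow> real \<Rightarrow> ('a \<Rightarrow> 'b::euclidean_space) set"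
  where "Lp_space \<Omega> p = {f. f \<in> borel_measurable (lebesgue_on \<Omega>) \<and>
                            integrable (lebesgue_on \<Omega>) (\<lambda>x. norm (f x) powr p)}"

text \<open>Only meaningful on \<open>Lp_space \<Omega> p\<close>, since the Bochner integral is 0 for non-integrable functions.\<close>

definition Lp_norm :: "'a::euclidean_space set \<Rightarrow> real \<Rightarrow> ('a \<Rightarrow> 'b::euclidean_space) \<Rightarrow> real"
  where "Lp_norm \<Omega> p f = (\<integral>x. norm (f x) powr p \<partial>lebesgue_on \<Omega>) powr (1 / p)"

text \<open>The library's \<open>esssup\<close> is infinite for non-measurable functions.\<close>

definition Linf_norm :: "'a::euclidean_space set \<Rightarrow> ('a \<Rightarrow> 'b::euclidean_space) \<Rightarrow> ereal"
  where "Linf_norm \<Omega> f = esssup (lebesgue_on \<Omega>) (\<lambda>x. ereal (norm (f x)))"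

definition Linf_space :: "'a::euclidean_space set \<Rightarrow> ('a \<Rightarrow> 'b::euclidean_space) set"
  where "Linf_space \<Omega> = {f. f \<in> borel_measurable (lebesgue_on \<Omega>) \<and> Linf_norm \<Omega> f < \<infinity>}"


subsection \<open>Weak gradients and Sobolev spaces\<close>

fun Ck_function :: "nat \<Rightarrow> ('a::euclidean_space \<Rightarrow> real) \<Rightarrow> bool" where
  "Ck_function 0 f \<longleftrightarrow> continuous_on UNIV f"
| "Ck_function (Suc k) f \<longleftrightarrow>
     (\<forall>x. f differentiable (at x)) \<and>
     (\<forall>b\<in>Basis. Ck_function k (\<lambda>x. frechet_derivative f (at x) b))"

definition test_function :: "'a::euclidean_space set \<Rightarrow> ('a \<Rightarrow> real) \<Rightarrow> bool"
  where "test_function \<Omega> \<phi> \<longleftrightarrow> (\<forall>k. Ck_function k \<phi>) \<and>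
           compact (closure {x. \<phi> x \<noteq> 0}) \<and> closure {x. \<phi> x \<noteq> 0} \<subseteq> \<Omega>"

definition locally_integrable :: "'a::euclidean_space set \<Rightarrow> ('a \<Rightarrow> 'b::euclidean_space) \<Rightarrow> bool"
  where "locally_integrable \<Omega> f \<longleftrightarrow>
           (\<forall>K. compact K \<and> K \<subseteq> \<Omega> \<longrightarrow> integrable (lebesgue_on K) f)"

definition is_weak_gradient ::
    "'a::euclidean_space set \<Rightarrow> ('a \<Rightarrow> real) \<Rightarrow> ('a \<Rightarrow> 'a) \<Rightarrow> bool"
  where "is_weak_gradient \<Omega> f G \<longleftrightarrow> locally_integrable \<Omega> f \<and> locally_integrable \<Omega> G \<and>
           (\<forall>\<phi>. test_function \<Omega> \<phi> \<longrightarrow> (\<forall>b\<in>Basis.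
              (\<integral>x. f x * frechet_derivative \<phi> (at x) b \<partial>lebesgue_on \<Omega>) =
              - (\<integral>x. (G x \<bullet> b) * \<phi> x \<partial>lebesgue_on \<Omega>)))"

text \<open>A weak gradient is unique up to null sets; this picks one representative.\<close>

definition weak_gradient :: "'a::euclidean_space set \<Rightarrow> ('a \<Rightarrow> real) \<Rightarrow> 'a \<Rightarrow> 'a"
  where "weak_gradient \<Omega> f = (SOME G. is_weak_gradient \<Omega> f G)"

definition W1p_space :: "'a::euclidean_space set \<Rightarrow> real \<Rightarrow> ('a \<Rightarrow> real) set"
  where "W1p_space \<Omega> p = {f \<in> Lp_space \<Omega> p. \<exists>G \<in> Lp_space \<Omega> p. is_weak_gradient \<Omega> f G}"

definition W1p_norm :: "'a::euclidean_space set \<Rightarrow> real \<Rightarrow> ('a \<Rightarrow> real) \<Rightarrow> real"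
  where "W1p_norm \<Omega> p f = Lp_norm \<Omega> p f + Lp_norm \<Omega> p (weak_gradient \<Omega> f)"

definition W1inf_space :: "'a::euclidean_space set \<Rightarrow> ('a \<Rightarrow> real) set"
  where "W1inf_space \<Omega> = {f \<in> Linf_space \<Omega>. \<exists>G \<in> Linf_space \<Omega>. is_weak_gradient \<Omega> f G}"


subsection \<open>The fractional space and the real interpolation space\<close>

definition ennreal_root :: "real \<Rightarrow> ennreal \<Rightarrow> ennreal"
  where "ennreal_root p I = (if I = \<infinity> then \<infinity> else ennreal (enn2real I powr (1 / p)))"

text \<open>For \<open>x \<in> \<Omega>\<close> the ball over which the inner integral runs is contained in \<open>\<Omega>\<close>.\<close>

definition frac_seminorm :: "'a::euclidean_space set \<Rightarrow> real \<Rightarrow> real \<Rightarrow> ('a \<Rightarrow> real) \<Rightarrow> ennreal"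
  where "frac_seminorm \<Omega> s p f = ennreal_root p
           (\<integral>\<^sup>+x\<in>\<Omega>. (\<integral>\<^sup>+y\<in>{y. norm (x - y) < bdist \<Omega> x / 2}.
               ennreal (\<bar>f x - f y\<bar> powr p / norm (x - y) powr (real DIM('a) + s * p))
             \<partial>lebesgue) \<partial>lebesgue)"

definition frac_space :: "'a::euclidean_space set \<Rightarrow> real \<Rightarrow> real \<Rightarrow> ('a \<Rightarrow> real) set"
  where "frac_space \<Omega> s p = {f \<in> Lp_space \<Omega> p. frac_seminorm \<Omega> s p f < \<infinity>}"

definition sum_space :: "'a::euclidean_space set \<Rightarrow> real \<Rightarrow> ('a \<Rightarrow> real) set"
  where "sum_space \<Omega> p = {f. \<exists>g \<in> Lp_space \<Omega> p. \<exists>h \<in> W1p_space \<Omega> p.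
                              AE x in lebesgue_on \<Omega>. f x = g x + h x}"

definition K_functional :: "'a::euclidean_space set \<Rightarrow> real \<Rightarrow> real \<Rightarrow> ('a \<Rightarrow> real) \<Rightarrow> real"
  where "K_functional \<Omega> p l f =
           Inf {Lp_norm \<Omega> p g + l * W1p_norm \<Omega> p h | g h.
                  g \<in> Lp_space \<Omega> p \<and> h \<in> W1p_space \<Omega> p \<and>
                  (AE x in lebesgue_on \<Omega>. f x = g x + h x)}"

definition interp_seminorm :: "'a::euclidean_space set \<Rightarrow> real \<Rightarrow> real \<Rightarrow> ('a \<Rightarrow> real) \<Rightarrow> ennreal"
  where "interp_seminorm \<Omega> s p f = ennreal_root p
           (\<integral>\<^sup>+l\<in>{0<..}. ennreal ((l powr (- s) * K_functional \<Omega> p l f) powr p / l) \<partial>lborel)"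

definition interp_space :: "'a::euclidean_space set \<Rightarrow> real \<Rightarrow> real \<Rightarrow> ('a \<Rightarrow> real) set"
  where "interp_space \<Omega> s p = {f \<in> sum_space \<Omega> p. interp_seminorm \<Omega> s p f < \<infinity>}"


subsection \<open>John domains and admissible domains\<close>

text \<open>
  A curve on \<open>[0,1]\<close> whose derivative exists almost everywhere, is bounded by \<open>k\<close>, and integrates
  back to the curve (absolute continuity). Such a curve is \<open>k\<close>-Lipschitz, hence rectifiable of
  length at most \<open>k\<close>. Without absolute continuity a bound on the almost-everywhere derivative
  would be void, as Cantor-type parametrisations show; demanding a derivative at every point
  would exclude polygonal curves.
\<close>

definition bounded_speed_curve :: "real \<Rightarrow> (real \<Rightarrow> 'a::euclidean_space) \<Rightarrow> bool"
  where "bounded_speed_curve k c \<longleftrightarrow> (\<exists>v.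
           (AE t in lebesgue_on {0..1}.
              (c has_vector_derivative v t) (at t within {0..1}) \<and> norm (v t) \<le> k) \<and>
           (\<forall>t\<in>{0..1}. (v has_integral (c t - c 0)) {0..t}))"

definition John_domain :: "'a::euclidean_space set \<Rightarrow> real \<Rightarrow> real \<Rightarrow> bool"
  where "John_domain U lam k \<longleftrightarrow> domain_on U \<and> bounded U \<and> lam > 0 \<and> k > 0 \<and>
           (\<exists>x0\<in>U. \<exists>\<gamma> :: real \<Rightarrow> 'a \<Rightarrow> 'a. \<forall>y\<in>U.
              (\<forall>t\<in>{0..1}. \<gamma> t y \<in> U) \<and>
              \<gamma> 0 y = y \<and> \<gamma> 1 y = x0 \<and>
              (\<forall>t\<in>{0..1}. bdist U (\<gamma> t y) \<ge> lam * t) \<and>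
              bounded_speed_curve k (\<lambda>t. \<gamma> t y))"

text \<open>
  Coverings are indexed by a set of natural numbers. This is no restriction: a family of nonempty
  open sets with finite overlap is countable.
\<close>

definition admissible_domain :: "'a::euclidean_space set \<Rightarrow> bool"
  where "admissible_domain \<Omega> \<longleftrightarrow> domain_on \<Omega> \<and> bounded \<Omega> \<and>
     (\<exists>\<tau> C lam k c :: real. \<tau> > 0 \<and> C > 0 \<and> lam > 0 \<and> k > 0 \<and> c > 0 \<and>
       (\<forall>l. 0 < l \<and> l < \<tau> \<longrightarrow>
         (\<exists>(J :: nat set) (U :: nat \<Rightarrow> 'a set) (\<psi> :: nat \<Rightarrow> 'a \<Rightarrow> real).
            (\<forall>j\<in>J. domain_on (U j)) \<and> \<Omega> = (\<Union>j\<in>J. U j) \<and>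
            (\<forall>j\<in>J. \<psi> j \<in> W1inf_space \<Omega>) \<and>
            (\<forall>j\<in>J. \<forall>x\<in>\<Omega> - U j. \<psi> j x = 0) \<and>
            (\<forall>x\<in>\<Omega>. ((\<lambda>j. \<psi> j x) has_sum 1) J) \<and>
            (\<forall>x. (\<Sum>\<^sub>\<infinity>j\<in>J. indicator (U j) x :: ennreal) \<le> ennreal C) \<and>
            (\<forall>j\<in>J. Linf_norm \<Omega> (\<psi> j) \<le> ereal C \<and>
                    Linf_norm \<Omega> (weak_gradient \<Omega> (\<psi> j)) \<le> ereal (C / l)) \<and>
            (\<forall>j\<in>J. John_domain (U j) (lam * l) (k * l)) \<and>
            (\<forall>j\<in>J. l / c \<le> diameter (U j) \<and> diameter (U j) \<le> c * l))))"

end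

(*
  For x and y at distance r, splitting f = g + h and estimating the difference of g by 2|g| and
  that of h along the segment shows that the L^p norm of f(. + z) - f is at most a constant times
  K(|z|, f); integrating against |z|^(-n-sp), written as an integral of r^(-n-sp-1) over r > |z|,
  gives one inclusion. The segment estimate for weakly differentiable h is obtained by mollification.

  Conversely, at scale l, replace f on each piece U_j of the covering by a constant a_j and let h be
  the sum of the a_j psi_j. Since the gradients of the psi_j sum to zero, both f - h and l grad h are
  controlled by the sum of |f - a_j| over the pieces containing the point. A Poincare inequality on
  John domains bounds this with a fractional seminorm of order sigma = s/2 restricted to
  |x - y| < c l; the strict inequality sigma < s makes the integral over l converge. The Poincare
  inequality follows by chaining averages of f over balls of geometrically decreasing radius that
  follow the John curve and shrink to the given point; consecutive balls are so close that their
  points stay within half the distance to the boundary, so no derivative is needed.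
*)

theory Submission
  imports Defs
begin

subsection \<open>Lebesgue points along a subsequence\<close>

text \<open>Both the chaining argument and the mollification must recover the value of a function at
  almost every point from averages. The limit is taken along a sparse sequence of radii: by
  continuity of translations in L^1 the integrated mean oscillation at radius r tends to 0, so along
  such a sequence it is summable, and then the oscillation itself tends to 0 almost everywhere.

  The John curves may depend on their starting point y in a non-measurable way. Before the chain
  estimate is integrated in y, the balls along the curve are therefore replaced by larger balls
  about y.

  Locality of weak gradients makes the gradient of \<psi>_j vanish only off the closure of U_j,
  while the estimates use that it vanishes off U_j. This is why frontiers of John domains have to be
  null.

  With \<sigma> = s the Poincare factor would turn the weight l^(-sp-1) into 1/l, whose integral
  costs a logarithm of |x-y|. For \<sigma> < s, integration over l > |x-y|/c produces a multiple of
  |x-y|^(-(s-\<sigma>)p), exactly the power by which the two kernels differ.\<close>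

lemma ball_borel [measurable]: "ball (x::'a::metric_space) r \<in> sets borel"
  and cball_borel [measurable]: "cball (x::'a::metric_space) r \<in> sets borel"
  by simp_all

lemma nn_integral_lborel_shift:
  fixes f :: "'a::euclidean_space \<Rightarrow> ennreal"
  assumes [measurable]: "f \<in> borel_measurable borel"
  shows "(\<integral>\<^sup>+x. f (x + z) \<partial>lborel) = (\<integral>\<^sup>+x. f x \<partial>lborel)"
proof -
  have "(\<integral>\<^sup>+x. f x \<partial>lborel) = (\<integral>\<^sup>+x. f x \<partial>(distr lborel borel ((+) z)))"
    by (simp add: lborel_distr_plus)
  also have "\<dots> = (\<integral>\<^sup>+x. f (x + z) \<partial>lborel)"
    by (subst nn_integral_distr) (auto simp: add.commute)
  finally show ?thesis ..
qed

section \<open>Continuity of translations in L^1\<close>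

definition L1_shift_continuous :: "('a::euclidean_space \<Rightarrow> real) \<Rightarrow> bool" where
  "L1_shift_continuous f \<longleftrightarrow>
     (\<forall>e>0. \<exists>d>0. \<forall>z. norm z < d \<longrightarrow> (\<integral>\<^sup>+x. ennreal \<bar>f (x + z) - f x\<bar> \<partial>lborel) \<le> ennreal e)"

text \<open>Closedness under L^1 limits by the e/3 argument: invariance of \<open>lborel\<close>
  makes the error of the shifted function equal to that of the unshifted one.\<close>

lemma L1_shift_continuous_approx:
  fixes f :: "'a::euclidean_space \<Rightarrow> real"
  assumes [measurable]: "f \<in> borel_measurable borel"
    and approx: "\<And>e. e > 0 \<Longrightarrow> \<exists>g\<in>borel_measurable borel. L1_shift_continuous g \<and>
      (\<integral>\<^sup>+x. ennreal \<bar>f x - g x\<bar> \<partial>lborel) \<le> ennreal e"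
  shows "L1_shift_continuous f"
  unfolding L1_shift_continuous_def
proof (intro allI impI)
  fix e :: real assume "e > 0"
  then obtain g where [measurable]: "g \<in> borel_measurable borel" and g: "L1_shift_continuous g"
    "(\<integral>\<^sup>+x. ennreal \<bar>f x - g x\<bar> \<partial>lborel) \<le> ennreal (e/3)"
    using approx[of "e/3"] by auto
  from g(1) \<open>e > 0\<close> obtain d where d: "d > 0"
    "\<And>z. norm z < d \<Longrightarrow> (\<integral>\<^sup>+x. ennreal \<bar>g (x + z) - g x\<bar> \<partial>lborel) \<le> ennreal (e/3)"
    unfolding L1_shift_continuous_def by (metis divide_pos_pos zero_less_numeral)
  have "(\<integral>\<^sup>+x. ennreal \<bar>f (x + z) - f x\<bar> \<partial>lborel) \<le> ennreal e" if "norm z < d" for z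
  proof -
    have "(\<integral>\<^sup>+x. ennreal \<bar>f (x + z) - f x\<bar> \<partial>lborel)
      \<le> (\<integral>\<^sup>+x. (ennreal \<bar>f (x + z) - g (x + z)\<bar> + ennreal \<bar>g (x + z) - g x\<bar>) + ennreal \<bar>f x - g x\<bar> \<partial>lborel)"
      by (intro nn_integral_mono) (simp flip: ennreal_plus add: ennreal_le_iff)
    also have "\<dots> = (\<integral>\<^sup>+x. ennreal \<bar>f (x + z) - g (x + z)\<bar> \<partial>lborel)
        + (\<integral>\<^sup>+x. ennreal \<bar>g (x + z) - g x\<bar> \<partial>lborel) + (\<integral>\<^sup>+x. ennreal \<bar>f x - g x\<bar> \<partial>lborel)"
      by (simp add: nn_integral_add)
    also have "(\<integral>\<^sup>+x. ennreal \<bar>f (x + z) - g (x + z)\<bar> \<partial>lborel) = (\<integral>\<^sup>+x. ennreal \<bar>f x - g x\<bar> \<partial>lborel)"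
      by (rule nn_integral_lborel_shift[where f="\<lambda>x. ennreal \<bar>f x - g x\<bar>"]) simp
    also have "(\<integral>\<^sup>+x. ennreal \<bar>f x - g x\<bar> \<partial>lborel) + (\<integral>\<^sup>+x. ennreal \<bar>g (x + z) - g x\<bar> \<partial>lborel)
        + (\<integral>\<^sup>+x. ennreal \<bar>f x - g x\<bar> \<partial>lborel) \<le> ennreal (e/3) + ennreal (e/3) + ennreal (e/3)"
      by (intro add_mono g d that)
    also have "\<dots> = ennreal e"
      using \<open>e > 0\<close> by (simp flip: ennreal_plus)
    finally show ?thesis .
  qed
  with d(1) show "\<exists>d>0. \<forall>z. norm z < d \<longrightarrow> (\<integral>\<^sup>+x. ennreal \<bar>f (x + z) - f x\<bar> \<partial>lborel) \<le> ennreal e"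
    by blast
qed

lemma L1_shift_continuous_scale:
  fixes f :: "'a::euclidean_space \<Rightarrow> real"
  assumes [measurable]: "f \<in> borel_measurable borel" and f: "L1_shift_continuous f"
  shows "L1_shift_continuous (\<lambda>x. f x * c)"
  unfolding L1_shift_continuous_def
proof (intro allI impI)
  fix e :: real assume "e > 0"
  \<comment> \<open>The summand 1 covers c = 0.\<close>
  then have "e / (\<bar>c\<bar> + 1) > 0" by (simp add: add_nonneg_pos)
  then obtain d where d: "d > 0"
    "\<And>z. norm z < d \<Longrightarrow> (\<integral>\<^sup>+x. ennreal \<bar>f (x + z) - f x\<bar> \<partial>lborel) \<le> ennreal (e / (\<bar>c\<bar> + 1))"
    using f unfolding L1_shift_continuous_def by blast
  have "(\<integral>\<^sup>+x. ennreal \<bar>f (x + z) * c - f x * c\<bar> \<partial>lborel) \<le> ennreal e" if "norm z < d" for z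
  proof -
    have "(\<integral>\<^sup>+x. ennreal \<bar>f (x + z) * c - f x * c\<bar> \<partial>lborel)
       = (\<integral>\<^sup>+x. ennreal \<bar>c\<bar> * ennreal \<bar>f (x + z) - f x\<bar> \<partial>lborel)"
      by (intro nn_integral_cong) (simp flip: ennreal_mult' abs_mult add: algebra_simps)
    also have "\<dots> = ennreal \<bar>c\<bar> * (\<integral>\<^sup>+x. ennreal \<bar>f (x + z) - f x\<bar> \<partial>lborel)"
      by (rule nn_integral_cmult) measurable
    also have "\<dots> \<le> ennreal \<bar>c\<bar> * ennreal (e / (\<bar>c\<bar> + 1))"
      by (intro mult_left_mono d that) simp
    also have "\<dots> \<le> ennreal e"
      using \<open>e > 0\<close> by (simp flip: ennreal_mult' add: divide_simps algebra_simps)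
    finally show ?thesis .
  qed
  with d(1) show "\<exists>d>0. \<forall>z. norm z < d \<longrightarrow> (\<integral>\<^sup>+x. ennreal \<bar>f (x + z) * c - f x * c\<bar> \<partial>lborel) \<le> ennreal e"
    by blast
qed

lemma L1_shift_continuous_add:
  fixes f g :: "'a::euclidean_space \<Rightarrow> real"
  assumes [measurable]: "f \<in> borel_measurable borel" "g \<in> borel_measurable borel"
    and f: "L1_shift_continuous f" and g: "L1_shift_continuous g"
  shows "L1_shift_continuous (\<lambda>x. f x + g x)"
  unfolding L1_shift_continuous_def
proof (intro allI impI)
  fix e :: real assume "e > 0"
  then have "e / 2 > 0" by simp
  obtain d where d: "d > 0"
    "\<And>z. norm z < d \<Longrightarrow> (\<integral>\<^sup>+x. ennreal \<bar>f (x + z) - f x\<bar> \<partial>lborel) \<le> ennreal (e / 2)"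
    using f \<open>e / 2 > 0\<close> unfolding L1_shift_continuous_def by blast
  obtain d' where d': "d' > 0"
    "\<And>z. norm z < d' \<Longrightarrow> (\<integral>\<^sup>+x. ennreal \<bar>g (x + z) - g x\<bar> \<partial>lborel) \<le> ennreal (e / 2)"
    using g \<open>e / 2 > 0\<close> unfolding L1_shift_continuous_def by blast
  have "(\<integral>\<^sup>+x. ennreal \<bar>(f (x + z) + g (x + z)) - (f x + g x)\<bar> \<partial>lborel) \<le> ennreal e"
    if "norm z < min d d'" for z
  proof -
    have "(\<integral>\<^sup>+x. ennreal \<bar>(f (x + z) + g (x + z)) - (f x + g x)\<bar> \<partial>lborel)
       \<le> (\<integral>\<^sup>+x. ennreal \<bar>f (x + z) - f x\<bar> + ennreal \<bar>g (x + z) - g x\<bar> \<partial>lborel)"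
      by (intro nn_integral_mono) (simp flip: ennreal_plus add: ennreal_le_iff)
    also have "\<dots> = (\<integral>\<^sup>+x. ennreal \<bar>f (x + z) - f x\<bar> \<partial>lborel) + (\<integral>\<^sup>+x. ennreal \<bar>g (x + z) - g x\<bar> \<partial>lborel)"
      by (rule nn_integral_add) measurable
    also have "\<dots> \<le> ennreal (e/2) + ennreal (e/2)"
      using that by (intro add_mono d d') auto
    also have "\<dots> = ennreal e" using \<open>e > 0\<close> by (simp flip: ennreal_plus)
    finally show ?thesis .
  qed
  with d(1) d'(1) show "\<exists>d>0. \<forall>z. norm z < d \<longrightarrow>
    (\<integral>\<^sup>+x. ennreal \<bar>(f (x + z) + g (x + z)) - (f x + g x)\<bar> \<partial>lborel) \<le> ennreal e"
    by (intro exI[of _ "min d d'"]) auto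
qed

text \<open>Outer regularity gives an open T around K with T - K small. A shift shorter than the
  distance from K to the complement of T keeps K inside T, so the two indicators can differ only
  where x or x + z lies in T - K.\<close>

lemma L1_shift_continuous_indicator_compact:
  fixes K :: "'a::euclidean_space set"
  assumes K: "compact K"
  shows "L1_shift_continuous (indicator K)"
  unfolding L1_shift_continuous_def
proof (intro allI impI)
  fix e :: real assume "e > 0"
  have Kb [measurable]: "K \<in> sets borel" using K by (simp add: borel_compact)
  have "e / 2 > 0" using \<open>e > 0\<close> by simp
  from outer_regular_lborel[OF Kb this] obtain T where T: "open T" "K \<subseteq> T"
    "emeasure lborel (T - K) < ennreal (e/2)" by blast
  have [measurable]: "T \<in> sets borel" using T(1) by simp
  obtain d where d: "d > 0" "\<And>x z. x \<in> K \<Longrightarrow> norm z < d \<Longrightarrow> x + z \<in> T"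
  proof -
    obtain d where "0 < d" "(\<Union>x\<in>K. ball x d) \<subseteq> T"
      using compact_subset_open_imp_ball_epsilon_subset[OF K T(1,2)] by blast
    then show thesis by (intro that[of d]) (force simp: dist_norm)+
  qed
  have "(\<integral>\<^sup>+x. ennreal \<bar>indicator K (x + z) - indicator K x\<bar> \<partial>lborel) \<le> ennreal e" if z: "norm z < d" for z
  proof -
    have "(\<integral>\<^sup>+x. ennreal \<bar>indicator K (x + z) - indicator K x\<bar> \<partial>lborel)
      \<le> (\<integral>\<^sup>+x. indicator (T - K) (x + z) + indicator (T - K) x \<partial>lborel)"
    proof (rule nn_integral_mono)
      fix x :: 'a
      have "x \<in> K \<Longrightarrow> x + z \<in> T" using d z by blast
      moreover have "x + z \<in> K \<Longrightarrow> x \<in> T" using d(2)[of "x + z" "-z"] z by simp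
      ultimately show "ennreal \<bar>indicator K (x + z) - indicator K x\<bar> \<le> indicator (T - K) (x + z) + indicator (T - K) x"
        using T(2) by (auto simp: indicator_def)
    qed
    also have "\<dots> = (\<integral>\<^sup>+x. indicator (T - K) (x + z) \<partial>lborel) + (\<integral>\<^sup>+x. indicator (T - K) x \<partial>lborel)"
      by (rule nn_integral_add) measurable
    also have "(\<integral>\<^sup>+x. indicator (T - K) (x + z) \<partial>lborel) = (\<integral>\<^sup>+x. indicator (T - K) x \<partial>lborel)"
      by (rule nn_integral_lborel_shift) measurable
    also have "(\<integral>\<^sup>+x. indicator (T - K) x \<partial>lborel) = emeasure lborel (T - K)"
      by simp
    also have "emeasure lborel (T - K) + emeasure lborel (T - K) \<le> ennreal (e/2) + ennreal (e/2)"
      using T(3) by (intro add_mono) auto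
    also have "\<dots> = ennreal e" using \<open>e > 0\<close> by (simp flip: ennreal_plus)
    finally show ?thesis .
  qed
  with d(1) show "\<exists>d>0. \<forall>z. norm z < d \<longrightarrow>
      (\<integral>\<^sup>+x. ennreal \<bar>indicator K (x + z) - indicator K x\<bar> \<partial>lborel) \<le> ennreal e"
    by blast
qed

text \<open>Inner regularity provides a closed subset with small loss; as A has finite measure,
  cutting with a large ball loses little more and makes the subset compact.\<close>

lemma L1_shift_continuous_indicator:
  fixes A :: "'a::euclidean_space set"
  assumes A [measurable]: "A \<in> sets borel" and fin: "emeasure lborel A < \<infinity>"
  shows "L1_shift_continuous (indicator A)"
proof (rule L1_shift_continuous_approx)
  fix e :: real assume "e > 0"
  then have e: "e / 2 > 0" by simp
  have "A \<in> sets lebesgue" using A by simp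
  then obtain T where T: "closed T" "T \<subseteq> A" "emeasure lebesgue (A - T) < ennreal (e/2)"
    by (rule sets_lebesgue_inner_closed[OF _ e])
  have [measurable]: "T \<in> sets borel" using T(1) by simp
  have "(\<lambda>n. emeasure lborel (A - cball 0 (real n))) \<longlonglongrightarrow> emeasure lborel (\<Inter>n. A - cball 0 (real n))"
  proof (rule Lim_emeasure_decseq)
    show "decseq (\<lambda>n. A - cball 0 (real n))" unfolding decseq_def by auto
    show "emeasure lborel (A - cball 0 (real i)) \<noteq> \<infinity>" for i
      using fin emeasure_mono[of "A - cball 0 (real i)" A lborel] by (auto simp: top_unique)
  qed auto
  also have "(\<Inter>n. A - cball 0 (real n)) = {}"
    using real_arch_simple by fastforce
  finally have "(\<lambda>n. emeasure lborel (A - cball 0 (real n))) \<longlonglongrightarrow> 0" by simp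
  then have "\<forall>\<^sub>F n in sequentially. emeasure lborel (A - cball 0 (real n)) < ennreal (e/2)"
    by (rule order_tendstoD) (use e in simp)
  then obtain n where n: "emeasure lborel (A - cball 0 (real n)) < ennreal (e/2)"
    by (auto simp: eventually_sequentially)
  define K where "K = T \<inter> cball 0 (real n)"
  have K: "compact K" unfolding K_def using T(1) by (simp add: closed_Int_compact)
  have [measurable]: "K \<in> sets borel" using K by (simp add: borel_compact)
  have "(\<integral>\<^sup>+x. ennreal \<bar>indicator A x - indicator K x\<bar> \<partial>lborel)
     \<le> (\<integral>\<^sup>+x. indicator (A - T) x + indicator (A - cball 0 (real n)) x \<partial>lborel)"
    using T(2) by (intro nn_integral_mono) (auto simp: indicator_def K_def)
  also have "\<dots> = emeasure lborel (A - T) + emeasure lborel (A - cball 0 (real n))"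
    by (subst nn_integral_add) simp_all
  also have "\<dots> \<le> ennreal (e/2) + ennreal (e/2)"
    using T(3) n by (intro add_mono) auto
  also have "\<dots> = ennreal e" using \<open>e > 0\<close> by (simp flip: ennreal_plus)
  finally show "\<exists>g\<in>borel_measurable borel. L1_shift_continuous g \<and>
     (\<integral>\<^sup>+x. ennreal \<bar>indicator A x - g x\<bar> \<partial>lborel) \<le> ennreal e"
    using L1_shift_continuous_indicator_compact[OF K] by (intro bexI[of _ "indicator K"]) auto
qed simp

lemma L1_shift_continuous_integrable:
  fixes f :: "'a::euclidean_space \<Rightarrow> real"
  assumes "integrable lborel f"
  shows "L1_shift_continuous f"
  using assms
proof (induction f rule: integrable_induct)
  case (base A c)
  then show ?case
    using L1_shift_continuous_scale[OF _ L1_shift_continuous_indicator[of A], of c] by simp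
next
  case (add f g)
  then show ?case by (intro L1_shift_continuous_add) auto
next
  case (lim f s)
  have fm [measurable]: "f \<in> borel_measurable borel" "\<And>i. s i \<in> borel_measurable borel"
    using lim by auto
  have "(\<lambda>i. \<integral>\<^sup>+x. ennreal (norm (f x - s i x)) \<partial>lborel) \<longlonglongrightarrow> 0"
  proof (rule Bochner_Integration.nn_integral_dominated_convergence_norm)
    show "AE x in lborel. norm (s j x) \<le> 2 * norm (f x)" for j using lim by auto
    show "(\<integral>\<^sup>+x. ennreal (2 * norm (f x)) \<partial>lborel) < \<infinity>"
      using \<open>integrable lborel f\<close> by (simp add: ennreal_mult' nn_integral_cmult integrable_iff_bounded ennreal_mult_less_top)
    show "AE x in lborel. (\<lambda>i. s i x) \<longlonglongrightarrow> f x" using lim by auto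
  qed auto
  note conv = this
  show ?case
  proof (rule L1_shift_continuous_approx)
    fix e :: real assume "e > 0"
    then have "\<forall>\<^sub>F i in sequentially. (\<integral>\<^sup>+x. ennreal (norm (f x - s i x)) \<partial>lborel) < ennreal e"
      by (intro order_tendstoD[OF conv]) simp
    then obtain i where i: "(\<integral>\<^sup>+x. ennreal (norm (f x - s i x)) \<partial>lborel) < ennreal e"
      by (auto simp: eventually_sequentially)
    show "\<exists>g\<in>borel_measurable borel. L1_shift_continuous g \<and>
      (\<integral>\<^sup>+x. ennreal \<bar>f x - g x\<bar> \<partial>lborel) \<le> ennreal e"
      using i lim by (intro bexI[of _ "s i"]) auto
  qed simp
qed

text \<open>Up to the factor \<open>unit_ball_vol\<close> this is the mean of |f x - f y| over the
  ball; y is a Lebesgue point when it tends to 0 with r. Dividing by the bare power of r makes balls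
  of comparable radii easy to compare.\<close>

definition local_osc :: "('a::euclidean_space \<Rightarrow> real) \<Rightarrow> real \<Rightarrow> 'a \<Rightarrow> ennreal" where
  "local_osc f r y = ennreal (1 / r ^ DIM('a)) *
     (\<integral>\<^sup>+x. indicator (ball y r) x * ennreal \<bar>f x - f y\<bar> \<partial>lborel)"

lemma local_osc_integral_measurable [measurable]:
  fixes f :: "'a::euclidean_space \<Rightarrow> real"
  assumes [measurable]: "f \<in> borel_measurable borel"
  shows "(\<lambda>y. \<integral>\<^sup>+x. indicator (ball y r) x * ennreal \<bar>f x - f y\<bar> \<partial>lborel) \<in> borel_measurable borel"
proof -
  have "(\<lambda>y. \<integral>\<^sup>+x. (if dist y x < r then ennreal \<bar>f x - f y\<bar> else 0) \<partial>lborel) \<in> borel_measurable borel"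
    by measurable
  also have "(\<lambda>y. \<integral>\<^sup>+x. (if dist y x < r then ennreal \<bar>f x - f y\<bar> else 0) \<partial>lborel)
     = (\<lambda>y. \<integral>\<^sup>+x. indicator (ball y r) x * ennreal \<bar>f x - f y\<bar> \<partial>lborel)"
    by (intro ext nn_integral_cong) (auto simp: indicator_def)
  finally show ?thesis .
qed

lemma local_osc_measurable [measurable]:
  "f \<in> borel_measurable borel \<Longrightarrow> local_osc f r \<in> borel_measurable borel"
  unfolding local_osc_def[abs_def] by measurable

text \<open>With x = y + z and Fubini, the integral over y becomes, for each shift z shorter than r,
  an L^1 translation difference; the ball of shifts has volume \<open>unit_ball_vol\<close> times
  r^n, and r^n cancels.\<close>

lemma nn_integral_local_osc_le:
  fixes f :: "'a::euclidean_space \<Rightarrow> real"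
  assumes [measurable]: "f \<in> borel_measurable borel" and "r > 0" "e \<ge> 0"
    and osc: "\<And>z. norm z < r \<Longrightarrow> (\<integral>\<^sup>+x. ennreal \<bar>f (x + z) - f x\<bar> \<partial>lborel) \<le> ennreal e"
  shows "(\<integral>\<^sup>+y. local_osc f r y \<partial>lborel) \<le> ennreal (unit_ball_vol (DIM('a)) * e)"
proof -
  let ?I = "\<integral>\<^sup>+y. \<integral>\<^sup>+x. indicator (ball y r) x * ennreal \<bar>f x - f y\<bar> \<partial>lborel \<partial>lborel"
  have "(\<integral>\<^sup>+x. indicator (ball y r) x * ennreal \<bar>f x - f y\<bar> \<partial>lborel)
      = (\<integral>\<^sup>+z. indicator (ball 0 r) z * ennreal \<bar>f (y + z) - f y\<bar> \<partial>lborel)" for y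
  proof -
    have "(\<integral>\<^sup>+x. indicator (ball y r) x * ennreal \<bar>f x - f y\<bar> \<partial>lborel)
      = (\<integral>\<^sup>+z. indicator (ball y r) (z + y) * ennreal \<bar>f (z + y) - f y\<bar> \<partial>lborel)"
      by (rule nn_integral_lborel_shift[symmetric]) measurable
    also have "\<dots> = (\<integral>\<^sup>+z. indicator (ball 0 r) z * ennreal \<bar>f (y + z) - f y\<bar> \<partial>lborel)"
      by (intro nn_integral_cong) (simp add: indicator_def dist_norm add.commute)
    finally show ?thesis .
  qed
  then have "?I = (\<integral>\<^sup>+y. \<integral>\<^sup>+z. indicator (ball 0 r) z * ennreal \<bar>f (y + z) - f y\<bar> \<partial>lborel \<partial>lborel)"
    by simp
  also have "\<dots> = (\<integral>\<^sup>+z. \<integral>\<^sup>+y. indicator (ball 0 r) z * ennreal \<bar>f (y + z) - f y\<bar> \<partial>lborel \<partial>lborel)"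
    by (rule lborel_pair.Fubini') measurable
  also have "\<dots> = (\<integral>\<^sup>+z. indicator (ball 0 r) z * (\<integral>\<^sup>+y. ennreal \<bar>f (y + z) - f y\<bar> \<partial>lborel) \<partial>lborel)"
    by (intro nn_integral_cong nn_integral_cmult) measurable
  also have "\<dots> \<le> (\<integral>\<^sup>+z. ennreal e * indicator (ball 0 r) (z::'a) \<partial>lborel)"
    using osc by (intro nn_integral_mono) (auto simp: indicator_def)
  also have "\<dots> = ennreal e * ennreal (unit_ball_vol (DIM('a)) * r ^ DIM('a))"
    using \<open>r > 0\<close> by (subst nn_integral_cmult_indicator) (auto simp: emeasure_ball)
  finally have I: "?I \<le> ennreal e * ennreal (unit_ball_vol (DIM('a)) * r ^ DIM('a))" .
  have "(\<integral>\<^sup>+y. local_osc f r y \<partial>lborel) = ennreal (1 / r ^ DIM('a)) * ?I"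
    unfolding local_osc_def by (rule nn_integral_cmult) measurable
  also have "\<dots> \<le> ennreal (1 / r ^ DIM('a)) * (ennreal e * ennreal (unit_ball_vol (DIM('a)) * r ^ DIM('a)))"
    by (intro mult_left_mono I) simp
  also have "\<dots> = ennreal (unit_ball_vol (DIM('a)) * e)"
    using \<open>r > 0\<close> \<open>e \<ge> 0\<close> by (simp flip: ennreal_mult' ennreal_mult'' add: field_simps)
  finally show ?thesis .
qed

lemma ennreal_suminf_tendsto_zero:
  fixes f :: "nat \<Rightarrow> ennreal"
  assumes "(\<Sum>n. f n) \<noteq> \<infinity>"
  shows "f \<longlonglongrightarrow> 0"
proof -
  have fin: "f n \<noteq> \<infinity>" for n
    using assms by (metis ennreal_suminf_lessD infinity_ennreal_def less_top)
  define g where "g n = enn2real (f n)" for n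
  have fg: "f n = ennreal (g n)" for n unfolding g_def using fin[of n] by (simp add: less_top)
  have "summable g"
  proof (rule summable_suminf_not_top)
    show "0 \<le> g n" for n unfolding g_def by simp
    show "(\<Sum>n. ennreal (g n)) \<noteq> top" using assms unfolding fg[symmetric] by simp
  qed
  then have "g \<longlonglongrightarrow> 0" by (rule summable_LIMSEQ_zero)
  then have "(\<lambda>n. ennreal (g n)) \<longlonglongrightarrow> ennreal 0" by (rule tendsto_ennrealI)
  moreover have "f = (\<lambda>n. ennreal (g n))" using fg by blast
  ultimately show ?thesis by simp
qed

text \<open>A weak form of the Lebesgue differentiation theorem. The integrals of the oscillation
  tend to 0, so a subsequence has integrals below (1/2)^n. The series of oscillations is then
  integrable, hence finite almost everywhere, and its terms tend to 0 there.\<close>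

lemma local_osc_tendsto_AE:
  fixes f :: "'a::euclidean_space \<Rightarrow> real" and r :: "nat \<Rightarrow> real"
  assumes f: "integrable lborel f" and r: "\<And>m. r m > 0" "r \<longlonglongrightarrow> 0"
  obtains \<rho> where "strict_mono \<rho>" "AE y in lborel. (\<lambda>m. local_osc f (r (\<rho> m)) y) \<longlonglongrightarrow> 0"
proof -
  have fm [measurable]: "f \<in> borel_measurable borel" using f by auto
  define P where "P n N \<longleftrightarrow> (\<integral>\<^sup>+y. local_osc f (r N) y \<partial>lborel) \<le> ennreal ((1/2)^n)" for n N
  have ex: "\<exists>N0. \<forall>N\<ge>N0. P n N" for n
  proof -
    \<comment> \<open>Cancels the ball volume in \<open>nn_integral_local_osc_le\<close>, leaving
      the summable bound (1/2)^n.\<close>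
    define e where "e = (1/2)^n / unit_ball_vol (DIM('a))"
    have "e > 0" unfolding e_def by simp
    then obtain d where d: "d > 0" "\<And>z. norm z < d \<Longrightarrow> (\<integral>\<^sup>+x. ennreal \<bar>f (x + z) - f x\<bar> \<partial>lborel) \<le> ennreal e"
      using L1_shift_continuous_integrable[OF f] unfolding L1_shift_continuous_def by blast
    have "\<forall>\<^sub>F m in sequentially. r m < d" using order_tendstoD(2)[OF r(2) d(1)] .
    then obtain N0 where N0: "\<And>m. m \<ge> N0 \<Longrightarrow> r m < d" by (auto simp: eventually_sequentially)
    have "P n N" if "N \<ge> N0" for N
    proof -
      have "(\<integral>\<^sup>+y. local_osc f (r N) y \<partial>lborel) \<le> ennreal (unit_ball_vol (DIM('a)) * e)"
        using N0[OF that] d \<open>e > 0\<close> r(1) by (intro nn_integral_local_osc_le) auto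
      also have "unit_ball_vol (DIM('a)) * e = (1/2)^n"
        unfolding e_def using less_imp_neq[OF unit_ball_vol_pos[of "real DIM('a)"]] by simp
      finally show ?thesis unfolding P_def .
    qed
    then show ?thesis by blast
  qed
  obtain \<rho> where \<rho>: "strict_mono \<rho>" "\<And>n. P n (\<rho> n)"
  proof -
    obtain N0 where N0: "\<And>n N. N \<ge> N0 n \<Longrightarrow> P n N" using ex by metis
    define \<rho> where "\<rho> n = rec_nat (N0 0) (\<lambda>n x. max (Suc x) (N0 (Suc n))) n" for n
    have "\<rho> n < \<rho> (Suc n)" for n unfolding \<rho>_def by simp
    moreover have "P n (\<rho> n)" for n
      by (rule N0, cases n) (simp_all add: \<rho>_def)
    ultimately show thesis using that strict_mono_Suc_iff by blast
  qed
  have "(\<integral>\<^sup>+y. (\<Sum>n. local_osc f (r (\<rho> n)) y) \<partial>lborel) = (\<Sum>n. \<integral>\<^sup>+y. local_osc f (r (\<rho> n)) y \<partial>lborel)"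
    by (rule nn_integral_suminf) measurable
  also have "\<dots> \<le> (\<Sum>n. ennreal ((1/2)^n))"
    using \<rho>(2) unfolding P_def by (intro suminf_le) auto
  also have "\<dots> < \<infinity>"
    by (subst suminf_ennreal2) (auto simp: summable_geometric)
  finally have "(\<integral>\<^sup>+y. (\<Sum>n. local_osc f (r (\<rho> n)) y) \<partial>lborel) \<noteq> \<infinity>" by simp
  then have "AE y in lborel. (\<Sum>n. local_osc f (r (\<rho> n)) y) \<noteq> \<infinity>"
    by (intro nn_integral_PInf_AE) simp_all
  then have "AE y in lborel. (\<lambda>m. local_osc f (r (\<rho> m)) y) \<longlonglongrightarrow> 0"
  proof (rule AE_mp, intro AE_I2 impI)
    fix y assume "(\<Sum>n. local_osc f (r (\<rho> n)) y) \<noteq> \<infinity>"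
    then show "(\<lambda>m. local_osc f (r (\<rho> m)) y) \<longlonglongrightarrow> 0"
      by (intro ennreal_suminf_tendsto_zero)
  qed
  with \<rho>(1) show thesis by (rule that)
qed

subsection \<open>Convexity of powers\<close>

text \<open>The tangent to a^p at t lies below the graph. Dividing by t^p reduces this to 1 + p (x -
  1) <= x^p, which is Young's inequality with second factor 1. At t = 0 the left side vanishes
  because \<open>0 powr _\<close> is 0, also for p = 1.\<close>

lemma powr_ge_tangent:
  fixes a t p :: real
  assumes "a \<ge> 0" "t \<ge> 0" "p \<ge> 1"
  shows "t powr p + p * t powr (p - 1) * (a - t) \<le> a powr p"
proof (cases "t = 0")
  case False
  with assms have t: "t > 0" by simp
  define x where "x = a / t"
  have x: "x \<ge> 0" using assms t by (simp add: x_def)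
  have "1 + p * (x - 1) \<le> x powr p"
  proof (cases "x = 0")
    case False
    then have "x = (x powr p) powr (1/p) * 1 powr (1 - 1/p)"
      using x assms by (simp add: powr_powr)
    also have "\<dots> \<le> (1/p) * (x powr p) + (1 - 1/p) * 1"
      by (rule Youngs_inequality_0) (use assms False x in auto)
    finally have "p * x \<le> p * ((1/p) * (x powr p) + (1 - 1/p) * 1)"
      using assms by (intro mult_left_mono) auto
    also have "\<dots> = x powr p + p - 1" using assms by (simp add: field_simps)
    finally show ?thesis by (simp add: algebra_simps)
  qed (use assms in simp)
  then have "t powr p * (1 + p * (x - 1)) \<le> t powr p * x powr p"
    by (intro mult_left_mono) auto
  also have "\<dots> = a powr p" using t x assms by (simp add: x_def flip: powr_mult)
  also have "t powr p * (1 + p * (x - 1)) = t powr p + p * t powr (p - 1) * (a - t)"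
    using t by (simp add: x_def powr_diff field_simps)
  finally show ?thesis .
qed simp

text \<open>Jensen with weights of arbitrary total mass W: summing the tangent inequalities at the
  weighted mean t cancels the linear terms. Rescaling the weights to mass 1 costs the factor
  W^(p-1).\<close>

lemma sum_weighted_powr_le:
  fixes w d :: "'i \<Rightarrow> real"
  assumes "finite I" "\<And>i. i \<in> I \<Longrightarrow> w i \<ge> 0" "\<And>i. i \<in> I \<Longrightarrow> d i \<ge> 0" "p \<ge> 1"
  shows "(\<Sum>i\<in>I. w i * d i) powr p \<le> (\<Sum>i\<in>I. w i) powr (p - 1) * (\<Sum>i\<in>I. w i * d i powr p)"
proof (cases "(\<Sum>i\<in>I. w i) = 0")
  case True
  then have "w i = 0" if "i \<in> I" for i
    using assms that sum_nonneg_eq_0_iff[of I w] by auto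
  then show ?thesis by simp
next
  case False
  define W where "W = (\<Sum>i\<in>I. w i)"
  define t where "t = (\<Sum>i\<in>I. w i * d i) / W"
  have W: "W > 0" using False assms sum_nonneg[of I w] by (simp add: W_def less_le)
  have s0: "(\<Sum>i\<in>I. w i * d i) \<ge> 0" using assms by (intro sum_nonneg) auto
  have t: "t \<ge> 0" using W s0 by (simp add: t_def)
  have tW: "t * W = (\<Sum>i\<in>I. w i * d i)" using W by (simp add: t_def)
  have "W * t powr p = (\<Sum>i\<in>I. w i * (t powr p + p * t powr (p - 1) * (d i - t)))"
  proof -
    have "(\<Sum>i\<in>I. w i * (t powr p + p * t powr (p - 1) * (d i - t)))
       = (\<Sum>i\<in>I. w i * t powr p) + (\<Sum>i\<in>I. p * t powr (p - 1) * (w i * d i)) - (\<Sum>i\<in>I. p * t powr (p-1) * t * w i)"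
      by (simp flip: sum.distrib sum_subtractf add: algebra_simps)
    also have "\<dots> = W * t powr p + p * t powr (p - 1) * (\<Sum>i\<in>I. w i * d i) - p * t powr (p-1) * t * W"
      by (simp add: sum_distrib_left[symmetric] sum_distrib_right[symmetric] W_def)
    finally show ?thesis unfolding tW[symmetric] by (simp add: algebra_simps)
  qed
  also have "\<dots> \<le> (\<Sum>i\<in>I. w i * d i powr p)"
    using assms t by (intro sum_mono mult_left_mono powr_ge_tangent) auto
  finally have "W powr (p - 1) * (W * t powr p) \<le> W powr (p - 1) * (\<Sum>i\<in>I. w i * d i powr p)"
    by (intro mult_left_mono) auto
  moreover have "W powr (p - 1) * (W * t powr p) = (\<Sum>i\<in>I. w i * d i) powr p"
    using W t by (simp add: tW[symmetric] powr_mult powr_diff)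
  ultimately show ?thesis by (simp add: W_def)
qed

lemma sum_powr_le:
  fixes d :: "'i \<Rightarrow> real"
  assumes "finite I" "\<And>i. i \<in> I \<Longrightarrow> d i \<ge> 0" "p \<ge> 1"
  shows "(\<Sum>i\<in>I. d i) powr p \<le> real (card I) powr (p - 1) * (\<Sum>i\<in>I. d i powr p)"
  using sum_weighted_powr_le[of I "\<lambda>_. 1" d p] assms by simp

lemma add_powr_le:
  fixes a b p :: real
  assumes "a \<ge> 0" "b \<ge> 0" "p \<ge> 1"
  shows "(a + b) powr p \<le> 2 powr (p - 1) * (a powr p + b powr p)"
  using sum_powr_le[of "{True, False}" "\<lambda>i. if i then a else b" p] assms by simp

text \<open>Jensen for a probability density w, with the tangent taken at t = |\<integral> w g|. As
  t is at most the mean of |g|, the linear term is nonnegative and may simply be added. An infinite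
  right side is the trivial case.\<close>

lemma abs_integral_weighted_powr_le:
  fixes w g :: "'b \<Rightarrow> real"
  assumes [measurable]: "w \<in> borel_measurable M" "g \<in> borel_measurable M"
    and w: "\<And>x. w x \<ge> 0" "integrable M w" "(\<integral>x. w x \<partial>M) = 1"
    and int: "integrable M (\<lambda>x. w x * g x)" and p: "p \<ge> 1"
  shows "ennreal (\<bar>\<integral>x. w x * g x \<partial>M\<bar> powr p) \<le> (\<integral>\<^sup>+x. ennreal (w x * \<bar>g x\<bar> powr p) \<partial>M)"
proof (cases "(\<integral>\<^sup>+x. ennreal (w x * \<bar>g x\<bar> powr p) \<partial>M) = \<infinity>")
  case False
  have nonneg: "w x * \<bar>g x\<bar> powr p \<ge> 0" for x using w(1) by simp
  have I: "integrable M (\<lambda>x. w x * \<bar>g x\<bar> powr p)"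
    using False nonneg by (intro integrableI_nonneg) (auto simp: less_top)
  define t where "t = \<bar>\<integral>x. w x * g x \<partial>M\<bar>"
  have t: "t \<ge> 0" by (simp add: t_def)
  have ia: "integrable M (\<lambda>x. w x * \<bar>g x\<bar>)"
    using integrable_abs[OF int] w(1) by (simp add: abs_mult)
  have "t \<le> (\<integral>x. \<bar>w x * g x\<bar> \<partial>M)" unfolding t_def by (rule integral_abs_bound)
  then have le: "t \<le> (\<integral>x. w x * \<bar>g x\<bar> \<partial>M)" using w(1) by (simp add: abs_mult)
  have "t powr p \<le> t powr p + p * t powr (p - 1) * ((\<integral>x. w x * \<bar>g x\<bar> \<partial>M) - t)"
    using le p by simp
  also have "\<dots> = (\<integral>x. (t powr p - p * t powr (p - 1) * t) * w x + p * t powr (p - 1) * (w x * \<bar>g x\<bar>) \<partial>M)"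
    using w ia
    by (subst Bochner_Integration.integral_add) (auto simp: right_diff_distrib)
  also have "\<dots> \<le> (\<integral>x. w x * \<bar>g x\<bar> powr p \<partial>M)"
  proof (rule integral_mono)
    fix x
    have "w x * (t powr p + p * t powr (p - 1) * (\<bar>g x\<bar> - t)) \<le> w x * \<bar>g x\<bar> powr p"
      using w(1) t p by (intro mult_left_mono powr_ge_tangent) auto
    then show "(t powr p - p * t powr (p - 1) * t) * w x + p * t powr (p - 1) * (w x * \<bar>g x\<bar>) \<le> w x * \<bar>g x\<bar> powr p"
      by (simp add: algebra_simps)
  qed (use w ia I in auto)
  finally have "ennreal (t powr p) \<le> ennreal (\<integral>x. w x * \<bar>g x\<bar> powr p \<partial>M)"
    by (rule ennreal_leI)
  also have "\<dots> = (\<integral>\<^sup>+x. ennreal (w x * \<bar>g x\<bar> powr p) \<partial>M)"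
    using I nonneg by (intro nn_integral_eq_integral[symmetric]) auto
  finally show ?thesis by (simp add: t_def)
qed simp

section \<open>Averages over balls\<close>

lemma set_integrable_ball:
  fixes f :: "'a::euclidean_space \<Rightarrow> real"
  assumes "integrable lborel f"
  shows "integrable lborel (\<lambda>x. indicator (ball c r) x * f x)"
  using integrable_mult_indicator[of "ball c r" lborel f] assms by simp

text \<open>Written as an integral against a probability density, the form to which
  \<open>abs_integral_weighted_powr_le\<close> applies.\<close>

definition ball_avg :: "('a::euclidean_space \<Rightarrow> real) \<Rightarrow> 'a \<Rightarrow> real \<Rightarrow> real" where
  "ball_avg f c r = (\<integral>x. indicator (ball c r) x / measure lborel (ball c r) * f x \<partial>lborel)"

lemma measure_ball_pos: "r > 0 \<Longrightarrow> measure lborel (ball (c::'a::euclidean_space) r) > 0"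
  using content_ball_pos[of r c] by simp

lemma diff_ball_avg_powr_le:
  fixes f :: "'a::euclidean_space \<Rightarrow> real"
  assumes f: "integrable lborel f" and r: "r > 0" and p: "p \<ge> 1"
  shows "ennreal (\<bar>a - ball_avg f c r\<bar> powr p) \<le>
    ennreal (1 / measure lborel (ball c r)) * (\<integral>\<^sup>+x. indicator (ball c r) x * ennreal (\<bar>a - f x\<bar> powr p) \<partial>lborel)"
proof -
  have [measurable]: "f \<in> borel_measurable borel" using f by auto
  define m where "m = measure lborel (ball c r)"
  have m: "m > 0" unfolding m_def by (rule measure_ball_pos[OF r])
  define w where "w x = indicator (ball c r) x / m" for x
  have [measurable]: "w \<in> borel_measurable borel" unfolding w_def[abs_def] by measurable
  have iw: "integrable lborel w"
    unfolding w_def[abs_def] by (intro integrable_divide_zero integrable_real_indicator) (auto simp: emeasure_ball r less_imp_le)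
  have wI: "(\<integral>x. w x \<partial>lborel) = 1"
    using m r unfolding w_def by (simp add: m_def)
  have wf: "integrable lborel (\<lambda>x. w x * f x)"
    using integrable_divide_zero[of m lborel "\<lambda>x. indicator (ball c r) x * f x"] set_integrable_ball[OF f]
    unfolding w_def by simp
  have "a - ball_avg f c r = (\<integral>x. w x * a \<partial>lborel) - (\<integral>x. w x * f x \<partial>lborel)"
    using wI unfolding ball_avg_def w_def m_def by (subst integral_mult_left_zero) simp
  also have "\<dots> = (\<integral>x. w x * (a - f x) \<partial>lborel)"
    by (subst Bochner_Integration.integral_diff[symmetric]) (use iw wf in \<open>auto simp: right_diff_distrib\<close>)
  finally have "ennreal (\<bar>a - ball_avg f c r\<bar> powr p) = ennreal (\<bar>\<integral>x. w x * (a - f x) \<partial>lborel\<bar> powr p)" by simp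
  also have "\<dots> \<le> (\<integral>\<^sup>+x. ennreal (w x * \<bar>a - f x\<bar> powr p) \<partial>lborel)"
  proof (rule abs_integral_weighted_powr_le)
    show "integrable lborel (\<lambda>x. w x * (a - f x))" using iw wf by (simp add: right_diff_distrib)
  qed (use iw wI p m in \<open>simp_all add: w_def[abs_def]\<close>)
  also have "\<dots> = (\<integral>\<^sup>+x. ennreal (1 / m) * (indicator (ball c r) x * ennreal (\<bar>a - f x\<bar> powr p)) \<partial>lborel)"
    using m by (intro nn_integral_cong) (auto simp: w_def indicator_def simp flip: ennreal_mult')
  also have "\<dots> = ennreal (1 / m) * (\<integral>\<^sup>+x. indicator (ball c r) x * ennreal (\<bar>a - f x\<bar> powr p) \<partial>lborel)"
    by (rule nn_integral_cmult) measurable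
  finally show ?thesis unfolding m_def .
qed

text \<open>Averages over balls that are not centred at y, and may miss it, still converge to f y at
  a Lebesgue point, as long as a ball about y of comparable radius M r contains them. The factor M^n
  is the ratio of the volumes.\<close>

lemma diff_ball_avg_le_local_osc:
  fixes f :: "'a::euclidean_space \<Rightarrow> real"
  assumes f: "integrable lborel f" and r: "r > 0" and sub: "ball c r \<subseteq> ball y (M * r)" and M: "M > 0"
  shows "ennreal \<bar>f y - ball_avg f c r\<bar> \<le> ennreal (M ^ DIM('a) / unit_ball_vol (DIM('a))) * local_osc f (M * r) y"
proof -
  have [measurable]: "f \<in> borel_measurable borel" using f by auto
  have v: "unit_ball_vol (real DIM('a)) > 0" by (rule unit_ball_vol_pos) simp
  have "ennreal \<bar>f y - ball_avg f c r\<bar>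
     \<le> ennreal (1 / measure lborel (ball c r)) * (\<integral>\<^sup>+x. indicator (ball c r) x * ennreal \<bar>f y - f x\<bar> \<partial>lborel)"
    using diff_ball_avg_powr_le[OF f r order_refl, of "f y" c] by simp
  also have "\<dots> \<le> ennreal (1 / measure lborel (ball c r)) * (\<integral>\<^sup>+x. indicator (ball y (M * r)) x * ennreal \<bar>f x - f y\<bar> \<partial>lborel)"
    using sub by (intro mult_left_mono nn_integral_mono) (auto simp: indicator_def abs_minus_commute)
  also have "measure lborel (ball c r) = unit_ball_vol (real DIM('a)) * r ^ DIM('a)"
    using content_ball[of r c] r by simp
  also have "1 / (unit_ball_vol (real DIM('a)) * r ^ DIM('a)) = M ^ DIM('a) / unit_ball_vol (DIM('a)) * (1 / (M * r) ^ DIM('a))"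
    using v r M by (simp add: field_simps power_mult_distrib)
  also have "ennreal \<dots> = ennreal (M ^ DIM('a) / unit_ball_vol (DIM('a))) * ennreal (1 / (M * r) ^ DIM('a))"
    using v M r by (intro ennreal_mult) auto
  finally show ?thesis unfolding local_osc_def by (simp only: mult.assoc)
qed

subsection \<open>Geometry of John domains\<close>

text \<open>A ball that leaves U is connected and so meets the frontier, at a point closer than
  \<open>bdist\<close>. For an empty frontier \<open>bdist\<close> is 0 and the ball is
  empty.\<close>

lemma ball_bdist_subset:
  assumes "open U" "x \<in> U"
  shows "ball x (bdist U x) \<subseteq> U"
proof (rule ccontr)
  assume n: "\<not> ball x (bdist U x) \<subseteq> U"
  then obtain y where y: "y \<in> ball x (bdist U x)" "y \<notin> U" by blast
  then have "bdist U x > 0" by (metis ball_empty empty_iff not_le)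
  then have "x \<in> ball x (bdist U x)" by simp
  then have "ball x (bdist U x) \<inter> frontier U \<noteq> {}"
    using assms y by (intro connected_Int_frontier connected_ball) blast+
  then obtain w where w: "w \<in> ball x (bdist U x)" "w \<in> frontier U" by blast
  have "bdist U x \<le> dist x w" unfolding bdist_def by (rule infdist_le[OF w(2)])
  with w(1) show False by simp
qed

lemma bdist_diff_le: "\<bar>bdist U x - bdist U y\<bar> \<le> dist x y"
  unfolding bdist_def by (rule infdist_triangle_abs)

lemma continuous_bdist [continuous_intros]: "continuous_on S (bdist U)"
  unfolding bdist_def by (intro continuous_intros)

lemma bdist_measurable [measurable]: "bdist U \<in> borel_measurable borel"
  by (intro borel_measurable_continuous_onI continuous_bdist)

lemma bdist_nonneg: "bdist U x \<ge> 0"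
  unfolding bdist_def by (rule infdist_nonneg)

text \<open>A frontier point of V closer to x than \<open>bdist U x\<close> would lie in U, hence in
  the open set V. Boundedness of V makes its frontier nonempty; otherwise \<open>infdist\<close>
  would be 0 and the inequality could fail.\<close>

lemma bdist_mono:
  fixes U V :: "'a::euclidean_space set"
  assumes "open U" "U \<subseteq> V" "open V" "x \<in> U" "bounded V"
  shows "bdist U x \<le> bdist V x"
proof -
  have ne: "frontier V \<noteq> {}"
    using assms frontier_eq_empty[of V] not_bounded_UNIV by auto
  have "bdist U x \<le> dist x w" if w: "w \<in> frontier V" for w
  proof (rule ccontr)
    assume "\<not> bdist U x \<le> dist x w"
    then have "w \<in> ball x (bdist U x)" by simp
    then have "w \<in> V" using ball_bdist_subset[OF assms(1,4)] assms(2) by blast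
    then show False using w assms(3) by (simp add: frontier_def interior_open)
  qed
  then show ?thesis
    unfolding bdist_def[of V] infdist_def using ne by (auto intro!: cINF_greatest)
qed

text \<open>The speed bound holds off a null set only. Setting the velocity to 0 on that set leaves
  its integral unchanged and makes the bound valid everywhere.\<close>

lemma bounded_speed_curve_dist_le:
  fixes c :: "real \<Rightarrow> 'a::euclidean_space"
  assumes c: "bounded_speed_curve k c" and st: "0 \<le> s" "s \<le> t" "t \<le> 1" and k: "k \<ge> 0"
  shows "dist (c s) (c t) \<le> k * (t - s)"
proof -
  from c obtain v where v: "AE t in lebesgue_on {0..1}. (c has_vector_derivative v t) (at t within {0..1}) \<and> norm (v t) \<le> k"
    "\<And>t. t \<in> {0..1} \<Longrightarrow> (v has_integral (c t - c 0)) {0..t}"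
    unfolding bounded_speed_curve_def by blast
  have "AE t in lebesgue. t \<in> {0..1} \<longrightarrow> norm (v t) \<le> k"
    using v(1) by (subst (asm) AE_restrict_space_iff) auto
  then obtain N where N: "N \<in> null_sets lebesgue" "{t. \<not> (t \<in> {0..1} \<longrightarrow> norm (v t) \<le> k)} \<subseteq> N"
    by (auto simp: eventually_ae_filter)
  define u where "u t = (if t \<in> N then 0 else v t)" for t
  have vs: "(v has_integral (c s - c 0)) {0..s}" and vt: "(v has_integral (c t - c 0)) {0..t}"
    using v(2) st by auto
  have "v integrable_on {s..t}"
    using vt st by (meson has_integral_integrable integrable_on_subinterval atLeastatMost_subset_iff order_refl)
  then have i: "(v has_integral integral {s..t} v) {s..t}" by (rule integrable_integral)
  have "(v has_integral (c s - c 0) + integral {s..t} v) {0..t}"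
    by (rule has_integral_combine[OF _ _ vs i]) (use st in auto)
  then have "c t - c 0 = c s - c 0 + integral {s..t} v"
    using vt has_integral_unique by blast
  then have "integral {s..t} v = c t - c s" by simp
  with i have "(v has_integral (c t - c s)) {s..t}" by simp
  then have "(u has_integral (c t - c s)) {s..t}"
    by (rule has_integral_spike[of N, rotated 2])
       (use N in \<open>auto simp: u_def negligible_iff_null_sets\<close>)
  then have "norm (c t - c s) \<le> k * measure lborel {s..t}"
  proof (rule has_integral_bound_real[OF k, of "{}", rotated])
    fix x assume "x \<in> {s..t} - {}"
    then have "x \<in> {0..1}" using st by auto
    then show "norm (u x) \<le> k" using N(2) k by (cases "x \<in> N") (auto simp: u_def)
  qed simp
  then show ?thesis using st by (simp add: dist_norm norm_minus_commute)
qed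


subsection \<open>The Poincare inequality on John domains\<close>

text \<open>The inner integral of the fractional seminorm with radius function D and kernel exponent
  e left free. D will be half the distance to the boundary of a piece or of \<Omega>, or its minimum
  with c l; e moves between n + \<sigma> p and n + s p.\<close>

definition frac_density :: "('a::euclidean_space \<Rightarrow> real) \<Rightarrow> real \<Rightarrow> real \<Rightarrow> ('a \<Rightarrow> real) \<Rightarrow> 'a \<Rightarrow> ennreal" where
  "frac_density D e p f x = (\<integral>\<^sup>+z. indicator {z. norm (x - z) < D x} z *
      ennreal (\<bar>f x - f z\<bar> powr p / norm (x - z) powr e) \<partial>lborel)"

lemma frac_density_measurable [measurable]:
  fixes f :: "'a::euclidean_space \<Rightarrow> real"
  assumes [measurable]: "f \<in> borel_measurable borel" "D \<in> borel_measurable borel"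
  shows "frac_density D e p f \<in> borel_measurable borel"
proof -
  have "(\<lambda>x. \<integral>\<^sup>+z. indicator {w. norm (fst w - snd w) < D (fst w)} (x, z) *
      ennreal (\<bar>f x - f z\<bar> powr p / norm (x - z) powr e) \<partial>lborel) \<in> borel_measurable borel"
    by measurable
  also have "(\<lambda>x. \<integral>\<^sup>+z. indicator {w. norm (fst w - snd w) < D (fst w)} (x, z) *
      ennreal (\<bar>f x - f z\<bar> powr p / norm (x - z) powr e) \<partial>lborel) = frac_density D e p f"
    by (intro ext) (simp add: frac_density_def indicator_def)
  finally show ?thesis .
qed

lemma frac_density_mono:
  assumes "D x \<le> D' x"
  shows "frac_density D e p f x \<le> frac_density D' e p f x"
  unfolding frac_density_def using assms
  by (intro nn_integral_mono) (auto simp: indicator_def)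

text \<open>Jensen in each variable bounds the left side by a double mean of |f x - f z|^p. By
  \<open>near\<close> every pair lies in the region of the density and satisfies |x - z|^e <= R^e,
  which inserts the kernel.\<close>

lemma diff_ball_avg_frac_density:
  fixes f :: "'a::euclidean_space \<Rightarrow> real"
  assumes f: "integrable lborel f" and [measurable]: "D \<in> borel_measurable borel"
    and r: "r > 0" "r' > 0" and p: "p \<ge> 1" and e: "e \<ge> 0"
    and near: "\<And>x z. x \<in> ball c r \<Longrightarrow> z \<in> ball c' r' \<Longrightarrow> norm (x - z) < D x \<and> norm (x - z) \<le> R"
  shows "ennreal (\<bar>ball_avg f c r - ball_avg f c' r'\<bar> powr p) \<le>
    ennreal (R powr e / (measure lborel (ball c r) * measure lborel (ball c' r'))) *
    (\<integral>\<^sup>+x. indicator (ball c r) x * frac_density D e p f x \<partial>lborel)"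
proof -
  have [measurable]: "f \<in> borel_measurable borel" using f by auto
  define m m' where "m = measure lborel (ball c r)" and "m' = measure lborel (ball c' r')"
  have m: "m > 0" "m' > 0" using r by (auto simp: m_def m'_def measure_ball_pos)
  have pt: "ennreal (\<bar>f x - ball_avg f c' r'\<bar> powr p) \<le> ennreal (R powr e / m') * frac_density D e p f x"
    if x: "x \<in> ball c r" for x
  proof -
    have "ennreal (\<bar>f x - ball_avg f c' r'\<bar> powr p)
       \<le> ennreal (1 / m') * (\<integral>\<^sup>+z. indicator (ball c' r') z * ennreal (\<bar>f x - f z\<bar> powr p) \<partial>lborel)"
      unfolding m'_def by (rule diff_ball_avg_powr_le) (use f r p in auto)
    also have "\<dots> \<le> ennreal (1 / m') * (\<integral>\<^sup>+z. ennreal (R powr e) * (indicator {z. norm (x - z) < D x} z *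
      ennreal (\<bar>f x - f z\<bar> powr p / norm (x - z) powr e)) \<partial>lborel)"
    proof (intro mult_left_mono nn_integral_mono)
      fix z
      show "indicator (ball c' r') z * ennreal (\<bar>f x - f z\<bar> powr p)
        \<le> ennreal (R powr e) * (indicator {z. norm (x - z) < D x} z *
            ennreal (\<bar>f x - f z\<bar> powr p / norm (x - z) powr e))"
      proof (cases "z \<in> ball c' r' \<and> x \<noteq> z")
        case True
        with near[OF x, of z] have n: "norm (x - z) < D x" "norm (x - z) \<le> R" by auto
        have pos: "norm (x - z) > 0" using True by simp
        have "\<bar>f x - f z\<bar> powr p = norm (x - z) powr e * (\<bar>f x - f z\<bar> powr p / norm (x - z) powr e)"
          using pos by simp
        also have "\<dots> \<le> R powr e * (\<bar>f x - f z\<bar> powr p / norm (x - z) powr e)"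
          using n pos e by (intro mult_right_mono powr_mono2) auto
        finally show ?thesis using n True by (simp add: ennreal_leI flip: ennreal_mult')
      next
        case False
        then show ?thesis by (cases "x = z") (auto simp: indicator_def)
      qed
    qed simp
    also have "\<dots> = ennreal (1 / m') * (ennreal (R powr e) * frac_density D e p f x)"
    proof -
      have [measurable]: "{z. norm (x - z) < D x} \<in> sets borel" by measurable
      show ?thesis unfolding frac_density_def by (subst nn_integral_cmult) simp_all
    qed
    also have "\<dots> = ennreal (R powr e / m') * frac_density D e p f x"
      using m by (simp flip: mult.assoc ennreal_mult')
    finally show ?thesis .
  qed
  have "ennreal (\<bar>ball_avg f c r - ball_avg f c' r'\<bar> powr p) = ennreal (\<bar>ball_avg f c' r' - ball_avg f c r\<bar> powr p)"
    by (simp add: abs_minus_commute)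
  also have "\<dots> \<le> ennreal (1 / m) * (\<integral>\<^sup>+x. indicator (ball c r) x * ennreal (\<bar>ball_avg f c' r' - f x\<bar> powr p) \<partial>lborel)"
    unfolding m_def by (rule diff_ball_avg_powr_le) (use f r p in auto)
  also have "\<dots> \<le> ennreal (1 / m) * (\<integral>\<^sup>+x. indicator (ball c r) x * (ennreal (R powr e / m') * frac_density D e p f x) \<partial>lborel)"
  proof (rule mult_left_mono[OF nn_integral_mono])
    fix x
    show "indicator (ball c r) x * ennreal (\<bar>ball_avg f c' r' - f x\<bar> powr p)
      \<le> indicator (ball c r) x * (ennreal (R powr e / m') * frac_density D e p f x)"
      using pt[of x] by (cases "x \<in> ball c r") (simp_all add: abs_minus_commute)
  qed simp
  also have "\<dots> = ennreal (1 / m) * (ennreal (R powr e / m') * (\<integral>\<^sup>+x. indicator (ball c r) x * frac_density D e p f x \<partial>lborel))"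
    by (subst mult.left_commute, subst nn_integral_cmult) simp_all
  also have "\<dots> = ennreal (R powr e / (m * m')) * (\<integral>\<^sup>+x. indicator (ball c r) x * frac_density D e p f x \<partial>lborel)"
    using m by (simp add: ac_simps flip: mult.assoc ennreal_mult')
  finally show ?thesis unfolding m_def m'_def .
qed

text \<open>Telescoping, with each increment x_k written as \<beta>^k (x_k / \<beta>^k) so that
  Jensen with weights \<beta>^k, of total mass at most 1 / (1 - \<beta>), applies to chains of any
  length. The bound is uniform in the length, so convergence along a subsequence suffices to reach
  v.\<close>

lemma geometric_chain_powr_le:
  fixes a :: "nat \<Rightarrow> real" and d :: "nat \<Rightarrow> ennreal"
  assumes \<rho>: "strict_mono \<rho>" "(\<lambda>m. a (\<rho> m)) \<longlonglongrightarrow> v" and \<beta>: "0 < \<beta>" "\<beta> < 1" and p: "p \<ge> 1"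
    and d: "\<And>k. ennreal (\<bar>a k - a (Suc k)\<bar> powr p) \<le> d k"
  shows "ennreal (\<bar>v - a 0\<bar> powr p) \<le>
    ennreal ((1 / (1 - \<beta>)) powr (p - 1)) * (\<Sum>k. ennreal ((\<beta> ^ k) powr (1 - p)) * d k)"
proof -
  define S where "S = (\<Sum>k. ennreal ((\<beta> ^ k) powr (1 - p)) * d k)"
  define W where "W = (1 / (1 - \<beta>)) powr (p - 1)"
  have step: "ennreal (\<bar>a N - a 0\<bar> powr p) \<le> ennreal W * S" for N
  proof -
    let ?x = "\<lambda>k. \<bar>a k - a (Suc k)\<bar>"
    have "\<bar>a N - a 0\<bar> \<le> (\<Sum>k<N. ?x k)"
    proof (induction N)
      case (Suc N)
      then show ?case by (simp add: abs_if split: if_splits)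
    qed simp
    also have "\<dots> = (\<Sum>k<N. \<beta>^k * (?x k / \<beta>^k))" using \<beta> by simp
    finally have "\<bar>a N - a 0\<bar> powr p \<le> (\<Sum>k<N. \<beta>^k * (?x k / \<beta>^k)) powr p"
      using p by (intro powr_mono2) auto
    also have "\<dots> \<le> (\<Sum>k<N. \<beta>^k) powr (p - 1) * (\<Sum>k<N. \<beta>^k * (?x k / \<beta>^k) powr p)"
      using \<beta> p by (intro sum_weighted_powr_le) auto
    also have "(\<Sum>k<N. \<beta>^k * (?x k / \<beta>^k) powr p) = (\<Sum>k<N. (\<beta>^k) powr (1 - p) * ?x k powr p)"
      using \<beta> by (intro sum.cong) (auto simp: powr_divide powr_diff field_simps)
    also have "(\<Sum>k<N. \<beta>^k) powr (p - 1) * (\<Sum>k<N. (\<beta>^k) powr (1 - p) * ?x k powr p)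
       \<le> W * (\<Sum>k<N. (\<beta>^k) powr (1 - p) * ?x k powr p)"
    proof (intro mult_right_mono sum_nonneg)
      have "(\<Sum>k<N. \<beta>^k) \<le> (\<Sum>k. \<beta>^k)" using \<beta> by (intro sum_le_suminf) (auto simp: summable_geometric)
      also have "\<dots> = 1 / (1 - \<beta>)" using \<beta> by (simp add: suminf_geometric)
      finally show "(\<Sum>k<N. \<beta>^k) powr (p - 1) \<le> W"
        unfolding W_def using p \<beta> by (intro powr_mono2 sum_nonneg) auto
    qed auto
    finally have "ennreal (\<bar>a N - a 0\<bar> powr p) \<le> ennreal (W * (\<Sum>k<N. (\<beta>^k) powr (1 - p) * ?x k powr p))"
      by (rule ennreal_leI)
    also have "\<dots> = ennreal W * (\<Sum>k<N. ennreal ((\<beta>^k) powr (1 - p)) * ennreal (?x k powr p))"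
      by (subst ennreal_mult') (auto simp: W_def simp flip: ennreal_mult' sum_ennreal)
    also have "\<dots> \<le> ennreal W * (\<Sum>k<N. ennreal ((\<beta>^k) powr (1 - p)) * d k)"
      by (intro mult_left_mono sum_mono d) auto
    also have "\<dots> \<le> ennreal W * S"
      unfolding S_def by (intro mult_left_mono sum_le_suminf) auto
    finally show ?thesis .
  qed
  have "(\<lambda>m. \<bar>a (\<rho> m) - a 0\<bar> powr p) \<longlonglongrightarrow> \<bar>v - a 0\<bar> powr p"
    using p by (intro tendsto_powr2 tendsto_intros \<rho>(2)) auto
  then have "(\<lambda>m. ennreal (\<bar>a (\<rho> m) - a 0\<bar> powr p)) \<longlonglongrightarrow> ennreal (\<bar>v - a 0\<bar> powr p)"
    by (rule tendsto_ennrealI)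
  then have "ennreal (\<bar>v - a 0\<bar> powr p) \<le> ennreal W * S"
    by (rule LIMSEQ_le_const2) (use step in blast)
  then show ?thesis unfolding S_def W_def .
qed

text \<open>The estimate at y is integrated over U. By Fubini the density at x is charged only by
  those y within M r_j, which compensates one of the two ball volumes in the denominator. Every
  radius is proportional to l, so the only trace of the scale is
  \<open>l powr (\<sigma> * p)\<close>.\<close>

theorem John_Poincare:
  fixes p \<sigma> lam k :: real
  assumes p: "p \<ge> 1" and \<sigma>: "\<sigma> > 0" and lam: "lam > 0" and k: "k > 0"
  obtains C where "C > 0"
    "\<And>l (U :: 'a::euclidean_space set) f. l > 0 \<Longrightarrow> John_domain U (lam * l) (k * l) \<Longrightarrow> integrable lborel f \<Longrightarrow>
       \<exists>a. (\<integral>\<^sup>+y. indicator U y * ennreal (\<bar>f y - a\<bar> powr p) \<partial>lborel) \<le> ennreal (C * l powr (\<sigma> * p)) *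
         (\<integral>\<^sup>+x. indicator U x * frac_density (\<lambda>x. bdist U x / 2) (real DIM('a) + \<sigma> * p) p f x \<partial>lborel)"
proof -
  define n where "n = DIM('a)"
  define e where "e = real n + \<sigma> * p"
  \<comment> \<open>The curve is sampled at times q^j. This q gives k (1 - q) <= lam / 8, so
    consecutive centres are at most one radius r_j apart, and 8 lam in the denominator keeps q
    positive. \<beta> is the decay rate of r_j^\<sigma>. M accounts for the distance from y to the
    j-th centre, at most k l q^j = (8 k / lam) r_j, plus one radius.\<close>
  define q where "q = 1 - lam / (8 * k + 8 * lam)"
  define \<beta> where "\<beta> = q powr \<sigma>"
  define M where "M = 8 * k / lam + 1"
  define V where "V = unit_ball_vol (real n)"
  define W where "W = (1 / (1 - \<beta>)) powr (p - 1)"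
  define C where "C = W * (3 powr e / q ^ n / V * M ^ n * (lam / 8) powr (\<sigma> * p) * (1 / (1 - \<beta>)))"
  have V: "V > 0" unfolding V_def by (rule unit_ball_vol_pos) simp
  have q: "q > 0" "q < 1" "k * (1 - q) \<le> lam / 8"
    using lam k by (auto simp: q_def field_simps)
  have \<beta>: "\<beta> > 0" "\<beta> < 1" using q \<sigma> powr_less_mono2[of \<sigma> q 1] by (auto simp: \<beta>_def)
  have M: "M > 0" using lam k by (simp add: M_def add_pos_pos)
  have W: "W > 0" using \<beta> by (simp add: W_def)
  have C: "C > 0" using W V q M \<beta> lam by (simp add: C_def)
  have e: "e \<ge> 0" using \<sigma> p by (simp add: e_def)
  have main: "\<exists>a. (\<integral>\<^sup>+y. indicator U y * ennreal (\<bar>f y - a\<bar> powr p) \<partial>lborel) \<le> ennreal (C * l powr (\<sigma> * p)) *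
         (\<integral>\<^sup>+x. indicator U x * frac_density (\<lambda>x. bdist U x / 2) e p f x \<partial>lborel)"
    if l: "l > 0" and J: "John_domain U (lam * l) (k * l)" and f: "integrable lborel f"
    for l and U :: "'a set" and f
  proof -
    have [measurable]: "f \<in> borel_measurable borel" using f by auto
    from J obtain x0 \<gamma> where U: "domain_on U" "bounded U" and x0: "x0 \<in> U" and
      \<gamma>: "\<And>y t. y \<in> U \<Longrightarrow> t \<in> {0..1} \<Longrightarrow> \<gamma> t y \<in> U" "\<And>y. y \<in> U \<Longrightarrow> \<gamma> 0 y = y" "\<And>y. y \<in> U \<Longrightarrow> \<gamma> 1 y = x0"
        "\<And>y t. y \<in> U \<Longrightarrow> t \<in> {0..1} \<Longrightarrow> bdist U (\<gamma> t y) \<ge> lam * l * t"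
        "\<And>y. y \<in> U \<Longrightarrow> bounded_speed_curve (k * l) (\<lambda>t. \<gamma> t y)"
      unfolding John_domain_def by blast
    have oU: "open U" using U by (simp add: domain_on_def)
    have [measurable]: "U \<in> sets borel" using oU by simp
    define G where "G = frac_density (\<lambda>x. bdist U x / 2) e p f"
    have [measurable]: "G \<in> borel_measurable borel" unfolding G_def by measurable
    \<comment> \<open>One eighth of the lower bound for \<open>bdist\<close> at time q^j. Points of
      consecutive balls are then less than 3 r_j apart, while \<open>bdist\<close> exceeds 7 r_j on
      the first ball, so such pairs stay below half the distance to the boundary.\<close>
    define r where "r j = lam * l / 8 * q ^ j" for j
    have r: "r j > 0" for j using lam l q by (simp add: r_def)
    have rS: "r (Suc j) = q * r j" for j by (simp add: r_def)
    have mb: "measure lborel (ball (c::'a) (r j)) = V * r j ^ n" for c j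
      using content_ball[of "r j" c] r[of j] by (simp add: V_def n_def)
    define a where "a = ball_avg f x0 (r 0)"
    \<comment> \<open>The ball about y contains the ball about the j-th centre. Unlike the latter it
      depends measurably on y, whatever the choice of the curves.\<close>
    define H where "H j y = (\<integral>\<^sup>+x. indicator {w. dist (fst w) (snd w) < M * r j} (y, x) * (indicator U x * G x) \<partial>lborel)" for j y
    have [measurable]: "H j \<in> borel_measurable borel" for j unfolding H_def[abs_def] by measurable
    define c where "c j = (3 * r j) powr e / (V * r j ^ n * (V * r (Suc j) ^ n))" for j
    have c: "c j > 0" for j using r[of j] r[of "Suc j"] V by (simp add: c_def)
    have rlim: "(\<lambda>j. M * r j) \<longlonglongrightarrow> 0"
      unfolding r_def using q by (auto intro!: tendsto_mult_right_zero LIMSEQ_realpow_zero)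
    obtain \<rho> where \<rho>: "strict_mono \<rho>" "AE y in lborel. (\<lambda>m. local_osc f (M * r (\<rho> m)) y) \<longlonglongrightarrow> 0"
      using local_osc_tendsto_AE[OF f, of "\<lambda>j. M * r j"] rlim M r by auto
    have pt: "ennreal (\<bar>f y - a\<bar> powr p) \<le> ennreal W * (\<Sum>j. ennreal ((\<beta> ^ j) powr (1 - p)) * (ennreal (c j) * H j y))"
      if y: "y \<in> U" and lim: "(\<lambda>m. local_osc f (M * r (\<rho> m)) y) \<longlonglongrightarrow> 0" for y
    proof -
      define x where "x j = \<gamma> (q ^ j) y" for j
      have qj: "q ^ j \<in> {0..1}" for j using q by (auto simp: power_le_one)
      have dx: "bdist U (x j) \<ge> 8 * r j" for j
        using \<gamma>(4)[OF y qj] by (simp add: x_def r_def)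
      have xU: "x j \<in> U" for j using \<gamma>(1)[OF y qj] by (simp add: x_def)
      have lip: "dist (\<gamma> s y) (\<gamma> t y) \<le> k * l * (t - s)" if "0 \<le> s" "s \<le> t" "t \<le> 1" for s t
        using bounded_speed_curve_dist_le[OF \<gamma>(5)[OF y] that] k l by simp
      have xS: "dist (x (Suc j)) (x j) \<le> r j" for j
      proof -
        have "dist (x (Suc j)) (x j) \<le> k * l * (q ^ j - q ^ Suc j)"
          unfolding x_def using qj[of j] qj[of "Suc j"] q by (intro lip) (auto intro: mult_left_le_one_le)
        also have "\<dots> = k * (1 - q) * (l * q ^ j)" by (simp add: algebra_simps)
        also have "\<dots> \<le> lam / 8 * (l * q ^ j)" using q l by (intro mult_right_mono) auto
        finally show ?thesis by (simp add: r_def)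
      qed
      have xy: "dist y (x j) \<le> 8 * k / lam * r j" for j
      proof -
        have "dist y (x j) \<le> k * l * (q ^ j - 0)"
          using lip[of 0 "q ^ j"] qj[of j] \<gamma>(2)[OF y] by (simp add: x_def)
        also have "\<dots> = 8 * k / lam * r j" using lam by (simp add: r_def)
        finally show ?thesis .
      qed
      have subM: "ball (x j) (r j) \<subseteq> ball y (M * r j)" for j
      proof
        fix w assume "w \<in> ball (x j) (r j)"
        then have "dist y w < 8 * k / lam * r j + r j"
          using xy[of j] dist_triangle[of y w "x j"] by simp
        then show "w \<in> ball y (M * r j)" by (simp add: M_def distrib_right)
      qed
      have subU: "ball (x j) (r j) \<subseteq> U" for j
      proof -
        have "ball (x j) (r j) \<subseteq> ball (x j) (bdist U (x j))" using dx[of j] r[of j] by (intro subset_ball) simp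
        then show ?thesis using ball_bdist_subset[OF oU xU] by blast
      qed
      have near: "norm (u - z) < bdist U u / 2 \<and> norm (u - z) \<le> 3 * r j"
        if "u \<in> ball (x j) (r j)" "z \<in> ball (x (Suc j)) (r (Suc j))" for u z j
      proof -
        have "r (Suc j) \<le> r j" using q r[of j] by (simp add: rS)
        have "dist u z \<le> dist u (x j) + dist (x j) (x (Suc j)) + dist (x (Suc j)) z"
          by (meson add_right_mono dist_triangle dist_triangle_le order_trans)
        also have "\<dots> < r j + r j + r j"
          using that xS[of j] \<open>r (Suc j) \<le> r j\<close> by (intro add_le_less_mono add_mono) (auto simp: dist_commute)
        finally have 1: "dist u z < 3 * r j" by simp
        have "\<bar>bdist U (x j) - bdist U u\<bar> \<le> dist (x j) u" by (rule bdist_diff_le)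
        then have "bdist U u > 7 * r j" using dx[of j] that(1) by simp
        with 1 show ?thesis using r[of j] by (simp add: dist_norm)
      qed
      define A where "A j = ball_avg f (x j) (r j)" for j
      \<comment> \<open>Since q^0 = 1, the chain starts at the common end point \<open>x0\<close> of
        all curves, so a does not depend on y.\<close>
      have A0: "A 0 = a" unfolding A_def a_def x_def using \<gamma>(3)[OF y] by simp
      have step: "ennreal (\<bar>A j - A (Suc j)\<bar> powr p) \<le> ennreal (c j) * H j y" for j
      proof -
        have "ennreal (\<bar>A j - A (Suc j)\<bar> powr p) \<le>
          ennreal ((3 * r j) powr e / (measure lborel (ball (x j) (r j)) * measure lborel (ball (x (Suc j)) (r (Suc j))))) *
          (\<integral>\<^sup>+u. indicator (ball (x j) (r j)) u * G u \<partial>lborel)"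
          unfolding A_def G_def by (rule diff_ball_avg_frac_density) (use f r p e near in simp_all)
        also have "\<dots> \<le> ennreal (c j) * H j y"
          unfolding mb c_def[symmetric] H_def using subM[of j] subU[of j]
          by (intro mult_left_mono nn_integral_mono) (auto simp: indicator_def)
        finally show ?thesis .
      qed
      have "(\<lambda>m. A (\<rho> m)) \<longlonglongrightarrow> f y"
      proof -
        have "(\<lambda>m. ennreal (M ^ DIM('a) / unit_ball_vol (DIM('a))) * local_osc f (M * r (\<rho> m)) y) \<longlonglongrightarrow>
            ennreal (M ^ DIM('a) / unit_ball_vol (DIM('a))) * 0"
          by (intro ennreal_tendsto_cmult lim) simp
        then have lim0: "(\<lambda>m. ennreal (M ^ DIM('a) / unit_ball_vol (DIM('a))) * local_osc f (M * r (\<rho> m)) y) \<longlonglongrightarrow> 0"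
          by simp
        have "ennreal \<bar>f y - A m\<bar> \<le> ennreal (M ^ DIM('a) / unit_ball_vol (DIM('a))) * local_osc f (M * r m) y" for m
          unfolding A_def by (rule diff_ball_avg_le_local_osc[OF f r subM M])
        then have "(\<lambda>m. ennreal \<bar>f y - A (\<rho> m)\<bar>) \<longlonglongrightarrow> 0"
          by (intro tendsto_sandwich[OF _ _ tendsto_const lim0] always_eventually) simp_all
        then have "(\<lambda>m. \<bar>f y - A (\<rho> m)\<bar>) \<longlonglongrightarrow> 0"
          using tendsto_ennreal_iff[of "\<lambda>m. \<bar>f y - A (\<rho> m)\<bar>" sequentially 0] by simp
        then have "(\<lambda>m. f y - A (\<rho> m)) \<longlonglongrightarrow> 0" by (rule tendsto_rabs_zero_cancel)
        then have "(\<lambda>m. f y - (f y - A (\<rho> m))) \<longlonglongrightarrow> f y - 0" by (intro tendsto_intros)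
        then show ?thesis by simp
      qed
      from geometric_chain_powr_le[OF \<rho>(1) this \<beta> p step] show ?thesis
        unfolding A0 W_def .
    qed
    define I where "I = (\<integral>\<^sup>+x. indicator U x * G x \<partial>lborel)"
    have HI: "(\<integral>\<^sup>+y. H j y \<partial>lborel) \<le> ennreal (V * (M * r j) ^ n) * I" for j
    proof -
      have "(\<integral>\<^sup>+y. H j y \<partial>lborel) = (\<integral>\<^sup>+x. \<integral>\<^sup>+y. indicator {w. dist (fst w) (snd w) < M * r j} (y, x) * (indicator U x * G x) \<partial>lborel \<partial>lborel)"
        unfolding H_def by (rule lborel_pair.Fubini') measurable
      also have "\<dots> = (\<integral>\<^sup>+x. \<integral>\<^sup>+y. (indicator U x * G x) * indicator (ball x (M * r j)) y \<partial>lborel \<partial>lborel)"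
        by (intro nn_integral_cong) (simp add: indicator_def dist_commute)
      also have "\<dots> = (\<integral>\<^sup>+x. (indicator U x * G x) * ennreal (V * (M * r j) ^ n) \<partial>lborel)"
        using M r[of j] by (subst nn_integral_cmult_indicator) (simp_all add: emeasure_ball V_def n_def less_imp_le)
      also have "\<dots> = I * ennreal (V * (M * r j) ^ n)"
        unfolding I_def by (rule nn_integral_multc) measurable
      finally show ?thesis by (simp add: mult.commute)
    qed
    \<comment> \<open>From r_j^e = r_j^n r_j^(\<sigma> p), the three volume factors cancel the power
      r_j^n. What remains is a multiple of \<beta>^(j p), which the Jensen weight \<beta>^(j (1-p))
      turns into the summable \<beta>^j.\<close>
    have coef: "(\<beta> ^ j) powr (1 - p) * (c j * (V * (M * r j) ^ n)) =
        3 powr e / q ^ n / V * M ^ n * (lam * l / 8) powr (\<sigma> * p) * \<beta> ^ j" for j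
    proof -
      have "(3 * r j) powr e = 3 powr e * (r j ^ n * r j powr (\<sigma> * p))"
        using r[of j] by (simp add: powr_mult e_def powr_add powr_realpow)
      then have "c j * (V * (M * r j) ^ n) = 3 powr e / q ^ n / V * M ^ n * r j powr (\<sigma> * p)"
        using r[of j] V q by (simp add: c_def rS power_mult_distrib field_simps)
      moreover have "r j powr (\<sigma> * p) = (lam * l / 8) powr (\<sigma> * p) * (\<beta> ^ j) powr p"
      proof -
        have "(\<beta> ^ j) powr p = (q ^ j) powr (\<sigma> * p)"
          using q by (simp add: \<beta>_def powr_powr powr_realpow[symmetric] mult_ac)
        then show ?thesis using lam l q powr_mult[of "lam * l / 8" "q ^ j" "\<sigma> * p"] by (simp add: r_def)
      qed
      moreover have "(\<beta> ^ j) powr (1 - p) * (\<beta> ^ j) powr p = \<beta> ^ j"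
        using \<beta> by (simp flip: powr_add)
      ultimately show ?thesis by (simp add: ac_simps)
    qed
    have "(\<integral>\<^sup>+y. indicator U y * ennreal (\<bar>f y - a\<bar> powr p) \<partial>lborel)
       \<le> (\<integral>\<^sup>+y. ennreal W * (\<Sum>j. ennreal ((\<beta> ^ j) powr (1 - p)) * (ennreal (c j) * H j y)) \<partial>lborel)"
      using \<rho>(2) by (intro nn_integral_mono_AE) (auto intro!: pt simp: indicator_def)
    also have "\<dots> = ennreal W * (\<Sum>j. ennreal ((\<beta> ^ j) powr (1 - p)) * (ennreal (c j) * (\<integral>\<^sup>+y. H j y \<partial>lborel)))"
      by (subst nn_integral_cmult, measurable, subst nn_integral_suminf, measurable)
        (simp add: nn_integral_cmult)
    also have "\<dots> \<le> ennreal W * (\<Sum>j. ennreal ((\<beta> ^ j) powr (1 - p)) * (ennreal (c j) * (ennreal (V * (M * r j) ^ n) * I)))"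
      by (intro mult_left_mono suminf_le HI) auto
    also have "\<dots> = ennreal W * (\<Sum>j. ennreal (3 powr e / q ^ n / V * M ^ n * (lam * l / 8) powr (\<sigma> * p) * \<beta> ^ j) * I)"
    proof -
      have "ennreal ((\<beta> ^ j) powr (1 - p)) * (ennreal (c j) * (ennreal (V * (M * r j) ^ n) * I)) =
          ennreal (3 powr e / q ^ n / V * M ^ n * (lam * l / 8) powr (\<sigma> * p) * \<beta> ^ j) * I" for j
      proof -
        have "V * (M * r j) ^ n \<ge> 0" using V M r[of j] by simp
        then show ?thesis
          unfolding coef[symmetric] using c[of j] by (subst ennreal_mult, simp, simp, subst ennreal_mult) (simp_all add: mult.assoc)
      qed
      then show ?thesis by simp
    qed
    also have "\<dots> = ennreal W * (ennreal (3 powr e / q ^ n / V * M ^ n * (lam * l / 8) powr (\<sigma> * p) * (1 / (1 - \<beta>))) * I)"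
    proof -
      have "(\<lambda>j. 3 powr e / q ^ n / V * M ^ n * (lam * l / 8) powr (\<sigma> * p) * \<beta> ^ j) sums
         (3 powr e / q ^ n / V * M ^ n * (lam * l / 8) powr (\<sigma> * p) * (1 / (1 - \<beta>)))"
        using \<beta> by (intro sums_mult geometric_sums) auto
      then have "(\<Sum>j. ennreal (3 powr e / q ^ n / V * M ^ n * (lam * l / 8) powr (\<sigma> * p) * \<beta> ^ j)) =
         ennreal (3 powr e / q ^ n / V * M ^ n * (lam * l / 8) powr (\<sigma> * p) * (1 / (1 - \<beta>)))"
        using \<beta> V q M by (intro suminf_ennreal_eq) auto
      then show ?thesis by simp
    qed
    also have "\<dots> = ennreal (C * l powr (\<sigma> * p)) * I"
    proof -
      have "(lam * l / 8) powr (\<sigma> * p) = (lam / 8) powr (\<sigma> * p) * l powr (\<sigma> * p)"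
        using powr_mult[of "lam/8" l "\<sigma> * p"] lam l by simp
      then have "C * l powr (\<sigma> * p) =
          W * (3 powr e / q ^ n / V * M ^ n * (lam * l / 8) powr (\<sigma> * p) * (1 / (1 - \<beta>)))"
        by (simp add: C_def)
      then show ?thesis using W by (simp only: ennreal_mult' mult.assoc less_imp_le)
    qed
    finally show ?thesis unfolding I_def G_def by blast
  qed
  show thesis by (rule that[OF C main[unfolded e_def n_def]])
qed

subsection \<open>Functions on \<open>\<Omega>\<close> and their Borel extensions\<close>

lemma AE_lebesgue_on_iff:
  assumes "\<Omega> \<in> sets borel"
  shows "(AE x in lebesgue_on \<Omega>. P x) \<longleftrightarrow> (AE x in lborel. x \<in> \<Omega> \<longrightarrow> P x)"
  using assms by (subst AE_restrict_space_iff) (auto simp: AE_completion_iff)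

lemma nn_integral_lebesgue_on:
  assumes "\<Omega> \<in> sets borel"
  shows "(\<integral>\<^sup>+x. F x \<partial>lebesgue_on \<Omega>) = (\<integral>\<^sup>+x. indicator \<Omega> x * F x \<partial>lborel)"
  using assms by (subst nn_integral_restrict_space) (auto simp: nn_integral_completion mult.commute)

lemma completion_ex_borel_measurable_euclidean:
  fixes g :: "'a \<Rightarrow> 'b::euclidean_space"
  assumes g: "g \<in> borel_measurable (completion M)"
  shows "\<exists>g'\<in>borel_measurable M. (AE x in M. g x = g' x)"
proof -
  have "\<exists>h\<in>borel_measurable M. AE x in M. g x \<bullet> b = h x" for b
    using g by (intro completion_ex_borel_measurable_real) simp
  then obtain h where h: "\<And>b. h b \<in> borel_measurable M" "\<And>b. AE x in M. g x \<bullet> b = h b x"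
    by metis
  have "AE x in M. \<forall>b\<in>Basis. g x \<bullet> b = h b x"
    using h(2) by (intro AE_finite_allI) auto
  then have "AE x in M. g x = (\<Sum>b\<in>Basis. h b x *\<^sub>R b)"
  proof (rule AE_mp, intro AE_I2 impI)
    fix x assume "\<forall>b\<in>Basis. g x \<bullet> b = h b x"
    then show "g x = (\<Sum>b\<in>Basis. h b x *\<^sub>R b)"
      using euclidean_representation[of "g x"] by (metis (no_types, lifting) sum.cong)
  qed
  moreover have "(\<lambda>x. \<Sum>b\<in>Basis. h b x *\<^sub>R b) \<in> borel_measurable M"
    using h(1) by measurable
  ultimately show ?thesis by (rule bexI)
qed

text \<open>Fubini and joint measurability are used on \<open>lborel\<close>, whereas elements of
  the spaces are measurable for the completion on \<Omega> only. The Borel representative extended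
  by 0 mediates between the two.\<close>

lemma borel_extension:
  fixes f :: "'a::euclidean_space \<Rightarrow> 'b::euclidean_space"
  assumes \<Omega> [measurable]: "\<Omega> \<in> sets borel" and f: "f \<in> borel_measurable (lebesgue_on \<Omega>)"
  obtains f0 where "f0 \<in> borel_measurable borel" "AE x in lebesgue_on \<Omega>. f x = f0 x" "\<And>x. x \<notin> \<Omega> \<Longrightarrow> f0 x = 0"
proof -
  have "(\<lambda>x. indicator \<Omega> x *\<^sub>R f x) \<in> borel_measurable lebesgue"
    using f \<Omega> by (subst (asm) borel_measurable_restrict_space_iff) auto
  from completion_ex_borel_measurable_euclidean[OF this] obtain g where
    [measurable]: "g \<in> borel_measurable borel" and g: "AE x in lborel. indicator \<Omega> x *\<^sub>R f x = g x" by auto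
  show thesis
  proof (rule that[of "\<lambda>x. indicator \<Omega> x *\<^sub>R g x"])
    show "AE x in lebesgue_on \<Omega>. f x = indicator \<Omega> x *\<^sub>R g x"
      unfolding AE_lebesgue_on_iff[OF \<Omega>] using g by eventually_elim auto
  qed auto
qed

lemma borel_measurable_lebesgue_on_borel:
  "f \<in> borel_measurable borel \<Longrightarrow> f \<in> borel_measurable (lebesgue_on \<Omega>)"
  by (intro measurable_restrict_space1 measurable_completion) simp

lemma borel_measurable_lebesgue_on_AE:
  fixes f g :: "'a::euclidean_space \<Rightarrow> 'b::euclidean_space"
  assumes \<Omega>: "\<Omega> \<in> sets borel" and g: "g \<in> borel_measurable (lebesgue_on \<Omega>)"
    and eq: "AE x in lebesgue_on \<Omega>. f x = g x"
  shows "f \<in> borel_measurable (lebesgue_on \<Omega>)"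
proof -
  have g': "(\<lambda>x. indicator \<Omega> x *\<^sub>R g x) \<in> borel_measurable lebesgue"
    using g \<Omega> by (subst (asm) borel_measurable_restrict_space_iff) auto
  have "AE x in lebesgue. x \<in> \<Omega> \<longrightarrow> f x = g x"
    using eq \<Omega> by (subst (asm) AE_restrict_space_iff) auto
  then have "AE x in lebesgue. indicator \<Omega> x *\<^sub>R g x = indicator \<Omega> x *\<^sub>R f x"
    by eventually_elim (auto simp: indicator_def)
  then have "(\<lambda>x. indicator \<Omega> x *\<^sub>R f x) \<in> borel_measurable lebesgue"
    by (rule borel_measurable_AE[OF g'])
  then show ?thesis using \<Omega> by (subst borel_measurable_restrict_space_iff) auto
qed

lemma lebesgue_on_borel_integrable_iff:
  fixes F F0 :: "'a::euclidean_space \<Rightarrow> 'b::euclidean_space"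
  assumes \<Omega>: "\<Omega> \<in> sets borel" and F: "F0 \<in> borel_measurable borel"
    and eq: "AE x in lebesgue_on \<Omega>. F x = F0 x" and zero: "\<And>x. x \<notin> \<Omega> \<Longrightarrow> F0 x = 0"
  shows "integrable (lebesgue_on \<Omega>) F \<longleftrightarrow> integrable lborel F0" (is ?A)
    and "integral\<^sup>L (lebesgue_on \<Omega>) F = integral\<^sup>L lborel F0" (is ?B)
proof -
  have F0: "F0 \<in> borel_measurable (lebesgue_on \<Omega>)" by (rule borel_measurable_lebesgue_on_borel[OF F])
  have Fm: "F \<in> borel_measurable (lebesgue_on \<Omega>)"
    by (rule borel_measurable_lebesgue_on_AE[OF \<Omega> F0 eq])
  have i: "(\<lambda>x. indicator \<Omega> x *\<^sub>R F0 x) = F0" using zero by (auto simp: indicator_def)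
  have O: "\<Omega> \<inter> space lebesgue \<in> sets lebesgue" using \<Omega> by simp
  show ?A
    using integrable_cong_AE[OF Fm F0 eq] integrable_restrict_space[OF O, of F0] F
    by (simp add: i integrable_completion)
  show ?B
    using integral_cong_AE[OF Fm F0 eq] integral_restrict_space[OF O, of F0] F
    by (simp add: i integral_completion)
qed

subsection \<open>Smooth compactly supported functions\<close>

text \<open>The powers of t in the denominator make the family closed under differentiation up to
  linear combinations, so smoothness follows by induction without formulas for higher
  derivatives.\<close>

definition exp_profile :: "nat \<Rightarrow> real \<Rightarrow> real" where
  "exp_profile m t = (if t > 0 then exp (- (1 / t)) / t ^ m else 0)"

lemma exp_profile_tendsto_0: "(exp_profile m \<longlongrightarrow> 0) (at 0)"
proof -
  have "((\<lambda>x::real. x ^ m / exp x) \<longlongrightarrow> 0) at_top" by (rule tendsto_power_div_exp_0)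
  then have "((\<lambda>t::real. inverse t ^ m / exp (inverse t)) \<longlongrightarrow> 0) (at_right 0)"
    by (rule filterlim_compose[OF _ filterlim_inverse_at_top_right])
  moreover have "\<forall>\<^sub>F t in at_right 0. inverse t ^ m / exp (inverse t) = exp_profile m t"
    by (auto simp: eventually_at_filter exp_profile_def exp_minus field_simps)
  ultimately have "(exp_profile m \<longlongrightarrow> 0) (at_right 0)"
    by (rule Lim_transform_eventually)
  moreover have "(exp_profile m \<longlongrightarrow> 0) (at_left 0)"
  proof (rule Lim_transform_eventually[OF tendsto_const])
    show "\<forall>\<^sub>F x in at_left 0. 0 = exp_profile m x"
      by (auto simp: eventually_at_filter exp_profile_def)
  qed
  ultimately show ?thesis by (simp add: filterlim_split_at_real)
qed

text \<open>At 0 the difference quotient of \<open>exp_profile m\<close> is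
  \<open>exp_profile (Suc m)\<close>, so differentiability there is once more the limit
  \<open>exp_profile_tendsto_0\<close>.\<close>

lemma exp_profile_deriv:
  "(exp_profile m has_real_derivative (exp_profile (m + 2) t - real m * exp_profile (m + 1) t)) (at t)"
proof -
  consider "t > 0" | "t < 0" | "t = 0" by linarith
  then show ?thesis
  proof cases
    case 1
    have "((\<lambda>t. exp (- (1 / t)) / t ^ m) has_real_derivative
        (exp_profile (m + 2) t - real m * exp_profile (m + 1) t)) (at t)"
    proof -
      have "((\<lambda>t. exp (- (1 / t)) * inverse (t ^ m)) has_real_derivative
        exp (- (1 / t)) * (1 / t\<^sup>2) * inverse (t ^ m) + exp (- (1 / t)) * (- (real m * (t ^ (m - 1))) / (t ^ m * t ^ m))) (at t)"
        using 1 by (auto intro!: derivative_eq_intros simp: power2_eq_square divide_simps)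
      moreover have "t ^ (m - 1) * t = t ^ m" if "m > 0" using that by (cases m) auto
      then have "real m * t ^ (m - 1) / (t ^ m * t ^ m) = real m / t ^ (m + 1)"
        using 1 by (cases "m = 0") (simp_all add: field_simps)
      then have "exp (- (1 / t)) * (1 / t\<^sup>2) * inverse (t ^ m) + exp (- (1 / t)) * (- (real m * (t ^ (m - 1))) / (t ^ m * t ^ m))
          = exp (- (1 / t)) / t ^ (m + 2) - exp (- (1 / t)) * (real m / t ^ (m + 1))"
        by (simp add: power2_eq_square field_simps)
      ultimately show ?thesis
        using 1 by (simp add: exp_profile_def divide_inverse mult.left_commute)
    qed
    moreover have "\<forall>\<^sub>F s in nhds t. exp (- (1 / s)) / s ^ m = exp_profile m s"
      using eventually_nhds_in_open[of "{0<..}" t] 1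
      by (auto elim!: eventually_mono simp: exp_profile_def)
    ultimately show ?thesis by (subst (asm) DERIV_cong_ev[OF refl _ refl]) auto
  next
    case 2
    have "((\<lambda>t. 0) has_real_derivative 0) (at t)" by simp
    moreover have "\<forall>\<^sub>F s in nhds t. 0 = exp_profile m s"
      using eventually_nhds_in_open[of "{..<0}" t] 2
      by (auto elim!: eventually_mono simp: exp_profile_def)
    ultimately have "(exp_profile m has_real_derivative 0) (at t)"
      by (subst (asm) DERIV_cong_ev[OF refl _ refl]) auto
    then show ?thesis using 2 by (simp add: exp_profile_def)
  next
    case 3
    have "((\<lambda>h. (exp_profile m (0 + h) - exp_profile m 0) / h) \<longlongrightarrow> 0) (at 0)"
    proof (rule Lim_transform_eventually[OF exp_profile_tendsto_0[of "Suc m"]])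
      show "\<forall>\<^sub>F h in at 0. exp_profile (Suc m) h = (exp_profile m (0 + h) - exp_profile m 0) / h"
        by (auto simp: eventually_at_filter exp_profile_def)
    qed
    then show ?thesis using 3 by (simp add: DERIV_def exp_profile_def)
  qed
qed

text \<open>An algebra containing the bumps and closed under directional derivatives; a single
  induction on k then shows that all its members satisfy \<open>Ck_function k\<close>.\<close>

inductive bump_algebra :: "('a::euclidean_space \<Rightarrow> real) \<Rightarrow> bool" where
  const: "bump_algebra (\<lambda>x. c)"
| coord: "bump_algebra (\<lambda>x. x \<bullet> v)"
| profile: "bump_algebra (\<lambda>x. exp_profile m (c - a * ((x - y) \<bullet> (x - y))))"
| add: "bump_algebra f \<Longrightarrow> bump_algebra g \<Longrightarrow> bump_algebra (\<lambda>x. f x + g x)"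
| mult: "bump_algebra f \<Longrightarrow> bump_algebra g \<Longrightarrow> bump_algebra (\<lambda>x. f x * g x)"

lemma bump_algebra_derivative:
  fixes f :: "'a::euclidean_space \<Rightarrow> real"
  assumes "bump_algebra f"
  shows "\<exists>f'. (\<forall>x. (f has_derivative f' x) (at x)) \<and> (\<forall>b. bump_algebra (\<lambda>x. f' x b))"
  using assms
proof induction
  case (const c)
  show ?case by (rule exI[of _ "\<lambda>x h. 0"]) (auto intro: bump_algebra.const)
next
  case (coord v)
  show ?case
    by (rule exI[of _ "\<lambda>x h. h \<bullet> v"]) (auto intro!: bump_algebra.const derivative_eq_intros)
next
  case (profile m c a y)
  let ?u = "\<lambda>x::'a. c - a * ((x - y) \<bullet> (x - y))"
  \<comment> \<open>Differences and negations are written as sums and products with constants, so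
    that the introduction rules match the derivative syntactically.\<close>
  let ?f' = "\<lambda>x h. (exp_profile (m + 2) (?u x) + (- real m) * exp_profile (m + 1) (?u x)) * ((- 2 * a) * (x \<bullet> h + (- (y \<bullet> h))))"
  have "((\<lambda>x. exp_profile m (?u x)) has_derivative ?f' x) (at x)" for x
  proof -
    have "(?u has_derivative (\<lambda>h. (- 2 * a) * (x \<bullet> h + (- (y \<bullet> h))))) (at x)"
      by (auto intro!: derivative_eq_intros simp: inner_diff_left inner_diff_right inner_commute algebra_simps)
    from has_derivative_compose[OF this exp_profile_deriv[of m "?u x", unfolded has_field_derivative_def]]
    show ?thesis by simp
  qed
  moreover have "bump_algebra (\<lambda>x. ?f' x b)" for b
    by (intro bump_algebra.intros)
  ultimately show ?case by (intro exI[of _ ?f']) blast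
next
  case (add f g)
  then obtain f' g' where "\<forall>x. (f has_derivative f' x) (at x)" "\<forall>b. bump_algebra (\<lambda>x. f' x b)"
     "\<forall>x. (g has_derivative g' x) (at x)" "\<forall>b. bump_algebra (\<lambda>x. g' x b)" by blast
  then show ?case
    by (intro exI[of _ "\<lambda>x h. f' x h + g' x h"]) (auto intro!: has_derivative_add bump_algebra.add)
next
  case (mult f g)
  then obtain f' g' where *: "\<forall>x. (f has_derivative f' x) (at x)" "\<forall>b. bump_algebra (\<lambda>x. f' x b)"
     "\<forall>x. (g has_derivative g' x) (at x)" "\<forall>b. bump_algebra (\<lambda>x. g' x b)" by blast
  show ?case
  proof (intro exI[of _ "\<lambda>x h. f x * g' x h + f' x h * g x"] conjI allI)
    show "((\<lambda>x. f x * g x) has_derivative (\<lambda>h. f x * g' x h + f' x h * g x)) (at x)" for x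
      using * by (intro has_derivative_mult) auto
    show "bump_algebra (\<lambda>x. f x * g' x b + f' x b * g x)" for b
      using * mult by (intro bump_algebra.add bump_algebra.mult) auto
  qed
qed

lemma bump_algebra_Ck: "bump_algebra f \<Longrightarrow> Ck_function k f"
proof (induction k arbitrary: f)
  case 0
  then obtain f' where "\<forall>x. (f has_derivative f' x) (at x)" using bump_algebra_derivative by blast
  then have "isCont f x" for x by (metis has_derivative_continuous)
  then show ?case by (simp add: continuous_on_eq_continuous_within)
next
  case (Suc k)
  then obtain f' where f': "\<forall>x. (f has_derivative f' x) (at x)" "\<forall>b. bump_algebra (\<lambda>x. f' x b)"
    using bump_algebra_derivative by blast
  have "frechet_derivative f (at x) = f' x" for x
    using f' by (metis frechet_derivative_at)
  with f' Suc.IH show ?case by (auto simp: differentiable_def)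
qed

section \<open>Bump functions and mollifiers\<close>

definition bump :: "real \<Rightarrow> 'a::euclidean_space \<Rightarrow> 'a \<Rightarrow> real" where
  "bump r y x = exp_profile 0 (1 - (1 / r\<^sup>2) * ((x - y) \<bullet> (x - y)))"

lemma exp_profile_0_bounds: "0 \<le> exp_profile 0 t" "exp_profile 0 t \<le> 1"
  by (auto simp: exp_profile_def)

lemma bump_nonneg: "bump r y x \<ge> 0" and bump_le_1: "bump r y x \<le> 1"
  unfolding bump_def by (rule exp_profile_0_bounds)+

lemma bump_eq_0:
  assumes "x \<notin> ball y r" "r > 0" shows "bump r y x = 0"
proof -
  have "r\<^sup>2 \<le> (norm (x - y))\<^sup>2" using assms by (intro power_mono) (auto simp: dist_norm norm_minus_commute)
  then show ?thesis using assms(2) by (simp add: bump_def exp_profile_def power2_norm_eq_inner field_simps)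
qed

text \<open>On the half ball the argument of the profile is at least 3/4, whence exp(-4/3). This
  bounds the mass of the bump below by a multiple of r^n.\<close>

lemma bump_ge:
  assumes "x \<in> ball y (r/2)" "r > 0" shows "bump r y x \<ge> exp (- (4/3))"
proof -
  have "(norm (x - y))\<^sup>2 \<le> (r/2)\<^sup>2" using assms by (intro power_mono) (auto simp: dist_norm norm_minus_commute)
  then have "(1 / r\<^sup>2) * ((x - y) \<bullet> (x - y)) \<le> 1/4"
    using assms(2) by (simp add: power2_norm_eq_inner field_simps)
  then have *: "1 - (1 / r\<^sup>2) * ((x - y) \<bullet> (x - y)) \<ge> 3/4" by simp
  then have "1 / (1 - (1 / r\<^sup>2) * ((x - y) \<bullet> (x - y))) \<le> 1 / (3/4)" by (intro divide_left_mono) auto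
  moreover have "1 - (1 / r\<^sup>2) * ((x - y) \<bullet> (x - y)) > 0" using * by linarith
  ultimately show ?thesis unfolding bump_def exp_profile_def by simp
qed

lemma bump_shift: "bump r y x = bump r 0 (x - y)"
  by (simp add: bump_def)

lemma bump_commute: "bump r y x = bump r x y"
proof -
  have "(x - y) \<bullet> (x - y) = (y - x) \<bullet> (y - x)"
    by (metis minus_diff_eq inner_minus_left inner_minus_right minus_minus)
  then show ?thesis by (simp add: bump_def)
qed

lemma exp_profile_measurable [measurable]: "exp_profile m \<in> borel_measurable borel"
  unfolding exp_profile_def[abs_def] by measurable

lemma bump_measurable [measurable]:
  "(\<lambda>w. bump r (fst w) (snd w)) \<in> borel_measurable (borel \<Otimes>\<^sub>M borel)"
  unfolding bump_def by measurable

lemma bump_measurable1 [measurable]: "bump r y \<in> borel_measurable borel"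
  unfolding bump_def[abs_def] by measurable

lemma integrable_bump: "r > 0 \<Longrightarrow> integrable lborel (bump r (y::'a::euclidean_space))"
proof -
  assume "r > 0"
  have "integrable lborel (\<lambda>x. indicator (ball y r) x :: real)"
    using \<open>r > 0\<close> by (intro integrable_real_indicator) (auto simp: emeasure_ball)
  then show ?thesis
  proof (rule Bochner_Integration.integrable_bound)
    show "AE x in lborel. norm (bump r y x) \<le> norm (indicator (ball y r) x :: real)"
      using bump_eq_0[of _ y r] bump_nonneg[of r y] bump_le_1[of r y] \<open>r > 0\<close>
      by (intro AE_I2) (auto simp: indicator_def)
  qed simp
qed

definition bump_mass :: "'a::euclidean_space itself \<Rightarrow> real \<Rightarrow> real" where
  "bump_mass _ r = (\<integral>x. bump r (0::'a) x \<partial>lborel)"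

lemma integral_bump:
  fixes y :: "'a::euclidean_space"
  assumes "r > 0"
  shows "(\<integral>x. bump r y x \<partial>lborel) = bump_mass TYPE('a) r"
proof -
  have "(\<integral>\<^sup>+x. ennreal (bump r y x) \<partial>lborel) = (\<integral>\<^sup>+x. ennreal (bump r y (x + y)) \<partial>lborel)"
    by (rule nn_integral_lborel_shift[symmetric]) simp
  then show ?thesis
    unfolding bump_mass_def by (simp add: integral_eq_nn_integral bump_nonneg bump_shift[of r y])
qed

lemma bump_mass_ge:
  assumes "r > 0"
  shows "exp (- (4/3)) * unit_ball_vol (DIM('a)) / 2 ^ DIM('a) * r ^ DIM('a) \<le> bump_mass TYPE('a::euclidean_space) r"
proof -
  have i: "integrable lborel (\<lambda>x::'a. indicator (ball 0 (r/2)) x :: real)"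
    using assms by (intro integrable_real_indicator) (auto simp: emeasure_ball)
  have "exp (- (4/3)) * measure lborel (ball (0::'a) (r/2)) = (\<integral>x. exp (- (4/3)) * indicator (ball (0::'a) (r/2)) x \<partial>lborel)"
    by simp
  also have "\<dots> \<le> bump_mass TYPE('a) r"
    unfolding bump_mass_def
  proof (rule integral_mono)
    show "exp (- (4/3)) * indicator (ball (0::'a) (r/2)) x \<le> bump r 0 x" for x :: 'a
      using bump_ge[of x 0 r] bump_nonneg[of r 0 x] assms by (auto simp: indicator_def)
  qed (use i integrable_bump assms in auto)
  also have "measure lborel (ball (0::'a) (r/2)) = unit_ball_vol (DIM('a)) * (r/2) ^ DIM('a)"
    using content_ball[of "r/2" "0::'a"] assms by simp
  finally show ?thesis by (simp add: power_divide)
qed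

lemma bump_mass_pos: "r > 0 \<Longrightarrow> bump_mass TYPE('a::euclidean_space) r > 0"
  by (rule less_le_trans[OF _ bump_mass_ge]) (auto intro!: mult_pos_pos divide_pos_pos unit_ball_vol_pos)

definition mollifier :: "real \<Rightarrow> 'a::euclidean_space \<Rightarrow> 'a \<Rightarrow> real" where
  "mollifier r y x = bump r y x / bump_mass TYPE('a) r"

lemma mollifier_nonneg: "r > 0 \<Longrightarrow> mollifier r y x \<ge> 0"
  unfolding mollifier_def by (simp add: bump_nonneg bump_mass_pos less_imp_le)

lemma mollifier_eq_0: "x \<notin> ball y r \<Longrightarrow> r > 0 \<Longrightarrow> mollifier r y x = 0"
  by (simp add: mollifier_def bump_eq_0)

lemma mollifier_commute: "mollifier r y x = mollifier r x y"
  by (simp add: mollifier_def bump_commute)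

lemma mollifier_shift: "mollifier r (y + z) x = mollifier r y (x - z)"
  by (simp add: mollifier_def bump_def algebra_simps)

lemma mollifier_measurable [measurable]:
  "(\<lambda>w. mollifier r (fst w) (snd w)) \<in> borel_measurable (borel \<Otimes>\<^sub>M borel)"
  "mollifier r y \<in> borel_measurable borel"
  unfolding mollifier_def[abs_def] by measurable

lemma integrable_mollifier: "r > 0 \<Longrightarrow> integrable lborel (mollifier r y)"
  unfolding mollifier_def[abs_def] by (intro integrable_divide_zero integrable_bump) auto

lemma integral_mollifier: "r > 0 \<Longrightarrow> (\<integral>x. mollifier r y x \<partial>lborel) = 1"
  unfolding mollifier_def using bump_mass_pos[of r, where 'a='a] by (simp add: integral_bump)

lemma nn_integral_mollifier: "r > 0 \<Longrightarrow> (\<integral>\<^sup>+x. ennreal (mollifier r y x) \<partial>lborel) = 1"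
  by (subst nn_integral_eq_integral) (auto simp: integrable_mollifier mollifier_nonneg integral_mollifier)

definition mollifier_const :: "'a::euclidean_space itself \<Rightarrow> real" where
  "mollifier_const _ = 1 / (exp (- (4/3)) * unit_ball_vol (DIM('a)) / 2 ^ DIM('a))"

lemma mollifier_const_pos: "mollifier_const TYPE('a::euclidean_space) > 0"
  unfolding mollifier_const_def by (auto intro!: mult_pos_pos divide_pos_pos unit_ball_vol_pos)

text \<open>The lower bound on the mass makes the mollifier at most a constant times the indicator
  of the ball divided by r^n, which is the weight in \<open>local_osc\<close>.\<close>

lemma mollifier_le:
  fixes y :: "'a::euclidean_space"
  assumes "r > 0" shows "mollifier r y x \<le> mollifier_const TYPE('a) * (1 / r ^ DIM('a)) * indicator (ball y r) x"
proof (cases "x \<in> ball y r")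
  case True
  have v: "unit_ball_vol (real DIM('a)) > 0" by (rule unit_ball_vol_pos) simp
  have "mollifier r y x \<le> 1 / bump_mass TYPE('a) r"
    unfolding mollifier_def by (intro divide_right_mono bump_le_1) (simp add: assms bump_mass_pos less_imp_le)
  also have "\<dots> \<le> 1 / (exp (- (4/3)) * unit_ball_vol (DIM('a)) / 2 ^ DIM('a) * r ^ DIM('a))"
    using v assms bump_mass_pos[OF assms, where 'a='a]
    by (intro divide_left_mono bump_mass_ge mult_pos_pos divide_pos_pos) auto
  finally show ?thesis using True by (simp add: mollifier_const_def)
qed (simp add: mollifier_eq_0 assms)

lemma mollifier_bump_algebra: "bump_algebra (mollifier r y)"
proof -
  have "bump_algebra (\<lambda>x. (1 / bump_mass TYPE('a) r) * exp_profile 0 (1 - (1 / r\<^sup>2) * ((x - y) \<bullet> (x - y))))"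
    by (intro bump_algebra.intros)
  then show ?thesis unfolding mollifier_def[abs_def] bump_def by simp
qed

lemma mollifier_test_function:
  assumes "r > 0" "cball y r \<subseteq> \<Omega>"
  shows "test_function \<Omega> (mollifier r y)"
proof -
  have "{x. mollifier r y x \<noteq> 0} \<subseteq> cball y r" using mollifier_eq_0[of _ y r] assms(1) by force
  then have c: "closure {x. mollifier r y x \<noteq> 0} \<subseteq> cball y r" by (intro closure_minimal) auto
  then have "compact (closure {x. mollifier r y x \<noteq> 0})"
    by (metis bounded_cball bounded_subset closed_closure compact_eq_bounded_closed)
  with c assms(2) show ?thesis unfolding test_function_def using bump_algebra_Ck[OF mollifier_bump_algebra] by auto
qed

text \<open>As the mollifier has integral 1, the error at y is the mollified difference u x - u y,
  and \<open>mollifier_le\<close> turns it into the local oscillation.\<close>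

lemma mollifier_approx:
  fixes u :: "'a::euclidean_space \<Rightarrow> real"
  assumes u: "integrable lborel u" and r: "r > 0"
  shows "integrable lborel (\<lambda>x. mollifier r y x * u x)"
    and "ennreal \<bar>(\<integral>x. mollifier r y x * u x \<partial>lborel) - u y\<bar> \<le> ennreal (mollifier_const TYPE('a)) * local_osc u r y"
proof -
  let ?C = "mollifier_const TYPE('a)"
  have [measurable]: "u \<in> borel_measurable borel" using u by auto
  have "integrable lborel (\<lambda>x. ?C * (1 / r ^ DIM('a)) * u x)" using u by simp
  then show i: "integrable lborel (\<lambda>x. mollifier r y x * u x)"
  proof (rule Bochner_Integration.integrable_bound)
    show "AE x in lborel. norm (mollifier r y x * u x) \<le> norm (?C * (1 / r ^ DIM('a)) * u x)"
    proof (rule AE_I2)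
      fix x
      have "mollifier r y x \<le> ?C * (1 / r ^ DIM('a))"
        using mollifier_le[OF r, of y x] mollifier_const_pos[where 'a='a] r
        by (cases "x \<in> ball y r") (auto intro: order_trans)
      then have "mollifier r y x * \<bar>u x\<bar> \<le> ?C * (1 / r ^ DIM('a)) * \<bar>u x\<bar>" by (rule mult_right_mono) simp
      then show "norm (mollifier r y x * u x) \<le> norm (?C * (1 / r ^ DIM('a)) * u x)"
        using mollifier_nonneg[OF r, of y x] mollifier_const_pos[where 'a='a] r by (simp add: abs_mult)
    qed
  qed measurable
  have i': "integrable lborel (\<lambda>x. mollifier r y x * (u x - u y))"
    using i integrable_mollifier[OF r, of y] by (simp add: right_diff_distrib)
  have "(\<integral>x. mollifier r y x * u x \<partial>lborel) - u y = (\<integral>x. mollifier r y x * (u x - u y) \<partial>lborel)"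
    using i integrable_mollifier[OF r, of y] by (simp add: right_diff_distrib integral_mollifier[OF r])
  then have "ennreal \<bar>(\<integral>x. mollifier r y x * u x \<partial>lborel) - u y\<bar> = ennreal (norm (\<integral>x. mollifier r y x * (u x - u y) \<partial>lborel))"
    by simp
  also have "\<dots> \<le> (\<integral>\<^sup>+x. ennreal (norm (mollifier r y x * (u x - u y))) \<partial>lborel)"
    using i' by (rule integral_norm_bound_ennreal)
  also have "\<dots> \<le> (\<integral>\<^sup>+x. ennreal (?C * (1 / r ^ DIM('a))) * (indicator (ball y r) x * ennreal \<bar>u x - u y\<bar>) \<partial>lborel)"
  proof (rule nn_integral_mono)
    fix x
    have "mollifier r y x * \<bar>u x - u y\<bar> \<le> ?C * (1 / r ^ DIM('a)) * indicator (ball y r) x * \<bar>u x - u y\<bar>"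
      by (intro mult_right_mono mollifier_le r) simp
    then have "ennreal (norm (mollifier r y x * (u x - u y))) \<le> ennreal (?C * (1 / r ^ DIM('a)) * (indicator (ball y r) x * \<bar>u x - u y\<bar>))"
      using mollifier_nonneg[OF r, of y x] by (intro ennreal_leI) (simp add: abs_mult mult.assoc)
    also have "\<dots> = ennreal (?C * (1 / r ^ DIM('a))) * (indicator (ball y r) x * ennreal \<bar>u x - u y\<bar>)"
      using mollifier_const_pos[where 'a='a] r by (subst ennreal_mult) (auto simp: indicator_def)
    finally show "ennreal (norm (mollifier r y x * (u x - u y))) \<le> ennreal (?C * (1 / r ^ DIM('a))) * (indicator (ball y r) x * ennreal \<bar>u x - u y\<bar>)" .
  qed
  also have "\<dots> = ennreal (?C * (1 / r ^ DIM('a))) * (\<integral>\<^sup>+x. indicator (ball y r) x * ennreal \<bar>u x - u y\<bar> \<partial>lborel)"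
    by (rule nn_integral_cmult) measurable
  also have "\<dots> = ennreal ?C * local_osc u r y"
    using mollifier_const_pos[where 'a='a] r unfolding local_osc_def by (subst ennreal_mult) (auto simp: mult.assoc)
  finally show "ennreal \<bar>(\<integral>x. mollifier r y x * u x \<partial>lborel) - u y\<bar> \<le> ennreal ?C * local_osc u r y" .
qed

lemma mollifier_tendsto:
  fixes u :: "'a::euclidean_space \<Rightarrow> real"
  assumes u: "integrable lborel u" and r: "\<And>m. r m > 0" and lim: "(\<lambda>m. local_osc u (r m) y) \<longlonglongrightarrow> 0"
  shows "(\<lambda>m. \<integral>x. mollifier (r m) y x * u x \<partial>lborel) \<longlonglongrightarrow> u y"
proof -
  have "(\<lambda>m. ennreal (mollifier_const TYPE('a)) * local_osc u (r m) y) \<longlonglongrightarrow> ennreal (mollifier_const TYPE('a)) * 0"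
    by (intro ennreal_tendsto_cmult lim) simp
  then have lim0: "(\<lambda>m. ennreal (mollifier_const TYPE('a)) * local_osc u (r m) y) \<longlonglongrightarrow> 0" by simp
  have "(\<lambda>m. ennreal \<bar>(\<integral>x. mollifier (r m) y x * u x \<partial>lborel) - u y\<bar>) \<longlonglongrightarrow> 0"
    by (intro tendsto_sandwich[OF _ _ tendsto_const lim0] always_eventually)
       (simp_all add: mollifier_approx[OF u r])
  then have "(\<lambda>m. \<bar>(\<integral>x. mollifier (r m) y x * u x \<partial>lborel) - u y\<bar>) \<longlonglongrightarrow> 0"
    using tendsto_ennreal_iff[of "\<lambda>m. \<bar>(\<integral>x. mollifier (r m) y x * u x \<partial>lborel) - u y\<bar>" sequentially 0] by simp
  then show ?thesis by (simp add: tendsto_rabs_zero_iff LIM_zero_iff)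
qed

lemma mollifier_measurable_comp [measurable (raw)]:
  fixes f g :: "'b \<Rightarrow> 'a::euclidean_space"
  assumes "f \<in> borel_measurable M" "g \<in> borel_measurable M"
  shows "(\<lambda>x. mollifier r (f x) (g x)) \<in> borel_measurable M"
  using measurable_compose[OF measurable_Pair[OF assms] mollifier_measurable(1)[of r]] by simp

subsection \<open>Weak gradients\<close>

lemma continuous_compact_support_bounded:
  fixes g :: "'a::euclidean_space \<Rightarrow> real"
  assumes "continuous_on UNIV g" "compact K" "\<And>x. x \<notin> K \<Longrightarrow> g x = 0"
  obtains B where "B \<ge> 0" "\<And>x. \<bar>g x\<bar> \<le> B"
proof -
  have "bounded (g ` K)"
    using assms by (intro compact_imp_bounded compact_continuous_image) (auto intro: continuous_on_subset)
  then obtain B where B: "\<And>x. x \<in> K \<Longrightarrow> \<bar>g x\<bar> \<le> B" by (auto simp: bounded_iff)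
  have "\<bar>g x\<bar> \<le> max B 0" for x
    using B[of x] assms(3)[of x] by (cases "x \<in> K") auto
  then show thesis by (intro that[of "max B 0"]) auto
qed

lemma test_functionD:
  fixes \<phi> :: "'a::euclidean_space \<Rightarrow> real"
  assumes \<phi>: "test_function \<Omega> \<phi>"
  obtains K where "compact K" "K \<subseteq> \<Omega>" "\<And>x. x \<notin> K \<Longrightarrow> \<phi> x = 0"
    "\<And>x z. x \<notin> K \<Longrightarrow> frechet_derivative \<phi> (at x) z = 0"
proof -
  define K where "K = closure {x. \<phi> x \<noteq> 0}"
  have K: "compact K" "K \<subseteq> \<Omega>" using \<phi> by (auto simp: K_def test_function_def)
  have z: "\<phi> x = 0" if "x \<notin> K" for x using that closure_subset[of "{x. \<phi> x \<noteq> 0}"] by (auto simp: K_def)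
  have "frechet_derivative \<phi> (at x) v = 0" if x: "x \<notin> K" for x v
  proof -
    have "open (- K)" using K(1) by (simp add: compact_imp_closed open_Compl)
    have "((\<lambda>_. 0) has_derivative (\<lambda>_. 0)) (at x)" by simp
    then have "(\<phi> has_derivative (\<lambda>_. 0)) (at x)"
      by (rule has_derivative_transform_within_open[OF _ \<open>open (- K)\<close>]) (use x z in auto)
    then show ?thesis by (metis frechet_derivative_at)
  qed
  with K z show thesis by (rule that)
qed

lemma test_function_differentiable: "test_function \<Omega> \<phi> \<Longrightarrow> \<phi> differentiable (at x)"
  unfolding test_function_def by (elim conjE allE[of _ "Suc 0"]) simp

lemma test_function_derivative_sum:
  assumes "test_function \<Omega> \<phi>"
  shows "frechet_derivative \<phi> (at x) z = (\<Sum>b\<in>Basis. (z \<bullet> b) * frechet_derivative \<phi> (at x) b)"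
proof -
  have l: "linear (frechet_derivative \<phi> (at x))"
    using test_function_differentiable[OF assms] linear_frechet_derivative by blast
  have "frechet_derivative \<phi> (at x) z = frechet_derivative \<phi> (at x) (\<Sum>b\<in>Basis. (z \<bullet> b) *\<^sub>R b)"
    by (simp add: euclidean_representation)
  also have "\<dots> = (\<Sum>b\<in>Basis. (z \<bullet> b) * frechet_derivative \<phi> (at x) b)"
    by (simp add: linear_sum[OF l] linear_scale[OF l])
  finally show ?thesis .
qed

lemma test_function_continuous:
  assumes \<phi>: "test_function \<Omega> \<phi>"
  shows "continuous_on UNIV \<phi>" "continuous_on UNIV (\<lambda>x. frechet_derivative \<phi> (at x) z)"
proof -
  have ck: "\<And>k. Ck_function k \<phi>" using \<phi> by (simp add: test_function_def)
  show "continuous_on UNIV \<phi>" using ck[of 0] by simp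
  have "continuous_on UNIV (\<lambda>x. frechet_derivative \<phi> (at x) b)" if "b \<in> Basis" for b
    using ck[of "Suc 0"] that by simp
  then show "continuous_on UNIV (\<lambda>x. frechet_derivative \<phi> (at x) z)"
    unfolding test_function_derivative_sum[OF \<phi>, of _ z] by (intro continuous_intros) auto
qed

lemma test_function_mono: "test_function V \<phi> \<Longrightarrow> V \<subseteq> \<Omega> \<Longrightarrow> test_function \<Omega> \<phi>"
  by (auto simp: test_function_def)

text \<open>A compactly supported \<phi> sees f on K only, so a locally integrable f can be traded
  for a globally integrable Borel function u that agrees with it almost everywhere on K.\<close>

lemma pairing_borel:
  fixes f u \<phi> :: "'a::euclidean_space \<Rightarrow> real"
  assumes \<Omega>: "\<Omega> \<in> sets borel" and K: "K \<subseteq> \<Omega>"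
    and u: "integrable lborel u" and eq: "AE x in lborel. x \<in> K \<longrightarrow> f x = u x"
    and \<phi>: "continuous_on UNIV \<phi>" "compact K" "\<And>x. x \<notin> K \<Longrightarrow> \<phi> x = 0"
  shows "integrable (lebesgue_on \<Omega>) (\<lambda>x. f x * \<phi> x)" "integrable lborel (\<lambda>x. u x * \<phi> x)"
    "(\<integral>x. f x * \<phi> x \<partial>lebesgue_on \<Omega>) = (\<integral>x. u x * \<phi> x \<partial>lborel)"
proof -
  have [measurable]: "u \<in> borel_measurable borel" "\<phi> \<in> borel_measurable borel"
    using u \<phi>(1) by (auto intro: borel_measurable_continuous_onI)
  obtain B where B: "\<And>x. \<bar>\<phi> x\<bar> \<le> B" using continuous_compact_support_bounded[OF \<phi>] by metis
  have "integrable lborel (\<lambda>x. B * u x)" using u by simp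
  then show i: "integrable lborel (\<lambda>x. u x * \<phi> x)"
  proof (rule Bochner_Integration.integrable_bound)
    show "AE x in lborel. norm (u x * \<phi> x) \<le> norm (B * u x)"
    proof (rule AE_I2)
      fix x
      have "\<bar>u x\<bar> * \<bar>\<phi> x\<bar> \<le> \<bar>u x\<bar> * \<bar>B\<bar>" using B[of x] by (intro mult_left_mono) auto
      then show "norm (u x * \<phi> x) \<le> norm (B * u x)" by (simp add: abs_mult mult.commute)
    qed
  qed measurable
  have eq': "AE x in lebesgue_on \<Omega>. f x * \<phi> x = u x * \<phi> x"
    unfolding AE_lebesgue_on_iff[OF \<Omega>] using eq
  proof eventually_elim
    case (elim x)
    then show ?case using \<phi>(3)[of x] by (cases "x \<in> K") auto
  qed
  have m: "(\<lambda>x. u x * \<phi> x) \<in> borel_measurable borel" by measurable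
  have z: "u x * \<phi> x = 0" if "x \<notin> \<Omega>" for x using that K \<phi>(3)[of x] by auto
  show "integrable (lebesgue_on \<Omega>) (\<lambda>x. f x * \<phi> x)"
    using lebesgue_on_borel_integrable_iff(1)[OF \<Omega> m eq' z] i by simp
  show "(\<integral>x. f x * \<phi> x \<partial>lebesgue_on \<Omega>) = (\<integral>x. u x * \<phi> x \<partial>lborel)"
    using lebesgue_on_borel_integrable_iff(2)[OF \<Omega> m eq' z] .
qed

lemma locally_integrable_borel:
  fixes f :: "'a::euclidean_space \<Rightarrow> real"
  assumes f: "locally_integrable \<Omega> f" and K: "compact K" "K \<subseteq> \<Omega>"
  obtains u where "integrable lborel u" "AE x in lborel. x \<in> K \<longrightarrow> f x = u x"
proof -
  have i: "integrable (lebesgue_on K) f" using f K by (simp add: locally_integrable_def)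
  have Kb: "K \<in> sets borel" using K(1) by (rule borel_compact)
  obtain u where u: "u \<in> borel_measurable borel" "AE x in lebesgue_on K. f x = u x" "\<And>x. x \<notin> K \<Longrightarrow> u x = 0"
    using borel_extension[OF Kb, of f] i by blast
  have "integrable lborel u" using lebesgue_on_borel_integrable_iff(1)[OF Kb u] i by simp
  moreover have "AE x in lborel. x \<in> K \<longrightarrow> f x = u x" using u(2) unfolding AE_lebesgue_on_iff[OF Kb] .
  ultimately show thesis by (rule that)
qed

lemma locally_integrable_pairing:
  fixes f :: "'a::euclidean_space \<Rightarrow> real"
  assumes \<Omega>: "\<Omega> \<in> sets borel" and f: "locally_integrable \<Omega> f" and \<phi>: "test_function \<Omega> \<phi>"
  shows "integrable (lebesgue_on \<Omega>) (\<lambda>x. f x * \<phi> x)"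
    "integrable (lebesgue_on \<Omega>) (\<lambda>x. f x * frechet_derivative \<phi> (at x) b)"
proof -
  obtain K where K: "compact K" "K \<subseteq> \<Omega>" "\<And>x. x \<notin> K \<Longrightarrow> \<phi> x = 0"
    "\<And>x z. x \<notin> K \<Longrightarrow> frechet_derivative \<phi> (at x) z = 0"
    using test_functionD[OF \<phi>] by metis
  obtain u where u: "integrable lborel u" "AE x in lborel. x \<in> K \<longrightarrow> f x = u x"
    using locally_integrable_borel[OF f K(1,2)] .
  show "integrable (lebesgue_on \<Omega>) (\<lambda>x. f x * \<phi> x)"
    by (rule pairing_borel(1)[OF \<Omega> K(2) u test_function_continuous(1)[OF \<phi>] K(1,3)])
  show "integrable (lebesgue_on \<Omega>) (\<lambda>x. f x * frechet_derivative \<phi> (at x) b)"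
    by (rule pairing_borel(1)[OF \<Omega> K(2) u test_function_continuous(2)[OF \<phi>] K(1,4)])
qed

text \<open>Mollifiers centred near a are test functions, so the mollifications of g vanish there,
  and almost everywhere they converge to g along a sequence of radii. The ball of radius 2 R leaves
  room for mollifiers of radius at most R about points of \<open>ball a R\<close>.\<close>

theorem fundamental_lemma_variations:
  fixes g :: "'a::euclidean_space \<Rightarrow> real"
  assumes V: "open V" and g: "locally_integrable V g"
    and ann: "\<And>\<phi>. test_function V \<phi> \<Longrightarrow> (\<integral>x. g x * \<phi> x \<partial>lebesgue_on V) = 0"
  shows "AE x in lebesgue_on V. g x = 0"
proof -
  have Vb: "V \<in> sets borel" using V by simp
  have loc: "AE y in lborel. y \<in> ball a R \<longrightarrow> g y = 0" if R: "R > 0" "cball a (2 * R) \<subseteq> V" for a R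
  proof -
    obtain u where u: "integrable lborel u" "AE x in lborel. x \<in> cball a (2 * R) \<longrightarrow> g x = u x"
      using locally_integrable_borel[OF g _ R(2)] by auto
    define r where "r m = R / real (Suc m)" for m
    have r: "r m > 0" "r m \<le> R" for m using R(1) by (auto simp: r_def field_simps)
    have "r \<longlonglongrightarrow> 0" unfolding r_def using LIMSEQ_Suc[OF lim_const_over_n[of R]] by simp
    then obtain \<rho> where \<rho>: "AE y in lborel. (\<lambda>m. local_osc u (r (\<rho> m)) y) \<longlonglongrightarrow> 0"
      using local_osc_tendsto_AE[OF u(1), of r] r(1) by auto
    have zero: "(\<integral>x. mollifier (r m) y x * u x \<partial>lborel) = 0" if y: "y \<in> ball a R" for y m
    proof -
      have c: "cball y (r m) \<subseteq> cball a (2 * R)"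
      proof
        fix x assume "x \<in> cball y (r m)"
        then show "x \<in> cball a (2 * R)"
          using y r(2)[of m] dist_triangle[of a x y] by simp
      qed
      have t: "test_function V (mollifier (r m) y)"
        by (rule mollifier_test_function[OF r(1)]) (use c R(2) in blast)
      have "0 = (\<integral>x. g x * mollifier (r m) y x \<partial>lebesgue_on V)" using ann[OF t] by simp
      also have "\<dots> = (\<integral>x. u x * mollifier (r m) y x \<partial>lborel)"
      proof (rule pairing_borel(3)[OF Vb R(2) u test_function_continuous(1)[OF t]])
        show "mollifier (r m) y x = 0" if "x \<notin> cball a (2 * R)" for x
          by (rule mollifier_eq_0[OF _ r(1)]) (use that c in force)
      qed simp
      finally show ?thesis by (simp add: mult.commute)
    qed
    show ?thesis using u(2) \<rho>
    proof eventually_elim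
      case (elim y)
      show ?case
      proof
        assume y: "y \<in> ball a R"
        have "(\<lambda>m. \<integral>x. mollifier (r (\<rho> m)) y x * u x \<partial>lborel) \<longlonglongrightarrow> u y"
          by (rule mollifier_tendsto[OF u(1) r(1) elim(2)])
        then have "u y = 0" unfolding zero[OF y] by (metis LIMSEQ_unique tendsto_const)
        moreover have "y \<in> cball a (2 * R)" using y R(1) by auto
        ultimately show "g y = 0" using elim(1) by simp
      qed
    qed
  qed
  have "\<exists>R>0. cball a (2 * R) \<subseteq> V" if a: "a \<in> V" for a
  proof -
    obtain e where "e > 0" "cball a e \<subseteq> V" using open_contains_cball[of V] V a by auto
    then show ?thesis by (intro exI[of _ "e/2"]) auto
  qed
  then obtain R where R: "\<And>a. a \<in> V \<Longrightarrow> R a > 0" "\<And>a. a \<in> V \<Longrightarrow> cball a (2 * R a) \<subseteq> V" by metis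
  \<comment> \<open>Countably many of these balls cover V, so the union of the exceptional sets is
    null.\<close>
  obtain F where F: "F \<subseteq> (\<lambda>a. ball a (R a)) ` V" "countable F" "\<Union>F = \<Union>((\<lambda>a. ball a (R a)) ` V)"
    using Lindelof[of "(\<lambda>a. ball a (R a)) ` V"] by auto
  have "AE y in lborel. \<forall>B\<in>F. y \<in> B \<longrightarrow> g y = 0"
    using F(1,2) loc R by (subst AE_ball_countable) auto
  then show ?thesis
    unfolding AE_lebesgue_on_iff[OF Vb]
  proof eventually_elim
    case (elim y)
    have "V \<subseteq> \<Union>F" unfolding F(3) using R(1) by auto
    then show ?case using elim by blast
  qed
qed

section \<open>Linearity, locality and uniqueness of weak gradients\<close>

lemma locally_integrable_add:
  "locally_integrable \<Omega> f \<Longrightarrow> locally_integrable \<Omega> g \<Longrightarrow> locally_integrable \<Omega> (\<lambda>x. f x + g x)"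
  by (auto simp: locally_integrable_def)

lemma locally_integrable_scaleR:
  "locally_integrable \<Omega> f \<Longrightarrow> locally_integrable \<Omega> (\<lambda>x. c *\<^sub>R f x)"
  by (auto simp: locally_integrable_def)

lemma locally_integrable_inner:
  "locally_integrable \<Omega> f \<Longrightarrow> locally_integrable \<Omega> (\<lambda>x. f x \<bullet> b)"
  by (auto simp: locally_integrable_def)

lemma locally_integrable_subset:
  "locally_integrable \<Omega> f \<Longrightarrow> V \<subseteq> \<Omega> \<Longrightarrow> locally_integrable V f"
  by (auto simp: locally_integrable_def)

lemma locally_integrable_const:
  "locally_integrable \<Omega> (\<lambda>x. c)"
  unfolding locally_integrable_def
proof (intro allI impI)
  fix K :: "'a set" assume K: "compact K \<and> K \<subseteq> \<Omega>"
  then have "K \<in> lmeasurable" by (simp add: lmeasurable_compact)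
  then have "finite_measure (lebesgue_on K)"
    by (intro finite_measureI) (auto simp: emeasure_restrict_space fmeasurable_def)
  then show "integrable (lebesgue_on K) (\<lambda>x. c)" by (rule finite_measure.integrable_const)
qed

lemma is_weak_gradient_add:
  assumes \<Omega>: "\<Omega> \<in> sets borel" and f: "is_weak_gradient \<Omega> f F" and g: "is_weak_gradient \<Omega> g G"
  shows "is_weak_gradient \<Omega> (\<lambda>x. f x + g x) (\<lambda>x. F x + G x)"
  unfolding is_weak_gradient_def
proof (intro conjI allI impI ballI)
  show "locally_integrable \<Omega> (\<lambda>x. f x + g x)" "locally_integrable \<Omega> (\<lambda>x. F x + G x)"
    using f g by (auto simp: is_weak_gradient_def intro!: locally_integrable_add)
  fix \<phi> :: "'a \<Rightarrow> real" and b :: 'a assume \<phi>: "test_function \<Omega> \<phi>" and b: "b \<in> Basis"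
  have li: "locally_integrable \<Omega> f" "locally_integrable \<Omega> g"
    "locally_integrable \<Omega> (\<lambda>x. F x \<bullet> b)" "locally_integrable \<Omega> (\<lambda>x. G x \<bullet> b)"
    using f g by (auto simp: is_weak_gradient_def intro: locally_integrable_inner)
  note i = locally_integrable_pairing[OF \<Omega> li(1) \<phi>] locally_integrable_pairing[OF \<Omega> li(2) \<phi>]
    locally_integrable_pairing[OF \<Omega> li(3) \<phi>] locally_integrable_pairing[OF \<Omega> li(4) \<phi>]
  show "(\<integral>x. (f x + g x) * frechet_derivative \<phi> (at x) b \<partial>lebesgue_on \<Omega>) =
        - (\<integral>x. ((F x + G x) \<bullet> b) * \<phi> x \<partial>lebesgue_on \<Omega>)"
    using f g \<phi> b i by (simp add: is_weak_gradient_def distrib_right inner_add_left)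
qed

lemma is_weak_gradient_scale:
  assumes f: "is_weak_gradient \<Omega> f F"
  shows "is_weak_gradient \<Omega> (\<lambda>x. c * f x) (\<lambda>x. c *\<^sub>R F x)"
  unfolding is_weak_gradient_def
proof (intro conjI allI impI ballI)
  show "locally_integrable \<Omega> (\<lambda>x. c * f x)" "locally_integrable \<Omega> (\<lambda>x. c *\<^sub>R F x)"
    using f locally_integrable_scaleR[of \<Omega> f c] by (auto simp: is_weak_gradient_def intro!: locally_integrable_scaleR)
  fix \<phi> :: "'a \<Rightarrow> real" and b :: 'a assume \<phi>: "test_function \<Omega> \<phi>" and b: "b \<in> Basis"
  show "(\<integral>x. c * f x * frechet_derivative \<phi> (at x) b \<partial>lebesgue_on \<Omega>) =
        - (\<integral>x. (c *\<^sub>R F x \<bullet> b) * \<phi> x \<partial>lebesgue_on \<Omega>)"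
    using f \<phi> b by (simp add: is_weak_gradient_def mult.assoc)
qed

text \<open>A test function on V is one on \<Omega>, and f times its derivative is 0 everywhere. So
  each coordinate of F annihilates all test functions on V, and the fundamental lemma
  applies.\<close>

lemma weak_gradient_zero_on_open:
  assumes \<Omega>: "open \<Omega>" and V: "open V" "V \<subseteq> \<Omega>" and f: "is_weak_gradient \<Omega> f F" and z: "\<And>x. x \<in> V \<Longrightarrow> f x = 0"
  shows "AE x in lebesgue_on V. F x = 0"
proof -
  have Vb: "V \<in> sets borel" and Ob: "\<Omega> \<in> sets borel" using V(1) \<Omega> by auto
  have "AE x in lebesgue_on V. F x \<bullet> b = 0" if b: "b \<in> Basis" for b
  proof (rule fundamental_lemma_variations[OF V(1)])
    have liF: "locally_integrable \<Omega> (\<lambda>x. F x \<bullet> b)" using f by (auto simp: is_weak_gradient_def intro: locally_integrable_inner)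
    then show "locally_integrable V (\<lambda>x. F x \<bullet> b)" using V(2) by (rule locally_integrable_subset)
    fix \<phi> :: "'a \<Rightarrow> real" assume \<phi>: "test_function V \<phi>"
    have \<phi>': "test_function \<Omega> \<phi>" using test_function_mono[OF \<phi> V(2)] .
    obtain K where K: "compact K" "K \<subseteq> V" "\<And>x. x \<notin> K \<Longrightarrow> \<phi> x = 0"
      "\<And>x z. x \<notin> K \<Longrightarrow> frechet_derivative \<phi> (at x) z = 0"
      using test_functionD[OF \<phi>] by metis
    obtain u where u: "integrable lborel u" "AE x in lborel. x \<in> K \<longrightarrow> F x \<bullet> b = u x"
      using locally_integrable_borel[OF liF K(1)] K(2) V(2) by blast
    have "f x * frechet_derivative \<phi> (at x) b = 0" for x
      using z[of x] K(2) K(4)[of x b] by (cases "x \<in> V") auto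
    then have "(\<lambda>x. f x * frechet_derivative \<phi> (at x) b) = (\<lambda>x. 0)" by (rule ext)
    then have "(\<integral>x. f x * frechet_derivative \<phi> (at x) b \<partial>lebesgue_on \<Omega>) = 0" by simp
    then have "(\<integral>x. (F x \<bullet> b) * \<phi> x \<partial>lebesgue_on \<Omega>) = 0"
      using f \<phi>' b unfolding is_weak_gradient_def by auto
    moreover have "(\<integral>x. (F x \<bullet> b) * \<phi> x \<partial>lebesgue_on \<Omega>) = (\<integral>x. u x * \<phi> x \<partial>lborel)"
      by (rule pairing_borel(3)[OF Ob _ u test_function_continuous(1)[OF \<phi>] K(1,3)]) (use K(2) V(2) in auto)
    moreover have "(\<integral>x. (F x \<bullet> b) * \<phi> x \<partial>lebesgue_on V) = (\<integral>x. u x * \<phi> x \<partial>lborel)"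
      by (rule pairing_borel(3)[OF Vb K(2) u test_function_continuous(1)[OF \<phi>] K(1,3)])
    ultimately show "(\<integral>x. (F x \<bullet> b) * \<phi> x \<partial>lebesgue_on V) = 0" by simp
  qed
  then have "AE x in lebesgue_on V. \<forall>b\<in>Basis. F x \<bullet> b = 0" by (intro AE_finite_allI) auto
  then show ?thesis by eventually_elim (simp add: euclidean_all_zero_iff)
qed

text \<open>The difference is a weak gradient of f - f = 0, so locality applies with V = \<Omega>.
  Hence norms of the chosen \<open>weak_gradient\<close> can be computed from any gradient at
  hand.\<close>

lemma weak_gradient_unique:
  assumes \<Omega>: "open \<Omega>" and F: "is_weak_gradient \<Omega> f F" and G: "is_weak_gradient \<Omega> f G"
  shows "AE x in lebesgue_on \<Omega>. F x = G x"
proof -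
  have "is_weak_gradient \<Omega> (\<lambda>x. f x + (-1) * f x) (\<lambda>x. F x + (-1) *\<^sub>R G x)"
    using \<Omega> by (intro is_weak_gradient_add is_weak_gradient_scale F G) auto
  from weak_gradient_zero_on_open[OF \<Omega> \<Omega> order_refl this]
  show ?thesis by simp
qed

text \<open>Dominated convergence: the mean value inequality bounds the difference quotients of
  \<psi> by the supremum B of its derivative along z, so B |u| dominates.\<close>

lemma integral_translate_derivative:
  fixes u \<psi> :: "'a::euclidean_space \<Rightarrow> real"
  assumes u: "integrable lborel u" and \<psi>: "test_function \<Omega> \<psi>"
  shows "((\<lambda>t. \<integral>y. u y * \<psi> (y - t *\<^sub>R z) \<partial>lborel) has_real_derivative
    - (\<integral>y. u y * frechet_derivative \<psi> (at (y - t *\<^sub>R z)) z \<partial>lborel)) (at t)"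
proof -
  let ?D = "\<lambda>x. frechet_derivative \<psi> (at x) z"
  obtain K where K: "compact K" "\<And>x. x \<notin> K \<Longrightarrow> \<psi> x = 0" "\<And>x z. x \<notin> K \<Longrightarrow> frechet_derivative \<psi> (at x) z = 0"
    using test_functionD[OF \<psi>] by metis
  obtain B0 where B0: "\<And>x. \<bar>\<psi> x\<bar> \<le> B0"
    using continuous_compact_support_bounded[OF test_function_continuous(1)[OF \<psi>] K(1,2)] by metis
  obtain B where B: "\<And>x. \<bar>?D x\<bar> \<le> B"
    using continuous_compact_support_bounded[OF test_function_continuous(2)[OF \<psi>] K(1,3)] by metis
  have [measurable]: "u \<in> borel_measurable borel" using u by auto
  have [measurable]: "\<psi> \<in> borel_measurable borel" "?D \<in> borel_measurable borel"
    using test_function_continuous[OF \<psi>] by (auto intro: borel_measurable_continuous_onI)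
  have int: "integrable lborel (\<lambda>y. u y * \<psi> (y - s *\<^sub>R z))" for s
  proof (rule Bochner_Integration.integrable_bound[of _ "\<lambda>y. B0 * u y"])
    show "AE y in lborel. norm (u y * \<psi> (y - s *\<^sub>R z)) \<le> norm (B0 * u y)"
    proof (rule AE_I2)
      fix y
      have "\<bar>u y\<bar> * \<bar>\<psi> (y - s *\<^sub>R z)\<bar> \<le> \<bar>u y\<bar> * \<bar>B0\<bar>"
        using B0[of "y - s *\<^sub>R z"] by (intro mult_left_mono) auto
      then show "norm (u y * \<psi> (y - s *\<^sub>R z)) \<le> norm (B0 * u y)" by (simp add: abs_mult mult.commute)
    qed
  qed (use u in auto)
  have dg: "((\<lambda>s. \<psi> (y - s *\<^sub>R z)) has_real_derivative - ?D (y - s *\<^sub>R z)) (at s)" for y s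
  proof -
    have 1: "((\<lambda>s. y - s *\<^sub>R z) has_derivative (\<lambda>h. - (h *\<^sub>R z))) (at s)"
      by (auto intro!: derivative_eq_intros)
    have 2: "(\<psi> has_derivative frechet_derivative \<psi> (at (y - s *\<^sub>R z))) (at (y - s *\<^sub>R z))"
      using test_function_differentiable[OF \<psi>] frechet_derivative_works by blast
    have l: "linear (frechet_derivative \<psi> (at (y - s *\<^sub>R z)))"
      using test_function_differentiable[OF \<psi>] linear_frechet_derivative by blast
    from has_derivative_compose[OF 1 2]
    have "((\<lambda>s. \<psi> (y - s *\<^sub>R z)) has_derivative (\<lambda>h. frechet_derivative \<psi> (at (y - s *\<^sub>R z)) (- (h *\<^sub>R z)))) (at s)" .
    moreover have "(\<lambda>h. frechet_derivative \<psi> (at (y - s *\<^sub>R z)) (- (h *\<^sub>R z))) = (*) (- ?D (y - s *\<^sub>R z))"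
      by (auto simp: linear_neg[OF l] linear_scale[OF l])
    ultimately show ?thesis by (simp add: has_field_derivative_def)
  qed
  show ?thesis
    unfolding DERIV_def tendsto_at_iff_sequentially comp_def
  proof (intro allI impI)
    fix X :: "nat \<Rightarrow> real" assume X0: "\<forall>i. X i \<in> UNIV - {0}" and X: "X \<longlonglongrightarrow> 0"
    let ?q = "\<lambda>i y. (\<psi> (y - (t + X i) *\<^sub>R z) - \<psi> (y - t *\<^sub>R z)) / X i"
    have Xn: "X i \<noteq> 0" for i using X0 by auto
    have eq: "((\<integral>y. u y * \<psi> (y - (t + X i) *\<^sub>R z) \<partial>lborel) - (\<integral>y. u y * \<psi> (y - t *\<^sub>R z) \<partial>lborel)) / X i
       = (\<integral>y. u y * ?q i y \<partial>lborel)" for i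
    proof -
      have "(\<integral>y. u y * \<psi> (y - (t + X i) *\<^sub>R z) \<partial>lborel) - (\<integral>y. u y * \<psi> (y - t *\<^sub>R z) \<partial>lborel)
        = (\<integral>y. u y * (\<psi> (y - (t + X i) *\<^sub>R z) - \<psi> (y - t *\<^sub>R z)) \<partial>lborel)"
        using int[of "t + X i"] int[of t] by (simp add: right_diff_distrib)
      then show ?thesis by simp
    qed
    have "(\<lambda>i. \<integral>y. u y * ?q i y \<partial>lborel)
       \<longlonglongrightarrow> (\<integral>y. u y * (- ?D (y - t *\<^sub>R z)) \<partial>lborel)"
    proof (rule integral_dominated_convergence[where w="\<lambda>y. B * \<bar>u y\<bar>"])
      show "integrable lborel (\<lambda>y. B * \<bar>u y\<bar>)" using u by simp
      show "AE y in lborel. (\<lambda>i. u y * ?q i y) \<longlonglongrightarrow> u y * (- ?D (y - t *\<^sub>R z))"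
      proof (rule AE_I2)
        fix y
        have "((\<lambda>h. (\<psi> (y - (t + h) *\<^sub>R z) - \<psi> (y - t *\<^sub>R z)) / h) \<longlongrightarrow> - ?D (y - t *\<^sub>R z)) (at 0)"
          using dg[of y t] by (simp add: DERIV_def)
        then have "(\<lambda>i. ?q i y) \<longlonglongrightarrow> - ?D (y - t *\<^sub>R z)"
          unfolding tendsto_at_iff_sequentially comp_def using X0 X by blast
        then show "(\<lambda>i. u y * ?q i y) \<longlonglongrightarrow> u y * (- ?D (y - t *\<^sub>R z))"
          by (intro tendsto_intros)
      qed
      show "AE y in lborel. norm (u y * ?q i y) \<le> B * \<bar>u y\<bar>" for i
      proof (rule AE_I2)
        fix y
        have "norm (\<psi> (y - (t + X i) *\<^sub>R z) - \<psi> (y - t *\<^sub>R z)) \<le> B * norm ((t + X i) - t)"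
          by (rule field_differentiable_bound[of UNIV "\<lambda>s. \<psi> (y - s *\<^sub>R z)" "\<lambda>s. - ?D (y - s *\<^sub>R z)"]) (use dg B in auto)
        then have "\<bar>?q i y\<bar> \<le> B"
          using Xn[of i] by (simp add: abs_divide divide_le_eq)
        then have "\<bar>u y\<bar> * \<bar>?q i y\<bar> \<le> \<bar>u y\<bar> * B"
          by (rule mult_left_mono) simp
        then show "norm (u y * ?q i y) \<le> B * \<bar>u y\<bar>"
          by (simp add: abs_mult mult.commute)
      qed
    qed measurable
    then show "(\<lambda>i. ((\<integral>y. u y * \<psi> (y - (t + X i) *\<^sub>R z) \<partial>lborel) - (\<integral>y. u y * \<psi> (y - t *\<^sub>R z) \<partial>lborel)) / X i)
        \<longlonglongrightarrow> - (\<integral>y. u y * ?D (y - t *\<^sub>R z) \<partial>lborel)"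
      unfolding eq by simp
  qed
qed

text \<open>By translation invariance the integral of \<psi>(y - t z) is constant in t;
  differentiating at t = 0 gives the claim.\<close>

lemma integral_test_function_derivative:
  fixes \<psi> :: "'a::euclidean_space \<Rightarrow> real"
  assumes \<psi>: "test_function \<Omega> \<psi>"
  shows "(\<integral>y. frechet_derivative \<psi> (at y) z \<partial>lborel) = 0"
proof -
  obtain K where K: "compact K" "\<And>x. x \<notin> K \<Longrightarrow> \<psi> x = 0" "\<And>x z. x \<notin> K \<Longrightarrow> frechet_derivative \<psi> (at x) z = 0"
    using test_functionD[OF \<psi>] by metis
  obtain R where R: "\<And>x. x \<in> K \<Longrightarrow> norm x \<le> R" using compact_imp_bounded[OF K(1)] by (auto simp: bounded_iff)
  \<comment> \<open>The differentiation lemma takes an integrable factor u. This one equals 1 on the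
    support of every translate with |t| <= 1, so it does not change the integrals.\<close>
  define u :: "'a \<Rightarrow> real" where "u = indicator (cball 0 (R + norm z))"
  have [measurable]: "\<psi> \<in> borel_measurable borel"
    using test_function_continuous(1)[OF \<psi>] by (auto intro: borel_measurable_continuous_onI)
  have iu: "integrable lborel u"
    unfolding u_def by (intro integrable_real_indicator) (use emeasure_bounded_finite[OF bounded_cball] in auto)
  have const: "(\<integral>y. u y * \<psi> (y - t *\<^sub>R z) \<partial>lborel) = (\<integral>y. \<psi> y \<partial>lborel)" if "\<bar>t\<bar> \<le> 1" for t
  proof -
    have "u y * \<psi> (y - t *\<^sub>R z) = \<psi> (y - t *\<^sub>R z)" for y
    proof (cases "y - t *\<^sub>R z \<in> K")
      case True
      have "norm y \<le> norm (y - t *\<^sub>R z) + norm (t *\<^sub>R z)" by (metis diff_add_cancel norm_triangle_ineq)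
      also have "\<dots> \<le> R + norm z"
        using R[OF True] that by (intro add_mono) (auto intro: mult_left_le_one_le)
      finally show ?thesis by (simp add: u_def)
    qed (simp add: K(2))
    then have "(\<lambda>y. u y * \<psi> (y - t *\<^sub>R z)) = (\<lambda>y. \<psi> (- (t *\<^sub>R z) + y))" by auto
    then have "(\<integral>y. u y * \<psi> (y - t *\<^sub>R z) \<partial>lborel) = (\<integral>y. \<psi> (- (t *\<^sub>R z) + y) \<partial>lborel)" by simp
    also have "\<dots> = (\<integral>y. \<psi> y \<partial>distr lborel borel ((+) (- (t *\<^sub>R z))))"
      by (subst integral_distr) auto
    also have "\<dots> = (\<integral>y. \<psi> y \<partial>lborel)" by (subst lborel_distr_plus) simp
    finally show ?thesis .
  qed
  have "((\<lambda>t. \<integral>y. \<psi> y \<partial>lborel) has_real_derivative - (\<integral>y. u y * frechet_derivative \<psi> (at (y - 0 *\<^sub>R z)) z \<partial>lborel)) (at 0)"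
  proof (rule has_field_derivative_transform_within_open[OF integral_translate_derivative[OF iu \<psi>]])
    show "open {-1<..<1::real}" by simp
  qed (use const in auto)
  then have "(\<integral>y. u y * frechet_derivative \<psi> (at y) z \<partial>lborel) = 0"
    using DERIV_unique[OF _ DERIV_const] by fastforce
  moreover have "u y * frechet_derivative \<psi> (at y) z = frechet_derivative \<psi> (at y) z" for y
  proof (cases "y \<in> K")
    case True
    then have "norm y \<le> R + norm z" using R[OF True] norm_ge_zero[of z] by linarith
    then show ?thesis by (simp add: u_def)
  qed (simp add: K(3))
  ultimately show ?thesis by simp
qed

lemma is_weak_gradient_const:
  fixes \<Omega> :: "'a::euclidean_space set"
  assumes \<Omega>: "\<Omega> \<in> sets borel"
  shows "is_weak_gradient \<Omega> (\<lambda>x. c) (\<lambda>x. 0)"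
  unfolding is_weak_gradient_def
proof (intro conjI locally_integrable_const allI impI ballI)
  fix \<phi> :: "'a \<Rightarrow> real" and b :: 'a assume \<phi>: "test_function \<Omega> \<phi>" and b: "b \<in> Basis"
  obtain K where K: "compact K" "K \<subseteq> \<Omega>" "\<And>x z. x \<notin> K \<Longrightarrow> frechet_derivative \<phi> (at x) z = 0"
    using test_functionD[OF \<phi>] by metis
  have [measurable]: "K \<in> sets borel" using K(1) by (rule borel_compact)
  have "(\<integral>x. c * frechet_derivative \<phi> (at x) b \<partial>lebesgue_on \<Omega>)
     = (\<integral>x. c * indicator K x * frechet_derivative \<phi> (at x) b \<partial>lborel)"
  proof (rule pairing_borel(3)[OF \<Omega> K(2) _ _ test_function_continuous(2)[OF \<phi>] K(1,3)])
    show "integrable lborel (\<lambda>x. c * indicator K x :: real)"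
      using emeasure_bounded_finite[OF compact_imp_bounded[OF K(1)]] by (intro integrable_mult_right integrable_real_indicator) auto
  qed auto
  also have "\<dots> = (\<integral>x. c * frechet_derivative \<phi> (at x) b \<partial>lborel)"
    using K(3) by (intro Bochner_Integration.integral_cong) (auto simp: indicator_def)
  also have "\<dots> = 0" using integral_test_function_derivative[OF \<phi>] by simp
  finally show "(\<integral>x. c * frechet_derivative \<phi> (at x) b \<partial>lebesgue_on \<Omega>) = - (\<integral>x. (0 \<bullet> b) * \<phi> x \<partial>lebesgue_on \<Omega>)"
    by simp
qed

lemma is_weak_gradient_sum:
  assumes \<Omega>: "\<Omega> \<in> sets borel" and J: "finite J" "\<And>j. j \<in> J \<Longrightarrow> is_weak_gradient \<Omega> (f j) (F j)"
  shows "is_weak_gradient \<Omega> (\<lambda>x. \<Sum>j\<in>J. a j * f j x) (\<lambda>x. \<Sum>j\<in>J. a j *\<^sub>R F j x)"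
  using J
proof (induction J rule: finite_induct)
  case empty
  then show ?case using is_weak_gradient_const[OF \<Omega>, of 0] by simp
next
  case (insert j J)
  then show ?case
    using is_weak_gradient_add[OF \<Omega> is_weak_gradient_scale[of \<Omega> "f j" "F j" "a j"]] by simp
qed


subsection \<open>Difference quotients of Sobolev functions\<close>

text \<open>The mollification of h at x + t z is differentiable in t, and its derivative is the
  mollification of the component of G along z, because the mollifiers along the segment are test
  functions on \<Omega>. Then the fundamental theorem of calculus on [0,1] and Jensen, first in t
  and then in y.\<close>

lemma mollified_difference_powr_le:
  fixes h :: "'a::euclidean_space \<Rightarrow> real" and G :: "'a \<Rightarrow> 'a"
  assumes h: "integrable lborel h" and G: "integrable lborel G"
    and wg: "\<And>\<phi> b. test_function \<Omega> \<phi> \<Longrightarrow> b \<in> Basis \<Longrightarrow>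
      (\<integral>y. h y * frechet_derivative \<phi> (at y) b \<partial>lborel) = - (\<integral>y. (G y \<bullet> b) * \<phi> y \<partial>lborel)"
    and p: "p \<ge> 1" and r: "r > 0" and sub: "\<And>t. t \<in> {0..1} \<Longrightarrow> cball (x + t *\<^sub>R z) r \<subseteq> \<Omega>"
  shows "ennreal (\<bar>(\<integral>y. mollifier r (x + z) y * h y \<partial>lborel) - (\<integral>y. mollifier r x y * h y \<partial>lborel)\<bar> powr p)
    \<le> (\<integral>\<^sup>+t. indicator {0..1} t * (\<integral>\<^sup>+y. ennreal (mollifier r (x + t *\<^sub>R z) y) * ennreal (norm z powr p * norm (G y) powr p) \<partial>lborel) \<partial>lborel)"
proof -
  have [measurable]: "h \<in> borel_measurable borel" "G \<in> borel_measurable borel" using h G by auto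
  define g where "g t = (\<integral>y. h y * mollifier r x (y - t *\<^sub>R z) \<partial>lborel)" for t
  define k where "k t = (\<integral>y. mollifier r (x + t *\<^sub>R z) y * (G y \<bullet> z) \<partial>lborel)" for t
  have iGz: "integrable lborel (\<lambda>y. G y \<bullet> z)" for z using G by simp
  have tf: "test_function UNIV (mollifier r x)" by (rule mollifier_test_function[OF r]) simp
  have dk: "(g has_real_derivative k t) (at t)" if t: "t \<in> {0..1}" for t
  proof -
    have tft: "test_function \<Omega> (mollifier r (x + t *\<^sub>R z))" by (rule mollifier_test_function[OF r sub[OF t]])
    have shift: "mollifier r (x + t *\<^sub>R z) = (\<lambda>y. mollifier r x (y - t *\<^sub>R z))" by (rule ext, rule mollifier_shift)
    have D: "frechet_derivative (mollifier r (x + t *\<^sub>R z)) (at y) = frechet_derivative (mollifier r x) (at (y - t *\<^sub>R z))" for y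
    proof -
      have 1: "((\<lambda>y. y - t *\<^sub>R z) has_derivative (\<lambda>h. h)) (at y)" by (auto intro!: derivative_eq_intros)
      have 2: "(mollifier r x has_derivative frechet_derivative (mollifier r x) (at (y - t *\<^sub>R z))) (at (y - t *\<^sub>R z))"
        using test_function_differentiable[OF tf] frechet_derivative_works by blast
      from has_derivative_compose[OF 1 2]
      show ?thesis unfolding shift by (metis frechet_derivative_at)
    qed
    have hD: "integrable lborel (\<lambda>y. h y * frechet_derivative (mollifier r (x + t *\<^sub>R z)) (at y) b)" for b
    proof -
      obtain K where K: "compact K" "K \<subseteq> \<Omega>" "\<And>y z'. y \<notin> K \<Longrightarrow> frechet_derivative (mollifier r (x + t *\<^sub>R z)) (at y) z' = 0"
        using test_functionD[OF tft] by metis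
      show ?thesis
        by (rule pairing_borel(2)[of UNIV K h h, OF _ _ h _ test_function_continuous(2)[OF tft] K(1,3)]) auto
    qed
    have "(\<integral>y. h y * frechet_derivative (mollifier r x) (at (y - t *\<^sub>R z)) z \<partial>lborel)
       = (\<integral>y. (\<Sum>b\<in>Basis. (z \<bullet> b) * (h y * frechet_derivative (mollifier r (x + t *\<^sub>R z)) (at y) b)) \<partial>lborel)"
      unfolding D[symmetric]
      by (subst test_function_derivative_sum[OF tft]) (simp add: sum_distrib_left mult_ac)
    also have "\<dots> = (\<Sum>b\<in>Basis. (z \<bullet> b) * (\<integral>y. h y * frechet_derivative (mollifier r (x + t *\<^sub>R z)) (at y) b \<partial>lborel))"
      using hD by (subst Bochner_Integration.integral_sum) auto
    also have "\<dots> = (\<Sum>b\<in>Basis. - ((z \<bullet> b) * (\<integral>y. (G y \<bullet> b) * mollifier r (x + t *\<^sub>R z) y \<partial>lborel)))"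
      using wg[OF tft] by (intro sum.cong) auto
    also have "\<dots> = - (\<integral>y. (\<Sum>b\<in>Basis. (z \<bullet> b) * ((G y \<bullet> b) * mollifier r (x + t *\<^sub>R z) y)) \<partial>lborel)"
      using mollifier_approx(1)[OF iGz r]
      by (subst Bochner_Integration.integral_sum) (auto simp: sum_negf mult.commute[of _ "mollifier _ _ _"])
    also have "(\<lambda>y. \<Sum>b\<in>Basis. (z \<bullet> b) * ((G y \<bullet> b) * mollifier r (x + t *\<^sub>R z) y)) = (\<lambda>y. mollifier r (x + t *\<^sub>R z) y * (G y \<bullet> z))"
      by (rule ext, subst euclidean_inner) (simp add: sum_distrib_left mult_ac)
    finally have "k t = - (\<integral>y. h y * frechet_derivative (mollifier r x) (at (y - t *\<^sub>R z)) z \<partial>lborel)"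
      by (simp add: k_def)
    then show ?thesis
      using integral_translate_derivative[OF h tf, of z t] unfolding g_def[abs_def] by simp
  qed
  have km [measurable]: "k \<in> borel_measurable borel"
  proof -
    have "(\<lambda>t. \<integral>y. mollifier r x (y - t *\<^sub>R z) * (G y \<bullet> z) \<partial>lborel) \<in> borel_measurable borel"
      by (rule lborel.borel_measurable_lebesgue_integral) measurable
    then show ?thesis unfolding k_def[abs_def] mollifier_shift .
  qed
  \<comment> \<open>A crude bound that degenerates as r tends to 0; it serves the integrability of
    \<open>k\<close> on [0,1] only.\<close>
  define B where "B = mollifier_const TYPE('a) * (1 / r ^ DIM('a)) * (\<integral>y. \<bar>G y \<bullet> z\<bar> \<partial>lborel)"
  have kB: "\<bar>k t\<bar> \<le> B" for t
  proof -
    have "\<bar>k t\<bar> \<le> (\<integral>y. \<bar>mollifier r (x + t *\<^sub>R z) y * (G y \<bullet> z)\<bar> \<partial>lborel)"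
      unfolding k_def by (rule integral_abs_bound)
    also have "\<dots> \<le> (\<integral>y. mollifier_const TYPE('a) * (1 / r ^ DIM('a)) * \<bar>G y \<bullet> z\<bar> \<partial>lborel)"
    proof (rule integral_mono)
      show "integrable lborel (\<lambda>y. \<bar>mollifier r (x + t *\<^sub>R z) y * (G y \<bullet> z)\<bar>)"
        using mollifier_approx(1)[OF iGz r] by (rule integrable_abs)
      show "integrable lborel (\<lambda>y. mollifier_const TYPE('a) * (1 / r ^ DIM('a)) * \<bar>G y \<bullet> z\<bar>)"
        using iGz by (intro integrable_mult_right integrable_abs)
      fix y
      have "mollifier r (x + t *\<^sub>R z) y \<le> mollifier_const TYPE('a) * (1 / r ^ DIM('a))"
        using mollifier_le[OF r, of "x + t *\<^sub>R z" y] mollifier_const_pos[where 'a='a] r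
        by (cases "y \<in> ball (x + t *\<^sub>R z) r") (auto intro: order_trans)
      then show "\<bar>mollifier r (x + t *\<^sub>R z) y * (G y \<bullet> z)\<bar> \<le> mollifier_const TYPE('a) * (1 / r ^ DIM('a)) * \<bar>G y \<bullet> z\<bar>"
        using mollifier_nonneg[OF r, of "x + t *\<^sub>R z" y] unfolding abs_mult by (intro mult_right_mono) auto
    qed
    also have "\<dots> = B" unfolding B_def by (rule integral_mult_right_zero)
    finally show ?thesis .
  qed
  have ik: "integrable lborel (\<lambda>t. indicator {0..1} t * k t)"
  proof (rule Bochner_Integration.integrable_bound)
    show "integrable lborel (\<lambda>t. B * indicator {0..1::real} t)"
      by (intro integrable_mult_right integrable_real_indicator) auto
    show "AE t in lborel. norm (indicator {0..1} t * k t) \<le> norm (B * indicator {0..1} t)"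
      using kB order_trans[OF abs_ge_zero kB] by (intro AE_I2) (auto simp: indicator_def)
  qed measurable
  have "(k has_integral (g 1 - g 0)) {0..1}"
    by (rule fundamental_theorem_of_calculus)
       (use dk in \<open>auto simp: has_real_derivative_iff_has_vector_derivative[symmetric] intro: has_field_derivative_at_within\<close>)
  moreover have "set_integrable lborel {0..1} k" using ik by (simp add: set_integrable_def)
  ultimately have gk: "g 1 - g 0 = (\<integral>t. indicator {0..1} t * k t \<partial>lborel)"
    using set_borel_integral_eq_integral(2)[of "{0..1}" k] by (simp add: set_lebesgue_integral_def integral_unique)
  have gm: "g 1 = (\<integral>y. mollifier r (x + z) y * h y \<partial>lborel)" "g 0 = (\<integral>y. mollifier r x y * h y \<partial>lborel)"
    unfolding g_def mollifier_shift by (simp_all add: mult.commute)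
  have kp: "ennreal (\<bar>k t\<bar> powr p) \<le> (\<integral>\<^sup>+y. ennreal (mollifier r (x + t *\<^sub>R z) y) * ennreal (norm z powr p * norm (G y) powr p) \<partial>lborel)" for t
  proof -
    have "ennreal (\<bar>k t\<bar> powr p) \<le> (\<integral>\<^sup>+y. ennreal (mollifier r (x + t *\<^sub>R z) y * \<bar>G y \<bullet> z\<bar> powr p) \<partial>lborel)"
      unfolding k_def by (rule abs_integral_weighted_powr_le)
        (use p r mollifier_approx(1)[OF iGz r] in \<open>auto simp: mollifier_nonneg integrable_mollifier integral_mollifier\<close>)
    also have "\<dots> \<le> (\<integral>\<^sup>+y. ennreal (mollifier r (x + t *\<^sub>R z) y) * ennreal (norm z powr p * norm (G y) powr p) \<partial>lborel)"
    proof (rule nn_integral_mono)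
      fix y
      have "\<bar>G y \<bullet> z\<bar> powr p \<le> (norm (G y) * norm z) powr p"
        using p Cauchy_Schwarz_ineq2[of "G y" z] by (intro powr_mono2) auto
      also have "\<dots> = norm z powr p * norm (G y) powr p" by (simp add: powr_mult mult.commute)
      finally show "ennreal (mollifier r (x + t *\<^sub>R z) y * \<bar>G y \<bullet> z\<bar> powr p)
          \<le> ennreal (mollifier r (x + t *\<^sub>R z) y) * ennreal (norm z powr p * norm (G y) powr p)"
        using mollifier_nonneg[OF r, of "x + t *\<^sub>R z" y]
        by (subst ennreal_mult[symmetric]) (auto intro!: ennreal_leI mult_left_mono)
    qed
    finally show ?thesis .
  qed
  have "ennreal (\<bar>g 1 - g 0\<bar> powr p) \<le> (\<integral>\<^sup>+t. ennreal (indicator {0..1} t * \<bar>k t\<bar> powr p) \<partial>lborel)"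
    unfolding gk by (rule abs_integral_weighted_powr_le) (use p ik in auto)
  also have "\<dots> = (\<integral>\<^sup>+t. indicator {0..1} t * ennreal (\<bar>k t\<bar> powr p) \<partial>lborel)"
    by (intro nn_integral_cong) (auto simp: indicator_def)
  also have "\<dots> \<le> (\<integral>\<^sup>+t. indicator {0..1} t * (\<integral>\<^sup>+y. ennreal (mollifier r (x + t *\<^sub>R z) y) * ennreal (norm z powr p * norm (G y) powr p) \<partial>lborel) \<partial>lborel)"
    by (intro nn_integral_mono mult_left_mono kp) auto
  finally show ?thesis unfolding gm .
qed

text \<open>Integrated over x, the mollified estimate no longer depends on the radius, since by
  Fubini each mollifier contributes its integral 1. Fatou then passes to h along a sequence of radii
  at which the mollifications converge almost everywhere.\<close>

theorem weak_gradient_difference_le: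
  fixes h :: "'a::euclidean_space \<Rightarrow> real" and G :: "'a \<Rightarrow> 'a"
  assumes \<Omega>: "open \<Omega>" and h: "integrable lborel h" and G: "integrable lborel G"
    and wg: "\<And>\<phi> b. test_function \<Omega> \<phi> \<Longrightarrow> b \<in> Basis \<Longrightarrow>
      (\<integral>y. h y * frechet_derivative \<phi> (at y) b \<partial>lborel) = - (\<integral>y. (G y \<bullet> b) * \<phi> y \<partial>lborel)"
    and p: "p \<ge> 1" and z: "z \<noteq> 0"
  shows "(\<integral>\<^sup>+x. indicator {x\<in>\<Omega>. 2 * norm z < bdist \<Omega> x} x * ennreal (\<bar>h (x + z) - h x\<bar> powr p) \<partial>lborel)
    \<le> ennreal (norm z powr p) * (\<integral>\<^sup>+y. ennreal (norm (G y) powr p) \<partial>lborel)"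
proof -
  have [measurable]: "h \<in> borel_measurable borel" "G \<in> borel_measurable borel" using h G by auto
  have [measurable]: "\<Omega> \<in> sets borel" using \<Omega> by simp
  \<comment> \<open>The segment uses up one |z| and the mollifier radius, at most |z|, a second one.
    The condition 2 |z| < \<open>bdist\<close> coincides with the region of integration in the
    fractional seminorm.\<close>
  define E where "E = {x\<in>\<Omega>. 2 * norm z < bdist \<Omega> x}"
  have [measurable]: "E \<in> sets borel" unfolding E_def by measurable
  define r where "r m = norm z / real (Suc m)" for m
  have r: "r m > 0" "r m \<le> norm z" for m using z by (auto simp: r_def field_simps)
  have "r \<longlonglongrightarrow> 0" unfolding r_def using LIMSEQ_Suc[OF lim_const_over_n[of "norm z"]] by simp
  then obtain \<rho> where \<rho>: "AE y in lborel. (\<lambda>m. local_osc h (r (\<rho> m)) y) \<longlonglongrightarrow> 0"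
    using local_osc_tendsto_AE[OF h, of r] r(1) by auto
  define H where "H m x = (\<integral>y. mollifier (r (\<rho> m)) x y * h y \<partial>lborel)" for m x
  have Hm [measurable]: "H m \<in> borel_measurable borel" for m
  proof -
    have "(\<lambda>x. \<integral>y. mollifier (r (\<rho> m)) x y * h y \<partial>lborel) \<in> borel_measurable borel"
      by (rule lborel.borel_measurable_lebesgue_integral) measurable
    then show ?thesis unfolding H_def[abs_def] .
  qed
  define I where "I = ennreal (norm z powr p) * (\<integral>\<^sup>+y. ennreal (norm (G y) powr p) \<partial>lborel)"
  have bound: "(\<integral>\<^sup>+x. indicator E x * ennreal (\<bar>H m (x + z) - H m x\<bar> powr p) \<partial>lborel) \<le> I" for m
  proof -
    let ?r = "r (\<rho> m)"
    let ?Q = "\<lambda>y. ennreal (norm z powr p * norm (G y) powr p)"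
    have "(\<integral>\<^sup>+x. indicator E x * ennreal (\<bar>H m (x + z) - H m x\<bar> powr p) \<partial>lborel)
      \<le> (\<integral>\<^sup>+x. \<integral>\<^sup>+t. indicator {0..1} t * (\<integral>\<^sup>+y. ennreal (mollifier ?r (x + t *\<^sub>R z) y) * ?Q y \<partial>lborel) \<partial>lborel \<partial>lborel)"
    proof (rule nn_integral_mono)
      fix x
      show "indicator E x * ennreal (\<bar>H m (x + z) - H m x\<bar> powr p)
        \<le> (\<integral>\<^sup>+t. indicator {0..1} t * (\<integral>\<^sup>+y. ennreal (mollifier ?r (x + t *\<^sub>R z) y) * ?Q y \<partial>lborel) \<partial>lborel)"
      proof (cases "x \<in> E")
        case True
        have "cball (x + t *\<^sub>R z) ?r \<subseteq> \<Omega>" if t: "t \<in> {0..1}" for t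
        proof
          fix w assume "w \<in> cball (x + t *\<^sub>R z) ?r"
          then have "norm (x + t *\<^sub>R z - w) \<le> norm z" using r(2)[of "\<rho> m"] by (simp add: dist_norm)
          moreover have "norm (t *\<^sub>R z) \<le> norm z" using t by (auto intro: mult_left_le_one_le)
          moreover have "norm (x - w) \<le> norm (x + t *\<^sub>R z - w) + norm (t *\<^sub>R z)"
            using norm_triangle_ineq4[of "x + t *\<^sub>R z - w" "t *\<^sub>R z"] by (simp add: algebra_simps)
          ultimately have "w \<in> ball x (bdist \<Omega> x)" using True by (simp add: E_def dist_norm)
          then show "w \<in> \<Omega>" using ball_bdist_subset[OF \<Omega>, of x] True by (auto simp: E_def)
        qed
        from mollified_difference_powr_le[OF h G wg p r(1) this] True show ?thesis unfolding H_def by simp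
      qed simp
    qed
    also have "\<dots> = (\<integral>\<^sup>+t. \<integral>\<^sup>+x. indicator {0..1} t * (\<integral>\<^sup>+y. ennreal (mollifier ?r (x + t *\<^sub>R z) y) * ?Q y \<partial>lborel) \<partial>lborel \<partial>lborel)"
      by (rule lborel_pair.Fubini') measurable
    also have "\<dots> = (\<integral>\<^sup>+t. indicator {0..1::real} t * I \<partial>lborel)"
    proof (rule nn_integral_cong)
      fix t :: real
      have "(\<integral>\<^sup>+x. indicator {0..1} t * (\<integral>\<^sup>+y. ennreal (mollifier ?r (x + t *\<^sub>R z) y) * ?Q y \<partial>lborel) \<partial>lborel)
        = indicator {0..1} t * (\<integral>\<^sup>+x. \<integral>\<^sup>+y. ennreal (mollifier ?r (x + t *\<^sub>R z) y) * ?Q y \<partial>lborel \<partial>lborel)"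
        by (rule nn_integral_cmult) measurable
      also have "(\<integral>\<^sup>+x. \<integral>\<^sup>+y. ennreal (mollifier ?r (x + t *\<^sub>R z) y) * ?Q y \<partial>lborel \<partial>lborel)
        = (\<integral>\<^sup>+y. \<integral>\<^sup>+x. ennreal (mollifier ?r (x + t *\<^sub>R z) y) * ?Q y \<partial>lborel \<partial>lborel)"
        by (rule lborel_pair.Fubini') measurable
      also have "\<dots> = (\<integral>\<^sup>+y. ?Q y \<partial>lborel)"
      proof (rule nn_integral_cong)
        fix y
        have "(\<integral>\<^sup>+x. ennreal (mollifier ?r (x + t *\<^sub>R z) y) * ?Q y \<partial>lborel) = (\<integral>\<^sup>+x. ennreal (mollifier ?r (x + t *\<^sub>R z) y) \<partial>lborel) * ?Q y"
          by (rule nn_integral_multc) measurable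
        also have "(\<integral>\<^sup>+x. ennreal (mollifier ?r (x + t *\<^sub>R z) y) \<partial>lborel) = (\<integral>\<^sup>+x. ennreal (mollifier ?r y (x + t *\<^sub>R z)) \<partial>lborel)"
          by (simp add: mollifier_commute[of _ _ y])
        also have "\<dots> = (\<integral>\<^sup>+x. ennreal (mollifier ?r y x) \<partial>lborel)"
          by (rule nn_integral_lborel_shift) measurable
        also have "\<dots> = 1" by (rule nn_integral_mollifier[OF r(1)])
        finally show "(\<integral>\<^sup>+x. ennreal (mollifier ?r (x + t *\<^sub>R z) y) * ?Q y \<partial>lborel) = ?Q y" by simp
      qed
      also have "\<dots> = I"
        unfolding I_def by (simp add: ennreal_mult nn_integral_cmult)
      finally show "(\<integral>\<^sup>+x. indicator {0..1} t * (\<integral>\<^sup>+y. ennreal (mollifier ?r (x + t *\<^sub>R z) y) * ?Q y \<partial>lborel) \<partial>lborel) = indicator {0..1} t * I" .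
    qed
    also have "\<dots> = I" by (subst nn_integral_multc) auto
    finally show ?thesis .
  qed
  have lim: "AE x in lborel. (\<lambda>m. H m x) \<longlonglongrightarrow> h x"
    using \<rho> by eventually_elim (unfold H_def, rule mollifier_tendsto[OF h r(1)])
  have lim': "AE x in lborel. (\<lambda>m. H m (x + z)) \<longlonglongrightarrow> h (x + z)"
  proof -
    have "AE x in distr lborel borel ((+) z). (\<lambda>m. H m x) \<longlonglongrightarrow> h x"
      by (subst lborel_distr_plus) (rule lim)
    then have "AE x in lborel. (\<lambda>m. H m (z + x)) \<longlonglongrightarrow> h (z + x)"
      by (rule AE_distrD[rotated]) simp
    then show ?thesis by (simp add: add.commute)
  qed
  have "(\<integral>\<^sup>+x. indicator E x * ennreal (\<bar>h (x + z) - h x\<bar> powr p) \<partial>lborel)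
     = (\<integral>\<^sup>+x. liminf (\<lambda>m. indicator E x * ennreal (\<bar>H m (x + z) - H m x\<bar> powr p)) \<partial>lborel)"
  proof (rule nn_integral_cong_AE)
    show "AE x in lborel. indicator E x * ennreal (\<bar>h (x + z) - h x\<bar> powr p)
       = liminf (\<lambda>m. indicator E x * ennreal (\<bar>H m (x + z) - H m x\<bar> powr p))"
      using lim lim'
    proof eventually_elim
      case (elim x)
      have "(\<lambda>m. \<bar>H m (x + z) - H m x\<bar> powr p) \<longlonglongrightarrow> \<bar>h (x + z) - h x\<bar> powr p"
        using p by (intro tendsto_powr2 tendsto_intros elim) auto
      then have "(\<lambda>m. indicator E x * ennreal (\<bar>H m (x + z) - H m x\<bar> powr p)) \<longlonglongrightarrow> indicator E x * ennreal (\<bar>h (x + z) - h x\<bar> powr p)"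
        by (intro ennreal_tendsto_cmult tendsto_ennrealI) (auto simp: indicator_def)
      then show ?case by (intro lim_imp_Liminf[symmetric]) auto
    qed
  qed
  also have "\<dots> \<le> liminf (\<lambda>m. \<integral>\<^sup>+x. indicator E x * ennreal (\<bar>H m (x + z) - H m x\<bar> powr p) \<partial>lborel)"
    by (rule nn_integral_liminf) measurable
  also have "\<dots> \<le> I"
    using bound by (intro Liminf_le) (auto intro: always_eventually)
  finally show ?thesis unfolding E_def I_def .
qed

subsection \<open>Lebesgue norms through Borel extensions\<close>

lemma Lp_norm_nonneg: "Lp_norm \<Omega> p u \<ge> 0"
  by (simp add: Lp_norm_def)

lemma Lp_norm_powr:
  fixes u :: "'a::euclidean_space \<Rightarrow> 'b::euclidean_space"
  assumes \<Omega>: "\<Omega> \<in> sets borel" and u: "u \<in> Lp_space \<Omega> p" and p: "p \<ge> 1"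
  shows "ennreal (Lp_norm \<Omega> p u powr p) = (\<integral>\<^sup>+x. indicator \<Omega> x * ennreal (norm (u x) powr p) \<partial>lborel)"
proof -
  have i: "integrable (lebesgue_on \<Omega>) (\<lambda>x. norm (u x) powr p)" using u by (simp add: Lp_space_def)
  have "(\<integral>x. norm (u x) powr p \<partial>lebesgue_on \<Omega>) \<ge> 0" by (rule Bochner_Integration.integral_nonneg) simp
  then have "Lp_norm \<Omega> p u powr p = (\<integral>x. norm (u x) powr p \<partial>lebesgue_on \<Omega>)"
    using p by (simp add: Lp_norm_def powr_powr)
  then have "ennreal (Lp_norm \<Omega> p u powr p) = (\<integral>\<^sup>+x. ennreal (norm (u x) powr p) \<partial>lebesgue_on \<Omega>)"
    using nn_integral_eq_integral[OF i] by simp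
  then show ?thesis by (simp add: nn_integral_lebesgue_on[OF \<Omega>])
qed

lemma Lp_spaceI:
  fixes u :: "'a::euclidean_space \<Rightarrow> 'b::euclidean_space"
  assumes \<Omega>: "\<Omega> \<in> sets borel" and u: "u \<in> borel_measurable (lebesgue_on \<Omega>)"
    and fin: "(\<integral>\<^sup>+x. indicator \<Omega> x * ennreal (norm (u x) powr p) \<partial>lborel) < \<infinity>"
  shows "u \<in> Lp_space \<Omega> p"
  unfolding Lp_space_def
proof (intro CollectI conjI u)
  show "integrable (lebesgue_on \<Omega>) (\<lambda>x. norm (u x) powr p)"
    using u fin by (intro integrableI_nonneg) (auto simp: nn_integral_lebesgue_on[OF \<Omega>])
qed

text \<open>A bounded \<Omega> has finite measure, so t <= 1 + t^p turns p-integrability into the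
  integrability on which the results on Lebesgue points and mollifiers rest.\<close>

lemma Lp_borel_extension:
  fixes u :: "'a::euclidean_space \<Rightarrow> 'b::euclidean_space"
  assumes \<Omega>: "\<Omega> \<in> sets borel" "bounded \<Omega>" and u: "u \<in> Lp_space \<Omega> p" and p: "p \<ge> 1"
  obtains u0 where "integrable lborel u0" "AE x in lebesgue_on \<Omega>. u x = u0 x" "\<And>x. x \<notin> \<Omega> \<Longrightarrow> u0 x = 0"
    "(\<integral>\<^sup>+x. ennreal (norm (u0 x) powr p) \<partial>lborel) = ennreal (Lp_norm \<Omega> p u powr p)"
proof -
  have um: "u \<in> borel_measurable (lebesgue_on \<Omega>)" using u by (simp add: Lp_space_def)
  obtain u0 where u0: "u0 \<in> borel_measurable borel" "AE x in lebesgue_on \<Omega>. u x = u0 x" "\<And>x. x \<notin> \<Omega> \<Longrightarrow> u0 x = 0"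
    using borel_extension[OF \<Omega>(1) um] by metis
  note [measurable] = u0(1) \<Omega>(1)
  have I: "(\<integral>\<^sup>+x. ennreal (norm (u0 x) powr p) \<partial>lborel) = ennreal (Lp_norm \<Omega> p u powr p)"
    unfolding Lp_norm_powr[OF \<Omega>(1) u p]
  proof (rule nn_integral_cong_AE)
    show "AE x in lborel. ennreal (norm (u0 x) powr p) = indicator \<Omega> x * ennreal (norm (u x) powr p)"
      using u0(2) unfolding AE_lebesgue_on_iff[OF \<Omega>(1)]
      by eventually_elim (use u0(3) p in \<open>auto simp: indicator_def\<close>)
  qed
  have "integrable lborel u0"
  proof (rule integrableI_bounded)
    have "(\<integral>\<^sup>+x. ennreal (norm (u0 x)) \<partial>lborel) \<le> (\<integral>\<^sup>+x. indicator \<Omega> x + ennreal (norm (u0 x) powr p) \<partial>lborel)"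
    proof (rule nn_integral_mono)
      fix x
      show "ennreal (norm (u0 x)) \<le> indicator \<Omega> x + ennreal (norm (u0 x) powr p)"
      proof (cases "x \<in> \<Omega>")
        case True
        have "norm (u0 x) \<le> 1 + norm (u0 x) powr p"
        proof (cases "norm (u0 x) \<le> 1")
          case False
          then have "norm (u0 x) powr 1 \<le> norm (u0 x) powr p" using p by (intro powr_mono) auto
          then show ?thesis using False by simp
        qed (simp add: add_increasing2)
        then have "ennreal (norm (u0 x)) \<le> ennreal (1 + norm (u0 x) powr p)" by (rule ennreal_leI)
        then show ?thesis using True by simp
      qed (simp add: u0(3))
    qed
    also have "\<dots> = emeasure lborel \<Omega> + (\<integral>\<^sup>+x. ennreal (norm (u0 x) powr p) \<partial>lborel)"
      by (subst nn_integral_add) auto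
    also have "\<dots> < \<infinity>" unfolding I using emeasure_bounded_finite[OF \<Omega>(2)] by auto
    finally show "(\<integral>\<^sup>+x. ennreal (norm (u0 x)) \<partial>lborel) < \<infinity>" .
  qed (use u0(1) in simp)
  with u0(2,3) I show thesis by (intro that)
qed

lemma weak_gradient_Lp:
  fixes f :: "'a::euclidean_space \<Rightarrow> real"
  assumes \<Omega>: "open \<Omega>" and G: "is_weak_gradient \<Omega> f G" "G \<in> Lp_space \<Omega> p"
  shows "is_weak_gradient \<Omega> f (weak_gradient \<Omega> f)" "Lp_norm \<Omega> p (weak_gradient \<Omega> f) = Lp_norm \<Omega> p G"
proof -
  have Ob: "\<Omega> \<in> sets borel" using \<Omega> by simp
  show w: "is_weak_gradient \<Omega> f (weak_gradient \<Omega> f)"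
    unfolding weak_gradient_def by (rule someI[of "is_weak_gradient \<Omega> f", OF G(1)])
  have eq: "AE x in lebesgue_on \<Omega>. weak_gradient \<Omega> f x = G x"
    by (rule weak_gradient_unique[OF \<Omega> w G(1)])
  have Gm: "G \<in> borel_measurable (lebesgue_on \<Omega>)" using G(2) by (simp add: Lp_space_def)
  have wm: "weak_gradient \<Omega> f \<in> borel_measurable (lebesgue_on \<Omega>)"
    by (rule borel_measurable_lebesgue_on_AE[OF Ob Gm eq])
  have "(\<integral>x. norm (weak_gradient \<Omega> f x) powr p \<partial>lebesgue_on \<Omega>) = (\<integral>x. norm (G x) powr p \<partial>lebesgue_on \<Omega>)"
    using Gm wm eq by (intro integral_cong_AE) (auto elim!: eventually_mono)
  then show "Lp_norm \<Omega> p (weak_gradient \<Omega> f) = Lp_norm \<Omega> p G" by (simp add: Lp_norm_def)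
qed

lemma ennreal_root_finite_iff: "ennreal_root p I < \<infinity> \<longleftrightarrow> I < \<infinity>"
  by (auto simp: ennreal_root_def less_top)

text \<open>For x in \<Omega> the inner ball stays inside \<Omega>, so f may be replaced by f0 in
  both variables.\<close>

lemma frac_seminorm_finite_iff:
  fixes f f0 :: "'a::euclidean_space \<Rightarrow> real"
  assumes \<Omega>: "open \<Omega>" and eq: "AE x in lebesgue_on \<Omega>. f x = f0 x"
  shows "frac_seminorm \<Omega> s p f < \<infinity> \<longleftrightarrow>
    (\<integral>\<^sup>+x. indicator \<Omega> x * frac_density (\<lambda>x. bdist \<Omega> x / 2) (real DIM('a) + s * p) p f0 x \<partial>lborel) < \<infinity>"
proof -
  have Ob: "\<Omega> \<in> sets borel" using \<Omega> by simp
  have eq': "AE x in lborel. x \<in> \<Omega> \<longrightarrow> f x = f0 x" using eq unfolding AE_lebesgue_on_iff[OF Ob] .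
  have "(\<integral>\<^sup>+x\<in>\<Omega>. (\<integral>\<^sup>+y\<in>{y. norm (x - y) < bdist \<Omega> x / 2}.
               ennreal (\<bar>f x - f y\<bar> powr p / norm (x - y) powr (real DIM('a) + s * p))
             \<partial>lebesgue) \<partial>lebesgue)
     = (\<integral>\<^sup>+x. indicator \<Omega> x * frac_density (\<lambda>x. bdist \<Omega> x / 2) (real DIM('a) + s * p) p f0 x \<partial>lborel)"
    unfolding nn_integral_completion
  proof (rule nn_integral_cong_AE, use eq' in eventually_elim)
    case (elim x)
    show ?case
    proof (cases "x \<in> \<Omega>")
      case True
      have "(\<integral>\<^sup>+y\<in>{y. norm (x - y) < bdist \<Omega> x / 2}.
               ennreal (\<bar>f x - f y\<bar> powr p / norm (x - y) powr (real DIM('a) + s * p)) \<partial>lborel)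
        = frac_density (\<lambda>x. bdist \<Omega> x / 2) (real DIM('a) + s * p) p f0 x"
        unfolding frac_density_def
      proof (rule nn_integral_cong_AE, use eq' in eventually_elim)
        case (elim y)
        show ?case
        proof (cases "norm (x - y) < bdist \<Omega> x / 2")
          case near: True
          then have "y \<in> ball x (bdist \<Omega> x)" using bdist_nonneg[of \<Omega> x] by (simp add: dist_norm)
          then have "y \<in> \<Omega>" using ball_bdist_subset[OF \<Omega> True] by blast
          then show ?thesis using elim \<open>x \<in> \<Omega> \<longrightarrow> f x = f0 x\<close> True by (simp add: indicator_def)
        qed simp
      qed
      then show ?thesis using True by simp
    qed simp
  qed
  then show ?thesis unfolding frac_seminorm_def ennreal_root_finite_iff by simp
qed

subsection \<open>The K-functional\<close>

lemma W1p_norm_nonneg: "W1p_norm \<Omega> p h \<ge> 0"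
  by (simp add: W1p_norm_def Lp_norm_nonneg)

lemma K_functional_le:
  assumes "l \<ge> 0" "g \<in> Lp_space \<Omega> p" "h \<in> W1p_space \<Omega> p" "AE x in lebesgue_on \<Omega>. f x = g x + h x"
  shows "K_functional \<Omega> p l f \<le> Lp_norm \<Omega> p g + l * W1p_norm \<Omega> p h"
  unfolding K_functional_def
proof (rule cInf_lower)
  show "bdd_below {Lp_norm \<Omega> p g + l * W1p_norm \<Omega> p h | g h.
      g \<in> Lp_space \<Omega> p \<and> h \<in> W1p_space \<Omega> p \<and> (AE x in lebesgue_on \<Omega>. f x = g x + h x)}"
    using assms(1) by (intro bdd_belowI[of _ 0]) (auto simp: Lp_norm_nonneg W1p_norm_nonneg)
qed (use assms in blast)

text \<open>Membership in \<open>sum_space\<close> makes the set of values nonempty;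
  \<open>Inf\<close> of an empty set of reals would carry no information.\<close>

lemma K_functional_ge:
  assumes "f \<in> sum_space \<Omega> p"
    and "\<And>g h. g \<in> Lp_space \<Omega> p \<Longrightarrow> h \<in> W1p_space \<Omega> p \<Longrightarrow> AE x in lebesgue_on \<Omega>. f x = g x + h x \<Longrightarrow>
      m \<le> Lp_norm \<Omega> p g + l * W1p_norm \<Omega> p h"
  shows "m \<le> K_functional \<Omega> p l f"
  unfolding K_functional_def
  by (rule cInf_greatest) (use assms in \<open>auto simp: sum_space_def\<close>)

lemma K_functional_nonneg: "f \<in> sum_space \<Omega> p \<Longrightarrow> l \<ge> 0 \<Longrightarrow> K_functional \<Omega> p l f \<ge> 0"
  by (rule K_functional_ge) (auto simp: Lp_norm_nonneg W1p_norm_nonneg)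

lemma K_functional_mono:
  assumes "f \<in> sum_space \<Omega> p" "0 \<le> l" "l \<le> l'"
  shows "K_functional \<Omega> p l f \<le> K_functional \<Omega> p l' f"
proof (rule K_functional_ge[OF assms(1)])
  fix g h assume gh: "g \<in> Lp_space \<Omega> p" "h \<in> W1p_space \<Omega> p" "AE x in lebesgue_on \<Omega>. f x = g x + h x"
  have "K_functional \<Omega> p l f \<le> Lp_norm \<Omega> p g + l * W1p_norm \<Omega> p h" by (rule K_functional_le[OF assms(2) gh])
  also have "\<dots> \<le> Lp_norm \<Omega> p g + l' * W1p_norm \<Omega> p h"
    using assms(3) by (intro add_left_mono mult_right_mono W1p_norm_nonneg)
  finally show "K_functional \<Omega> p l f \<le> Lp_norm \<Omega> p g + l' * W1p_norm \<Omega> p h" .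
qed

subsection \<open>From the interpolation space to the fractional space\<close>

lemma sum_space_subset_Lp:
  fixes \<Omega> :: "'a::euclidean_space set"
  assumes \<Omega>: "\<Omega> \<in> sets borel" and p: "p \<ge> 1" and f: "f \<in> sum_space \<Omega> p"
  shows "f \<in> Lp_space \<Omega> p"
proof -
  obtain g h where g: "g \<in> Lp_space \<Omega> p" and h: "h \<in> Lp_space \<Omega> p" and eq: "AE x in lebesgue_on \<Omega>. f x = g x + h x"
    using f by (auto simp: sum_space_def W1p_space_def)
  have gm: "g \<in> borel_measurable (lebesgue_on \<Omega>)" "h \<in> borel_measurable (lebesgue_on \<Omega>)"
    using g h by (auto simp: Lp_space_def)
  have fm: "f \<in> borel_measurable (lebesgue_on \<Omega>)"
    by (rule borel_measurable_lebesgue_on_AE[OF \<Omega> _ eq]) (use gm in simp)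
  have "integrable (lebesgue_on \<Omega>) (\<lambda>x. norm (f x) powr p)"
  proof (rule Bochner_Integration.integrable_bound)
    show "integrable (lebesgue_on \<Omega>) (\<lambda>x. 2 powr (p - 1) * (norm (g x) powr p + norm (h x) powr p))"
      using g h by (auto simp: Lp_space_def)
    show "AE x in lebesgue_on \<Omega>. norm (norm (f x) powr p) \<le> norm (2 powr (p - 1) * (norm (g x) powr p + norm (h x) powr p))"
      using eq
    proof eventually_elim
      case (elim x)
      have "norm (f x) powr p \<le> (\<bar>g x\<bar> + \<bar>h x\<bar>) powr p" using p elim by (intro powr_mono2) auto
      also have "\<dots> \<le> 2 powr (p - 1) * (\<bar>g x\<bar> powr p + \<bar>h x\<bar> powr p)" by (rule add_powr_le) (use p in auto)
      finally show ?case by simp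
    qed
  qed (use fm in simp)
  with fm show ?thesis by (simp add: Lp_space_def)
qed

lemma Lp_subset_sum_space:
  assumes \<Omega>: "\<Omega> \<in> sets borel" and p: "p \<ge> 1" and f: "f \<in> Lp_space \<Omega> p"
  shows "(\<lambda>x. 0) \<in> W1p_space \<Omega> p" "f \<in> sum_space \<Omega> p"
proof -
  have "(\<lambda>x. 0 :: real) \<in> Lp_space \<Omega> p" "(\<lambda>x. 0 :: 'a) \<in> Lp_space \<Omega> p" using p by (auto simp: Lp_space_def)
  then show z: "(\<lambda>x. 0) \<in> W1p_space \<Omega> p"
    using is_weak_gradient_const[OF \<Omega>, of 0] by (auto simp: W1p_space_def)
  show "f \<in> sum_space \<Omega> p"
    unfolding sum_space_def by (intro CollectI bexI[OF _ f] bexI[OF _ z]) simp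
qed

text \<open>Three terms are raised to the power p, namely g at x + z, g at x and the difference of
  h, which gives 3^(p-1). Their bounds a^p, a^p and b^p are each at most (a + b)^p.\<close>

lemma shift_difference_le_decomposition:
  fixes f0 :: "'a::euclidean_space \<Rightarrow> real"
  assumes \<Omega>: "open \<Omega>" "bounded \<Omega>" and p: "p \<ge> 1" and z: "z \<noteq> 0"
    and g: "g \<in> Lp_space \<Omega> p" and h: "h \<in> W1p_space \<Omega> p"
    and f0: "f0 \<in> borel_measurable borel" "AE x in lebesgue_on \<Omega>. f0 x = g x + h x"
  shows "(\<integral>\<^sup>+x. indicator {x\<in>\<Omega>. 2 * norm z < bdist \<Omega> x} x * ennreal (\<bar>f0 (x + z) - f0 x\<bar> powr p) \<partial>lborel)
    \<le> ennreal (4 * 3 powr (p - 1) * (Lp_norm \<Omega> p g + norm z * W1p_norm \<Omega> p h) powr p)"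
proof -
  have Ob [measurable]: "\<Omega> \<in> sets borel" using \<Omega>(1) by simp
  define E where "E = {x\<in>\<Omega>. 2 * norm z < bdist \<Omega> x}"
  have [measurable]: "E \<in> sets borel" unfolding E_def by measurable
  have Ez: "x + z \<in> \<Omega>" if "x \<in> E" for x
  proof -
    have "x + z \<in> ball x (bdist \<Omega> x)" using that by (auto simp: E_def dist_norm intro: le_less_trans[rotated])
    then show ?thesis using ball_bdist_subset[OF \<Omega>(1), of x] that by (auto simp: E_def)
  qed
  obtain G where hL: "h \<in> Lp_space \<Omega> p" and G: "G \<in> Lp_space \<Omega> p" "is_weak_gradient \<Omega> h G"
    using h by (auto simp: W1p_space_def)
  obtain g0 where g0: "integrable lborel g0" "AE x in lebesgue_on \<Omega>. g x = g0 x" "\<And>x. x \<notin> \<Omega> \<Longrightarrow> g0 x = 0"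
    "(\<integral>\<^sup>+x. ennreal (norm (g0 x) powr p) \<partial>lborel) = ennreal (Lp_norm \<Omega> p g powr p)"
    by (rule Lp_borel_extension[OF Ob \<Omega>(2) g p]) (rule that, simp_all)
  obtain h0 where h0: "integrable lborel h0" "AE x in lebesgue_on \<Omega>. h x = h0 x" "\<And>x. x \<notin> \<Omega> \<Longrightarrow> h0 x = 0"
    using Lp_borel_extension[OF Ob \<Omega>(2) hL p] by metis
  obtain G0 where G0: "integrable lborel G0" "AE x in lebesgue_on \<Omega>. G x = G0 x" "\<And>x. x \<notin> \<Omega> \<Longrightarrow> G0 x = 0"
    "(\<integral>\<^sup>+x. ennreal (norm (G0 x) powr p) \<partial>lborel) = ennreal (Lp_norm \<Omega> p G powr p)"
    by (rule Lp_borel_extension[OF Ob \<Omega>(2) G(1) p]) (rule that, simp_all)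
  have [measurable]: "f0 \<in> borel_measurable borel" "g0 \<in> borel_measurable borel" "h0 \<in> borel_measurable borel" "G0 \<in> borel_measurable borel"
    using f0(1) g0(1) h0(1) G0(1) by auto
  have wg: "(\<integral>y. h0 y * frechet_derivative \<phi> (at y) b \<partial>lborel) = - (\<integral>y. (G0 y \<bullet> b) * \<phi> y \<partial>lborel)"
    if \<phi>: "test_function \<Omega> \<phi>" and b: "b \<in> Basis" for \<phi> b
  proof -
    have [measurable]: "\<phi> \<in> borel_measurable borel" "(\<lambda>y. frechet_derivative \<phi> (at y) b) \<in> borel_measurable borel"
      using test_function_continuous[OF \<phi>] by (auto intro: borel_measurable_continuous_onI)
    have "(\<integral>y. h y * frechet_derivative \<phi> (at y) b \<partial>lebesgue_on \<Omega>) = (\<integral>y. h0 y * frechet_derivative \<phi> (at y) b \<partial>lborel)"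
      by (rule lebesgue_on_borel_integrable_iff(2)[OF Ob]) (use h0 in \<open>auto elim!: eventually_mono\<close>)
    moreover have "(\<integral>y. (G y \<bullet> b) * \<phi> y \<partial>lebesgue_on \<Omega>) = (\<integral>y. (G0 y \<bullet> b) * \<phi> y \<partial>lborel)"
      by (rule lebesgue_on_borel_integrable_iff(2)[OF Ob]) (use G0 in \<open>auto elim!: eventually_mono\<close>)
    ultimately show ?thesis using G(2) \<phi> b by (simp add: is_weak_gradient_def)
  qed
  have fgh: "AE x in lborel. x \<in> \<Omega> \<longrightarrow> f0 x = g0 x + h0 x"
    using f0(2) g0(2) h0(2) unfolding AE_lebesgue_on_iff[OF Ob] by eventually_elim auto
  \<comment> \<open>The decomposition holds almost everywhere; translation invariance of
    \<open>lborel\<close> carries it to the shifted point.\<close>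
  have fgh': "AE x in lborel. x + z \<in> \<Omega> \<longrightarrow> f0 (x + z) = g0 (x + z) + h0 (x + z)"
  proof -
    have "AE x in distr lborel borel ((+) z). x \<in> \<Omega> \<longrightarrow> f0 x = g0 x + h0 x"
      by (subst lborel_distr_plus) (rule fgh)
    then have "AE x in lborel. z + x \<in> \<Omega> \<longrightarrow> f0 (z + x) = g0 (z + x) + h0 (z + x)"
      by (rule AE_distrD[rotated]) simp
    then show ?thesis by (simp add: add.commute)
  qed
  define a where "a = Lp_norm \<Omega> p g"
  define b where "b = norm z * W1p_norm \<Omega> p h"
  have ab: "a \<ge> 0" "b \<ge> 0" by (auto simp: a_def b_def Lp_norm_nonneg W1p_norm_nonneg)
  have G0b: "ennreal (norm z powr p) * (\<integral>\<^sup>+y. ennreal (norm (G0 y) powr p) \<partial>lborel) \<le> ennreal (b powr p)"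
  proof -
    have "Lp_norm \<Omega> p G \<le> W1p_norm \<Omega> p h"
      using weak_gradient_Lp(2)[OF \<Omega>(1) G(2,1)] by (simp add: W1p_norm_def Lp_norm_nonneg)
    then have "norm z * Lp_norm \<Omega> p G \<le> b" unfolding b_def by (intro mult_left_mono) auto
    then have "(norm z * Lp_norm \<Omega> p G) powr p \<le> b powr p" using p by (intro powr_mono2) (auto simp: Lp_norm_nonneg)
    then have "norm z powr p * Lp_norm \<Omega> p G powr p \<le> b powr p" by (simp add: powr_mult Lp_norm_nonneg)
    then show ?thesis unfolding G0(4) by (simp add: ennreal_leI flip: ennreal_mult)
  qed
  let ?c = "ennreal (3 powr (p - 1))"
  have "(\<integral>\<^sup>+x. indicator E x * ennreal (\<bar>f0 (x + z) - f0 x\<bar> powr p) \<partial>lborel)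
    \<le> (\<integral>\<^sup>+x. ?c * ((ennreal (norm (g0 (x + z)) powr p) + ennreal (norm (g0 x) powr p)) +
          indicator E x * ennreal (\<bar>h0 (x + z) - h0 x\<bar> powr p)) \<partial>lborel)"
  proof (rule nn_integral_mono_AE, use fgh fgh' in eventually_elim)
    case (elim x)
    show ?case
    proof (cases "x \<in> E")
      case True
      then have "f0 (x + z) - f0 x = g0 (x + z) - g0 x + (h0 (x + z) - h0 x)"
        using elim Ez[OF True] by (auto simp: E_def)
      then have "\<bar>f0 (x + z) - f0 x\<bar> powr p \<le> (\<Sum>i\<in>{0,1,2::nat}. if i = 0 then \<bar>g0 (x + z)\<bar> else if i = 1 then \<bar>g0 x\<bar> else \<bar>h0 (x + z) - h0 x\<bar>) powr p"
        using p by (intro powr_mono2) auto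
      also have "\<dots> \<le> real (card {0,1,2::nat}) powr (p - 1) * (\<Sum>i\<in>{0,1,2::nat}. (if i = 0 then \<bar>g0 (x + z)\<bar> else if i = 1 then \<bar>g0 x\<bar> else \<bar>h0 (x + z) - h0 x\<bar>) powr p)"
        by (rule sum_powr_le) (use p in auto)
      also have "\<dots> = 3 powr (p - 1) * ((\<bar>g0 (x + z)\<bar> powr p + \<bar>g0 x\<bar> powr p) + \<bar>h0 (x + z) - h0 x\<bar> powr p)"
        by simp
      finally have "ennreal (\<bar>f0 (x + z) - f0 x\<bar> powr p) \<le> ennreal (3 powr (p - 1) * ((\<bar>g0 (x + z)\<bar> powr p + \<bar>g0 x\<bar> powr p) + \<bar>h0 (x + z) - h0 x\<bar> powr p))"
        by (rule ennreal_leI)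
      then show ?thesis using True by (simp add: ennreal_mult)
    qed simp
  qed
  also have "\<dots> = ?c * (((\<integral>\<^sup>+x. ennreal (norm (g0 (x + z)) powr p) \<partial>lborel) + (\<integral>\<^sup>+x. ennreal (norm (g0 x) powr p) \<partial>lborel)) +
      (\<integral>\<^sup>+x. indicator E x * ennreal (\<bar>h0 (x + z) - h0 x\<bar> powr p) \<partial>lborel))"
    by (subst nn_integral_cmult, measurable) (simp add: nn_integral_add)
  also have "(\<integral>\<^sup>+x. ennreal (norm (g0 (x + z)) powr p) \<partial>lborel) = (\<integral>\<^sup>+x. ennreal (norm (g0 x) powr p) \<partial>lborel)"
    by (rule nn_integral_lborel_shift) measurable
  also have "(\<integral>\<^sup>+x. ennreal (norm (g0 x) powr p) \<partial>lborel) = ennreal (a powr p)"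
    unfolding g0(4) a_def ..
  also have "?c * (ennreal (a powr p) + ennreal (a powr p) + (\<integral>\<^sup>+x. indicator E x * ennreal (\<bar>h0 (x + z) - h0 x\<bar> powr p) \<partial>lborel))
    \<le> ?c * (ennreal (a powr p) + ennreal (a powr p) + ennreal (b powr p))"
    using weak_gradient_difference_le[OF \<Omega>(1) h0(1) G0(1) wg p z] G0b unfolding E_def
    by (intro mult_left_mono add_left_mono) (auto intro: order_trans)
  also have "\<dots> = ennreal (3 powr (p - 1) * (a powr p + a powr p + b powr p))"
    by (simp only: ennreal_mult' ennreal_plus powr_ge_zero add_nonneg_nonneg)
  also have "\<dots> \<le> ennreal (4 * 3 powr (p - 1) * (a + b) powr p)"
  proof (rule ennreal_leI)
    have "a powr p \<le> (a + b) powr p" "b powr p \<le> (a + b) powr p" using ab p by (auto intro!: powr_mono2)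
    then have "a powr p + a powr p + b powr p \<le> 4 * (a + b) powr p" using powr_ge_zero[of "a + b" p] by linarith
    then have "3 powr (p - 1) * (a powr p + a powr p + b powr p) \<le> 3 powr (p - 1) * (4 * (a + b) powr p)"
      by (rule mult_left_mono) simp
    then show "3 powr (p - 1) * (a powr p + a powr p + b powr p) \<le> 4 * 3 powr (p - 1) * (a + b) powr p" by simp
  qed
  finally show ?thesis unfolding E_def a_def b_def .
qed

text \<open>The infimum in K need not be attained. So the bound for a single decomposition is solved
  for its norm: (w / c)^(1/p) is a lower bound for all competitors, hence for K. One decomposition
  shows that w is finite.\<close>

lemma shift_difference_le_K:
  fixes f0 :: "'a::euclidean_space \<Rightarrow> real"
  assumes \<Omega>: "open \<Omega>" "bounded \<Omega>" and p: "p \<ge> 1" and z: "z \<noteq> 0" and f: "f \<in> sum_space \<Omega> p"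
    and f0: "f0 \<in> borel_measurable borel" "AE x in lebesgue_on \<Omega>. f x = f0 x"
  shows "(\<integral>\<^sup>+x. indicator {x\<in>\<Omega>. 2 * norm z < bdist \<Omega> x} x * ennreal (\<bar>f0 (x + z) - f0 x\<bar> powr p) \<partial>lborel)
    \<le> ennreal (4 * 3 powr (p - 1) * (K_functional \<Omega> p (norm z) f) powr p)"
    (is "?W \<le> ennreal (?c * _)")
proof -
  have c: "?c > 0" by simp
  have le: "?W \<le> ennreal (?c * (Lp_norm \<Omega> p g + norm z * W1p_norm \<Omega> p h) powr p)"
    if g: "g \<in> Lp_space \<Omega> p" and h: "h \<in> W1p_space \<Omega> p" and eq: "AE x in lebesgue_on \<Omega>. f x = g x + h x" for g h
    by (rule shift_difference_le_decomposition[OF \<Omega> p z g h f0(1)]) (use eq f0(2) in eventually_elim, simp)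
  obtain g h where gh: "g \<in> Lp_space \<Omega> p" "h \<in> W1p_space \<Omega> p" "AE x in lebesgue_on \<Omega>. f x = g x + h x"
    using f by (auto simp: sum_space_def)
  have fin: "?W < \<infinity>" using le[OF gh] by (auto intro: le_less_trans)
  define w where "w = enn2real ?W"
  have W: "?W = ennreal w" "w \<ge> 0" using fin by (auto simp: w_def less_top)
  have "(w / ?c) powr (1 / p) \<le> K_functional \<Omega> p (norm z) f"
  proof (rule K_functional_ge[OF f])
    fix g h assume gh: "g \<in> Lp_space \<Omega> p" "h \<in> W1p_space \<Omega> p" "AE x in lebesgue_on \<Omega>. f x = g x + h x"
    let ?v = "Lp_norm \<Omega> p g + norm z * W1p_norm \<Omega> p h"
    have v: "?v \<ge> 0" by (simp add: Lp_norm_nonneg W1p_norm_nonneg)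
    have "w \<le> ?c * ?v powr p" using le[OF gh] W by (subst (asm) W(1)) (simp add: ennreal_le_iff)
    then have "w / ?c \<le> ?v powr p" using c by (simp add: divide_le_eq mult.commute)
    then have "(w / ?c) powr (1 / p) \<le> (?v powr p) powr (1 / p)"
      using W(2) p by (intro powr_mono2) auto
    then show "(w / ?c) powr (1 / p) \<le> ?v" using p v by (simp add: powr_powr)
  qed
  then have "((w / ?c) powr (1 / p)) powr p \<le> (K_functional \<Omega> p (norm z) f) powr p"
    using p by (intro powr_mono2) auto
  then have "w / ?c \<le> (K_functional \<Omega> p (norm z) f) powr p" using p W(2) by (simp add: powr_powr)
  then have "w \<le> ?c * (K_functional \<Omega> p (norm z) f) powr p" using c by (simp add: divide_le_eq mult.commute)
  then show ?thesis unfolding W(1) by (rule ennreal_leI)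
qed

lemma nn_integral_powr_tail:
  fixes a e :: real
  assumes "a > 0" "e > 0"
  shows "(\<integral>\<^sup>+r. ennreal (e * r powr (- e - 1)) * indicator {a..} r \<partial>lborel) = ennreal (a powr (- e))"
proof -
  have "((\<lambda>r. - (r powr (- e))) \<longlongrightarrow> - 0) at_top"
    using assms by (intro tendsto_minus tendsto_neg_powr filterlim_ident) simp
  then have lim: "((\<lambda>r. - (r powr (- e))) \<longlongrightarrow> 0) at_top" by simp
  have "(\<integral>\<^sup>+r. ennreal (e * r powr (- e - 1)) * indicator {a..} r \<partial>lborel) = ennreal (0 - (- (a powr (- e))))"
  proof (rule nn_integral_FTC_atLeast[OF _ _ _ lim])
    fix r assume "a \<le> r"
    then have r: "r > 0" using assms by simp
    show "((\<lambda>r. - (r powr (- e))) has_real_derivative e * r powr (- e - 1)) (at r)"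
      using r by (auto intro!: derivative_eq_intros simp: powr_diff)
  qed (use assms in auto)
  then show ?thesis by simp
qed

text \<open>Replacing z by x + z and exchanging the integrals puts the shift outside, so that the
  inner integral is the one bounded by K at |z|.\<close>

lemma frac_density_integral_shift:
  fixes f0 :: "'a::euclidean_space \<Rightarrow> real"
  assumes [measurable]: "f0 \<in> borel_measurable borel" "\<Omega> \<in> sets borel"
  shows "(\<integral>\<^sup>+x. indicator \<Omega> x * frac_density (\<lambda>x. bdist \<Omega> x / 2) e p f0 x \<partial>lborel)
    = (\<integral>\<^sup>+z. ennreal (1 / norm z powr e) *
        (\<integral>\<^sup>+x. indicator {x\<in>\<Omega>. 2 * norm z < bdist \<Omega> x} x * ennreal (\<bar>f0 (x + z) - f0 x\<bar> powr p) \<partial>lborel) \<partial>lborel)"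
proof -
  let ?F = "\<lambda>x z. indicator {w\<in>\<Omega> \<times> UNIV. 2 * norm (snd w) < bdist \<Omega> (fst w)} (x, z) *
      ennreal (\<bar>f0 (x + z) - f0 x\<bar> powr p / norm z powr e)"
  have [measurable]: "{w\<in>\<Omega> \<times> (UNIV::'a set). 2 * norm (snd w) < bdist \<Omega> (fst w)} \<in> sets (borel \<Otimes>\<^sub>M borel)"
  proof -
    have "{w\<in>\<Omega> \<times> (UNIV::'a set). 2 * norm (snd w) < bdist \<Omega> (fst w)}
       = {w\<in>space (borel \<Otimes>\<^sub>M borel). fst w \<in> \<Omega> \<and> 2 * norm (snd w) < bdist \<Omega> (fst w)}"
      by (auto simp: space_pair_measure)
    also have "\<dots> \<in> sets (borel \<Otimes>\<^sub>M borel)" by measurable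
    finally show ?thesis .
  qed
  have "(\<integral>\<^sup>+x. indicator \<Omega> x * frac_density (\<lambda>x. bdist \<Omega> x / 2) e p f0 x \<partial>lborel) = (\<integral>\<^sup>+x. \<integral>\<^sup>+z. ?F x z \<partial>lborel \<partial>lborel)"
  proof (rule nn_integral_cong)
    fix x
    have [measurable]: "{z. norm (x - z) < bdist \<Omega> x / 2} \<in> sets borel" by measurable
    have "frac_density (\<lambda>x. bdist \<Omega> x / 2) e p f0 x = (\<integral>\<^sup>+z. indicator {z. norm (x - z) < bdist \<Omega> x / 2} (z + x) *
      ennreal (\<bar>f0 x - f0 (z + x)\<bar> powr p / norm (x - (z + x)) powr e) \<partial>lborel)"
      unfolding frac_density_def by (rule nn_integral_lborel_shift[symmetric]) measurable
    also have "\<dots> = (\<integral>\<^sup>+z. indicator {z. 2 * norm z < bdist \<Omega> x} z * ennreal (\<bar>f0 (x + z) - f0 x\<bar> powr p / norm z powr e) \<partial>lborel)"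
      by (intro nn_integral_cong) (simp add: indicator_def add.commute[of x] abs_minus_commute[of "f0 x"])
    finally show "indicator \<Omega> x * frac_density (\<lambda>x. bdist \<Omega> x / 2) e p f0 x = (\<integral>\<^sup>+z. ?F x z \<partial>lborel)"
      by (cases "x \<in> \<Omega>") (simp_all add: indicator_def)
  qed
  also have "\<dots> = (\<integral>\<^sup>+z. \<integral>\<^sup>+x. ?F x z \<partial>lborel \<partial>lborel)"
    by (rule lborel_pair.Fubini') measurable
  also have "\<dots> = (\<integral>\<^sup>+z. ennreal (1 / norm z powr e) *
        (\<integral>\<^sup>+x. indicator {x\<in>\<Omega>. 2 * norm z < bdist \<Omega> x} x * ennreal (\<bar>f0 (x + z) - f0 x\<bar> powr p) \<partial>lborel) \<partial>lborel)"
  proof (rule nn_integral_cong)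
    fix z :: 'a
    have [measurable]: "{x\<in>\<Omega>. 2 * norm z < bdist \<Omega> x} \<in> sets borel" by measurable
    have "(\<integral>\<^sup>+x. ?F x z \<partial>lborel) = (\<integral>\<^sup>+x. ennreal (1 / norm z powr e) *
        (indicator {x\<in>\<Omega>. 2 * norm z < bdist \<Omega> x} x * ennreal (\<bar>f0 (x + z) - f0 x\<bar> powr p)) \<partial>lborel)"
      by (intro nn_integral_cong) (simp add: indicator_def flip: ennreal_mult')
    also have "\<dots> = ennreal (1 / norm z powr e) *
        (\<integral>\<^sup>+x. indicator {x\<in>\<Omega>. 2 * norm z < bdist \<Omega> x} x * ennreal (\<bar>f0 (x + z) - f0 x\<bar> powr p) \<partial>lborel)"
      by (rule nn_integral_cmult) measurable
    finally show "(\<integral>\<^sup>+x. ?F x z \<partial>lborel) = \<dots>" .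
  qed
  finally show ?thesis .
qed

theorem interp_space_subset_frac_space:
  fixes \<Omega> :: "'a::euclidean_space set" and s p :: real
  assumes \<Omega>: "open \<Omega>" "bounded \<Omega>" and p: "p \<ge> 1" and s: "s > 0"
  shows "interp_space \<Omega> s p \<subseteq> frac_space \<Omega> s p"
proof
  fix f assume fi: "f \<in> interp_space \<Omega> s p"
  have Ob [measurable]: "\<Omega> \<in> sets borel" using \<Omega>(1) by simp
  have fs: "f \<in> sum_space \<Omega> p" using fi by (simp add: interp_space_def)
  have fL: "f \<in> Lp_space \<Omega> p" by (rule sum_space_subset_Lp[OF Ob p fs])
  obtain f0 where f0: "integrable lborel f0" "AE x in lebesgue_on \<Omega>. f x = f0 x" "\<And>x. x \<notin> \<Omega> \<Longrightarrow> f0 x = 0"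
    using Lp_borel_extension[OF Ob \<Omega>(2) fL p] by metis
  have f0m [measurable]: "f0 \<in> borel_measurable borel" using f0(1) by auto
  define n where "n = DIM('a)"
  define e where "e = real n + s * p"
  have e: "e > 0" using s p by (simp add: e_def n_def add_pos_pos)
  \<comment> \<open>Setting K to 0 for l <= 0 makes it monotone on the whole line. Monotonicity
    gives its measurability and K(|z|) <= K(r) for r >= |z|.\<close>
  define K where "K l = (if l > 0 then K_functional \<Omega> p l f else 0)" for l
  have K0: "K l \<ge> 0" for l unfolding K_def using K_functional_nonneg[OF fs, of l] by simp
  have Kmono: "mono K"
  proof (rule monoI)
    fix l l' :: real assume "l \<le> l'"
    then show "K l \<le> K l'"
      using K0[of l'] K_functional_mono[OF fs, of l l'] by (auto simp: K_def split: if_splits)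
  qed
  have [measurable]: "K \<in> borel_measurable borel" by (rule borel_measurable_mono[OF Kmono])
  define c where "c = 4 * 3 powr (p - 1)"
  have c: "c > 0" by (simp add: c_def)
  define V where "V = unit_ball_vol (real n)"
  have V: "V > 0" unfolding V_def by (rule unit_ball_vol_pos) simp
  define Q where "Q = (\<integral>\<^sup>+l\<in>{0<..}. ennreal ((l powr (- s) * K_functional \<Omega> p l f) powr p / l) \<partial>lborel)"
  have "ennreal_root p Q < \<infinity>" using fi by (simp add: interp_space_def interp_seminorm_def Q_def)
  then have Q: "Q < \<infinity>" unfolding ennreal_root_finite_iff .
  \<comment> \<open>The kernel |z|^(-e) is spread over radii r >= |z|, and K(|z|) is enlarged to
    K(r). For fixed r only the indicator of a ball then depends on z, and exchanging the integrals
    yields its volume.\<close>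
  let ?\<Phi> = "\<lambda>z r. ennreal c * (indicator {w::'a \<times> real. norm (fst w) \<le> snd w \<and> snd w > 0} (z, r) *
      ennreal (K r powr p * (e * r powr (- e - 1))))"
  have "(\<integral>\<^sup>+x. indicator \<Omega> x * frac_density (\<lambda>x. bdist \<Omega> x / 2) e p f0 x \<partial>lborel)
    \<le> (\<integral>\<^sup>+z. \<integral>\<^sup>+r. ?\<Phi> z r \<partial>lborel \<partial>lborel)"
    unfolding frac_density_integral_shift[OF f0m Ob]
  proof (rule nn_integral_mono)
    fix z :: 'a
    show "ennreal (1 / norm z powr e) * (\<integral>\<^sup>+x. indicator {x\<in>\<Omega>. 2 * norm z < bdist \<Omega> x} x * ennreal (\<bar>f0 (x + z) - f0 x\<bar> powr p) \<partial>lborel)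
      \<le> (\<integral>\<^sup>+r. ?\<Phi> z r \<partial>lborel)"
    \<comment> \<open>At z = 0 the left side is 0, because division by 0 gives 0.\<close>
    proof (cases "z = 0")
      case False
      then have nz: "norm z > 0" by simp
      have "ennreal (1 / norm z powr e) * (\<integral>\<^sup>+x. indicator {x\<in>\<Omega>. 2 * norm z < bdist \<Omega> x} x * ennreal (\<bar>f0 (x + z) - f0 x\<bar> powr p) \<partial>lborel)
        \<le> ennreal (1 / norm z powr e) * ennreal (c * K (norm z) powr p)"
        using shift_difference_le_K[OF \<Omega> p False fs f0m f0(2)] nz by (intro mult_left_mono) (auto simp: c_def K_def)
      also have "\<dots> = ennreal (c * K (norm z) powr p) * ennreal (norm z powr (- e))"
        by (simp add: powr_minus divide_inverse mult.commute)
      also have "\<dots> = ennreal (c * K (norm z) powr p) * (\<integral>\<^sup>+r. ennreal (e * r powr (- e - 1)) * indicator {norm z..} r \<partial>lborel)"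
        by (simp only: nn_integral_powr_tail[OF nz e])
      also have "\<dots> = (\<integral>\<^sup>+r. ennreal (c * K (norm z) powr p) * (ennreal (e * r powr (- e - 1)) * indicator {norm z..} r) \<partial>lborel)"
        by (rule nn_integral_cmult[symmetric]) measurable
      also have "\<dots> \<le> (\<integral>\<^sup>+r. ?\<Phi> z r \<partial>lborel)"
      proof (rule nn_integral_mono)
        fix r :: real
        show "ennreal (c * K (norm z) powr p) * (ennreal (e * r powr (- e - 1)) * indicator {norm z..} r)
          \<le> ?\<Phi> z r"
        proof (cases "norm z \<le> r")
          case True
          have "K (norm z) powr p \<le> K r powr p" using monoD[OF Kmono True] K0 p by (intro powr_mono2) auto
          then have "c * (K (norm z) powr p * (e * r powr (- e - 1))) \<le> c * (K r powr p * (e * r powr (- e - 1)))"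
            using c e by (intro mult_left_mono mult_right_mono) auto
          then have "ennreal (c * K (norm z) powr p * (e * r powr (- e - 1))) \<le> ennreal (c * (K r powr p * (e * r powr (- e - 1))))"
            by (intro ennreal_leI) (simp add: mult.assoc)
          moreover have "r > 0" using True nz by linarith
          ultimately show ?thesis using True c e
            by (simp add: indicator_def flip: ennreal_mult')
        qed simp
      qed
      finally show ?thesis .
    qed simp
  qed
  also have "\<dots> = (\<integral>\<^sup>+r. \<integral>\<^sup>+z. ?\<Phi> z r \<partial>lborel \<partial>lborel)"
    by (rule lborel_pair.Fubini') measurable
  also have "\<dots> = (\<integral>\<^sup>+r. ennreal (c * e * V) * (ennreal ((r powr (- s) * K_functional \<Omega> p r f) powr p / r) * indicator {0<..} r) \<partial>lborel)"
  proof (rule nn_integral_cong)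
    fix r :: real
    show "(\<integral>\<^sup>+z. ?\<Phi> z r \<partial>lborel)
      = ennreal (c * e * V) * (ennreal ((r powr (- s) * K_functional \<Omega> p r f) powr p / r) * indicator {0<..} r)"
    proof (cases "r > 0")
      case True
      have "(\<integral>\<^sup>+z. ?\<Phi> z r \<partial>lborel)
        = (\<integral>\<^sup>+z. (ennreal c * ennreal (K r powr p * (e * r powr (- e - 1)))) * indicator (cball (0::'a) r) z \<partial>lborel)"
        using True by (intro nn_integral_cong) (auto simp: indicator_def)
      also have "\<dots> = (ennreal c * ennreal (K r powr p * (e * r powr (- e - 1)))) * ennreal (V * r ^ n)"
        using True by (subst nn_integral_cmult_indicator) (auto simp: emeasure_cball V_def n_def)
      also have "\<dots> = ennreal (c * (K r powr p * (e * r powr (- e - 1))) * (V * r ^ n))"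
        using c e V True by (simp add: ennreal_mult less_imp_le)
      \<comment> \<open>Since e = n + s p, the ball volume reduces r^(-e-1) to r^(-sp-1), the weight
        of the interpolation seminorm.\<close>
      also have "c * (K r powr p * (e * r powr (- e - 1))) * (V * r ^ n) = (c * e * V) * ((r powr (- s) * K_functional \<Omega> p r f) powr p / r)"
      proof -
        have "r powr (- e - 1) * r ^ n = r powr (- (s * p)) / r"
          using True by (simp add: e_def powr_diff powr_minus powr_add powr_realpow field_simps)
        moreover have "(r powr (- s) * K r) powr p = r powr (- (s * p)) * K r powr p"
          using True K0 by (simp add: powr_mult powr_powr)
        moreover have "c * (K r powr p * (e * r powr (- e - 1))) * (V * r ^ n) = (c * e * V) * (K r powr p * (r powr (- e - 1) * r ^ n))"
          by (simp add: mult_ac)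
        ultimately show ?thesis using True by (simp add: K_def)
      qed
      also have "ennreal ((c * e * V) * ((r powr (- s) * K_functional \<Omega> p r f) powr p / r))
          = ennreal (c * e * V) * ennreal ((r powr (- s) * K_functional \<Omega> p r f) powr p / r)"
        using c e V by (intro ennreal_mult') simp
      finally show ?thesis using True by (simp only: indicator_simps greaterThan_iff mult_1_right)
    qed simp
  qed
  also have "\<dots> = ennreal (c * e * V) * Q"
    unfolding Q_def
  proof (rule nn_integral_cmult)
    have "(\<lambda>r. ennreal ((r powr (- s) * K r) powr p / r) * indicator {0<..} r) \<in> borel_measurable borel" by measurable
    also have "(\<lambda>r. ennreal ((r powr (- s) * K r) powr p / r) * indicator {0<..} r) =
      (\<lambda>r. ennreal ((r powr (- s) * K_functional \<Omega> p r f) powr p / r) * indicator {0<..} r)"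
      by (auto simp: K_def indicator_def)
    finally show "(\<lambda>r. ennreal ((r powr (- s) * K_functional \<Omega> p r f) powr p / r) * indicator {0<..} r) \<in> borel_measurable lborel" by simp
  qed
  also have "\<dots> < \<infinity>" using Q by (simp add: ennreal_mult_less_top)
  finally have "frac_seminorm \<Omega> s p f < \<infinity>"
    unfolding frac_seminorm_finite_iff[OF \<Omega>(1) f0(2)] e_def n_def .
  then show "f \<in> frac_space \<Omega> s p" using fL by (simp add: frac_space_def)
qed

subsection \<open>Coverings by John domains\<close>

lemma John_domain_contains_ball:
  assumes "John_domain U lam k"
  obtains x where "ball x lam \<subseteq> U"
proof -
  obtain x0 \<gamma> where U: "domain_on U" and x0: "x0 \<in> U" and
    \<gamma>: "\<And>y. y \<in> U \<Longrightarrow> \<gamma> 1 y = x0" "\<And>y t. y \<in> U \<Longrightarrow> t \<in> {0..1} \<Longrightarrow> bdist U (\<gamma> t y) \<ge> lam * t"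
    using assms unfolding John_domain_def by blast
  have "bdist U x0 \<ge> lam" using \<gamma>(1)[OF x0] \<gamma>(2)[OF x0, of 1] by simp
  then have "ball x0 lam \<subseteq> ball x0 (bdist U x0)" by (rule subset_ball)
  also have "\<dots> \<subseteq> U" using U x0 by (intro ball_bdist_subset) (auto simp: domain_on_def)
  finally show thesis by (rule that)
qed

text \<open>
  The frontier is porous: near each of its points the John curves supply a ball of comparable
  radius inside the domain, so no frontier point is a Lebesgue point of its indicator.
\<close>

lemma John_domain_frontier_null:
  fixes U :: "'a::euclidean_space set"
  assumes J: "John_domain U lam k"
  shows "AE y in lborel. y \<notin> frontier U"
proof -
  obtain x0 \<gamma> where U: "domain_on U" "bounded U" and lk: "lam > 0" "k > 0" and
    \<gamma>: "\<And>y t. y \<in> U \<Longrightarrow> t \<in> {0..1} \<Longrightarrow> \<gamma> t y \<in> U" "\<And>y. y \<in> U \<Longrightarrow> \<gamma> 0 y = y"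
      "\<And>y t. y \<in> U \<Longrightarrow> t \<in> {0..1} \<Longrightarrow> bdist U (\<gamma> t y) \<ge> lam * t"
      "\<And>y. y \<in> U \<Longrightarrow> bounded_speed_curve k (\<lambda>t. \<gamma> t y)"
    using J unfolding John_domain_def by blast
  have oU: "open U" using U by (simp add: domain_on_def)
  define f :: "'a \<Rightarrow> real" where "f = indicator (frontier U)"
  have [measurable]: "frontier U \<in> sets borel" by (simp add: frontier_closed)
  have f: "integrable lborel f"
    unfolding f_def using emeasure_bounded_finite[OF bounded_subset[OF bounded_closure[OF U(2)]], of "frontier U"]
    by (intro integrable_real_indicator) (auto simp: frontier_def)
  have [measurable]: "f \<in> borel_measurable borel" using f by auto
  \<comment> \<open>From a point of U within r/4 of y, the curve is followed for time r/(4k), that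
    is over a length of at most r/4. There \<open>bdist\<close> is at least lam r/(4k) >= q r, and q
    <= 1/2 keeps the ball of radius q r inside \<open>ball y r\<close>.\<close>
  define q where "q = min (1/2) (lam / (4 * k))"
  have q: "q > 0" "q \<le> 1/2" "q \<le> lam / (4 * k)" using lk by (auto simp: q_def)
  define v where "v = unit_ball_vol (real DIM('a)) * q ^ DIM('a)"
  have v: "v > 0" unfolding v_def using q unit_ball_vol_pos[of "real DIM('a)"] by simp
  have lower: "ennreal v \<le> local_osc f r y" if y: "y \<in> frontier U" and r: "0 < r" "r \<le> 4 * k" for y r
  proof -
    have "y \<in> closure U" using y by (simp add: frontier_def)
    then obtain y' where y': "y' \<in> U" "dist y' y < r / 4"
      using closure_approachable[of y U] r by (metis divide_pos_pos zero_less_numeral)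
    define t where "t = r / (4 * k)"
    have t: "t \<in> {0..1}" using r lk by (auto simp: t_def)
    define x where "x = \<gamma> t y'"
    have xU: "x \<in> U" unfolding x_def by (rule \<gamma>(1)[OF y'(1) t])
    have "dist y' x \<le> k * (t - 0)"
      using bounded_speed_curve_dist_le[OF \<gamma>(4)[OF y'(1)], of 0 t] t lk \<gamma>(2)[OF y'(1)] by (simp add: x_def)
    then have dx: "dist y' x \<le> r / 4" using lk by (simp add: t_def)
    have "bdist U x \<ge> lam * t" unfolding x_def by (rule \<gamma>(3)[OF y'(1) t])
    then have bx: "bdist U x \<ge> q * r"
      using q(3) r lk mult_right_mono[OF q(3), of r] by (simp add: t_def)
    have sub: "ball x (q * r) \<subseteq> ball y r"
    proof
      fix w assume "w \<in> ball x (q * r)"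
      moreover have "q * r \<le> r / 2" using q(2) r by simp
      ultimately have "dist x w < r / 2" by simp
      moreover have "dist y w \<le> dist y y' + dist y' x + dist x w"
        by (meson add_right_mono dist_triangle dist_triangle_le order_trans)
      ultimately show "w \<in> ball y r" using y'(2) dx by (simp add: dist_commute)
    qed
    have subU: "ball x (q * r) \<subseteq> U"
      using subset_ball[OF bx, of x] ball_bdist_subset[OF oU xU] by blast
    have "ennreal v = ennreal (1 / r ^ DIM('a)) * ennreal (unit_ball_vol (real DIM('a)) * (q * r) ^ DIM('a))"
      using r by (simp add: v_def power_mult_distrib flip: ennreal_mult')
    also have "ennreal (unit_ball_vol (real DIM('a)) * (q * r) ^ DIM('a)) = (\<integral>\<^sup>+w. indicator (ball x (q * r)) w \<partial>lborel)"
      using q r by (simp add: emeasure_ball)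
    also have "\<dots> \<le> (\<integral>\<^sup>+w. indicator (ball y r) w * ennreal \<bar>f w - f y\<bar> \<partial>lborel)"
    proof (rule nn_integral_mono)
      fix w
      have "w \<notin> frontier U" if "w \<in> U" using that oU by (simp add: frontier_def interior_open)
      then show "indicator (ball x (q * r)) w \<le> indicator (ball y r) w * ennreal \<bar>f w - f y\<bar>"
        using sub subU y by (auto simp: f_def indicator_def)
    qed
    finally show ?thesis unfolding local_osc_def by (simp add: mult_left_mono)
  qed
  define r where "r m = 4 * k / real (Suc m)" for m
  have r: "r m > 0" "r m \<le> 4 * k" for m using lk by (auto simp: r_def field_simps)
  have "r \<longlonglongrightarrow> 0" unfolding r_def using LIMSEQ_Suc[OF lim_const_over_n[of "4 * k"]] by simp
  then obtain \<rho> where \<rho>: "AE y in lborel. (\<lambda>m. local_osc f (r (\<rho> m)) y) \<longlonglongrightarrow> 0"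
    using local_osc_tendsto_AE[OF f, of r] r(1) by auto
  then show ?thesis
  proof eventually_elim
    case (elim y)
    show ?case
    proof
      assume y: "y \<in> frontier U"
      have "ennreal v \<le> 0"
        by (rule LIMSEQ_le_const[OF elim]) (use lower[OF y r] in blast)
      then show False using v by simp
    qed
  qed
qed

lemma finite_subset_overlap_le:
  assumes ov: "(\<Sum>\<^sub>\<infinity>j\<in>J. indicator (U j) x :: ennreal) \<le> ennreal C" and F: "finite F" "F \<subseteq> J" and C: "C \<ge> 0"
  shows "(\<Sum>j\<in>F. indicator (U j) x :: real) \<le> C"
proof -
  have "(\<Sum>j\<in>F. indicator (U j) x :: ennreal) \<le> (\<Sum>\<^sub>\<infinity>j\<in>J. indicator (U j) x)"
    by (subst nonneg_infsum_complete) (use F in \<open>auto intro!: SUP_upper\<close>)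
  with ov have "(\<Sum>j\<in>F. indicator (U j) x :: ennreal) \<le> ennreal C" by (rule order_trans[rotated])
  moreover have "(\<Sum>j\<in>F. indicator (U j) x :: ennreal) = ennreal (\<Sum>j\<in>F. indicator (U j) x)"
    by (subst sum_ennreal[symmetric]) (auto simp: ennreal_indicator)
  ultimately show ?thesis using C by (simp add: ennreal_le_iff)
qed

text \<open>Every piece contains a ball of radius \<open>lam\<close>, while bounded overlap limits
  the sum of the volumes to C times that of \<Omega>. Finiteness of J turns the partition of unity
  into a finite sum, whose weak gradient is the sum of the weak gradients.\<close>

lemma finite_cover_index:
  fixes U :: "'j \<Rightarrow> 'a::euclidean_space set"
  assumes \<Omega>: "open \<Omega>" "bounded \<Omega>" and U: "\<And>j. j \<in> J \<Longrightarrow> John_domain (U j) lam (k j)" "\<And>j. j \<in> J \<Longrightarrow> U j \<subseteq> \<Omega>"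
    and lam: "lam > 0" and C: "C \<ge> 0"
    and ov: "\<And>x. (\<Sum>\<^sub>\<infinity>j\<in>J. indicator (U j) x :: ennreal) \<le> ennreal C"
  shows "finite J"
proof -
  define v where "v = unit_ball_vol (real DIM('a)) * lam ^ DIM('a)"
  have v: "v > 0" unfolding v_def using lam unit_ball_vol_pos[of "real DIM('a)"] by simp
  have fin: "emeasure lborel \<Omega> < \<infinity>" by (rule emeasure_bounded_finite[OF \<Omega>(2)])
  define m where "m = measure lborel \<Omega>"
  have m: "emeasure lborel \<Omega> = ennreal m" unfolding m_def using fin by (intro emeasure_eq_ennreal_measure) auto
  have "card F \<le> nat \<lceil>C * m / v\<rceil>" if F: "F \<subseteq> J" "finite F" for F
  proof -
    have Ub: "U j \<in> sets borel" if "j \<in> F" for j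
      using U(1)[of j] that F by (auto simp: John_domain_def domain_on_def)
    have "ennreal (real (card F) * v) = (\<Sum>j\<in>F. ennreal v)"
      using v by (simp add: ennreal_mult' ennreal_of_nat_eq_real_of_nat)
    also have "\<dots> \<le> (\<Sum>j\<in>F. emeasure lborel (U j))"
    proof (rule sum_mono)
      fix j assume j: "j \<in> F"
      then obtain x where x: "ball x lam \<subseteq> U j" using John_domain_contains_ball[OF U(1)] F by blast
      have "ennreal v = emeasure lborel (ball x lam)" using lam by (simp add: v_def emeasure_ball)
      also have "\<dots> \<le> emeasure lborel (U j)" using x Ub[OF j] by (intro emeasure_mono) auto
      finally show "ennreal v \<le> emeasure lborel (U j)" .
    qed
    also have "\<dots> = (\<Sum>j\<in>F. \<integral>\<^sup>+x. indicator (U j) x \<partial>lborel)"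
      using Ub by (intro sum.cong) auto
    also have "\<dots> = (\<integral>\<^sup>+x. (\<Sum>j\<in>F. indicator (U j) x) \<partial>lborel)"
      using Ub by (intro nn_integral_sum[symmetric]) auto
    also have "\<dots> \<le> (\<integral>\<^sup>+x. ennreal C * indicator \<Omega> x \<partial>lborel)"
    proof (rule nn_integral_mono)
      fix x
      have "(\<Sum>j\<in>F. indicator (U j) x :: ennreal) = ennreal (\<Sum>j\<in>F. indicator (U j) x)"
        by (subst sum_ennreal[symmetric]) (auto simp: ennreal_indicator)
      also have "\<dots> \<le> ennreal C" by (intro ennreal_leI finite_subset_overlap_le[OF ov F(2,1) C])
      finally have le: "(\<Sum>j\<in>F. indicator (U j) x :: ennreal) \<le> ennreal C" .
      show "(\<Sum>j\<in>F. indicator (U j) x :: ennreal) \<le> ennreal C * indicator \<Omega> x"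
      proof (cases "x \<in> \<Omega>")
        case False
        then have "\<And>j. j \<in> F \<Longrightarrow> x \<notin> U j" using U(2) F by blast
        then show ?thesis by simp
      qed (use le in simp)
    qed
    also have "\<dots> = ennreal (C * m)" using \<Omega>(1) C m by (simp add: nn_integral_cmult_indicator ennreal_mult')
    finally have "real (card F) * v \<le> C * m" using C by (simp add: m_def ennreal_le_iff)
    then have "real (card F) \<le> C * m / v" using v by (simp add: field_simps)
    then show ?thesis by linarith
  qed
  then show ?thesis using finite_if_finite_subsets_card_bdd by blast
qed

lemma Linf_norm_AE_le:
  assumes "Linf_norm \<Omega> u \<le> ereal C"
  shows "AE x in lebesgue_on \<Omega>. norm (u x) \<le> C"
proof -
  have "AE x in lebesgue_on \<Omega>. ereal (norm (u x)) \<le> Linf_norm \<Omega> u"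
    unfolding Linf_norm_def by (rule esssup_AE)
  then show ?thesis
  proof eventually_elim
    case (elim x)
    then have "ereal (norm (u x)) \<le> ereal C" using assms by (rule order_trans)
    then show ?case by simp
  qed
qed

text \<open>The last claim combines locality, which gives vanishing off the closure of U_j, with the
  nullity of the frontier of U_j.\<close>

lemma partition_gradients:
  fixes \<Omega> :: "'a::euclidean_space set" and U :: "'j \<Rightarrow> 'a set"
  assumes \<Omega>: "open \<Omega>" and J: "finite J" and U: "\<And>j. j \<in> J \<Longrightarrow> John_domain (U j) lam k"
    and \<psi>: "\<And>j. j \<in> J \<Longrightarrow> \<psi> j \<in> W1inf_space \<Omega>" "\<And>j x. j \<in> J \<Longrightarrow> x \<in> \<Omega> - U j \<Longrightarrow> \<psi> j x = 0"
      "\<And>x. x \<in> \<Omega> \<Longrightarrow> (\<Sum>j\<in>J. \<psi> j x) = 1"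
  defines "D j \<equiv> weak_gradient \<Omega> (\<psi> j)"
  shows "\<And>j. j \<in> J \<Longrightarrow> is_weak_gradient \<Omega> (\<psi> j) (D j)"
    "\<And>j. j \<in> J \<Longrightarrow> D j \<in> borel_measurable (lebesgue_on \<Omega>)"
    "AE x in lebesgue_on \<Omega>. (\<Sum>j\<in>J. D j x) = 0"
    "AE x in lebesgue_on \<Omega>. \<forall>j\<in>J. x \<notin> U j \<longrightarrow> D j x = 0"
proof -
  have Ob: "\<Omega> \<in> sets borel" using \<Omega> by simp
  show D: "is_weak_gradient \<Omega> (\<psi> j) (D j)" if j: "j \<in> J" for j
  proof -
    obtain G where "is_weak_gradient \<Omega> (\<psi> j) G" using \<psi>(1)[OF j] by (auto simp: W1inf_space_def)
    then show ?thesis unfolding D_def weak_gradient_def by (rule someI[of "is_weak_gradient \<Omega> (\<psi> j)"])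
  qed
  show "D j \<in> borel_measurable (lebesgue_on \<Omega>)" if j: "j \<in> J" for j
  proof -
    obtain G where G: "is_weak_gradient \<Omega> (\<psi> j) G" "G \<in> borel_measurable (lebesgue_on \<Omega>)"
      using \<psi>(1)[OF j] by (auto simp: W1inf_space_def Linf_space_def)
    show ?thesis by (rule borel_measurable_lebesgue_on_AE[OF Ob G(2) weak_gradient_unique[OF \<Omega> D[OF j] G(1)]])
  qed
  \<comment> \<open>Subtracting 1 makes the sum vanish on \<Omega>, so that
    \<open>weak_gradient_zero_on_open\<close> applies.\<close>
  have "is_weak_gradient \<Omega> (\<lambda>x. (\<Sum>j\<in>J. 1 * \<psi> j x) + (- 1)) (\<lambda>x. (\<Sum>j\<in>J. 1 *\<^sub>R D j x) + 0)"
    by (intro is_weak_gradient_add[OF Ob] is_weak_gradient_sum[OF Ob J] is_weak_gradient_const[OF Ob] D)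
  from weak_gradient_zero_on_open[OF \<Omega> \<Omega> order_refl this]
  show "AE x in lebesgue_on \<Omega>. (\<Sum>j\<in>J. D j x) = 0" using \<psi>(3) by simp
  have "AE x in lebesgue_on \<Omega>. x \<notin> U j \<longrightarrow> D j x = 0" if j: "j \<in> J" for j
  proof -
    define V where "V = \<Omega> - closure (U j)"
    have V: "open V" "V \<subseteq> \<Omega>" unfolding V_def using \<Omega> by (auto simp: open_Diff)
    have Vb: "V \<in> sets borel" using V by simp
    have oU: "open (U j)" using U[OF j] by (simp add: John_domain_def domain_on_def)
    have "AE x in lebesgue_on V. D j x = 0"
      by (rule weak_gradient_zero_on_open[OF \<Omega> V D[OF j]])
         (use \<psi>(2)[OF j] closure_subset[of "U j"] in \<open>auto simp: V_def\<close>)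
    then show ?thesis
      using John_domain_frontier_null[OF U[OF j]]
      unfolding AE_lebesgue_on_iff[OF Vb] AE_lebesgue_on_iff[OF Ob]
      by eventually_elim (use oU in \<open>auto simp: V_def frontier_def interior_open\<close>)
  qed
  then show "AE x in lebesgue_on \<Omega>. \<forall>j\<in>J. x \<notin> U j \<longrightarrow> D j x = 0"
    using J by (intro AE_finite_allI) auto
qed

subsection \<open>From the fractional space to the interpolation space\<close>

lemma Lp_norm_le_dominated:
  fixes u :: "'a::euclidean_space \<Rightarrow> 'b::euclidean_space"
  assumes \<Omega>: "\<Omega> \<in> sets borel" and p: "p \<ge> 1" and u: "u \<in> borel_measurable (lebesgue_on \<Omega>)"
    and S: "S \<in> borel_measurable borel" "\<And>x. S x \<ge> 0" and B: "B \<ge> 0" "t \<ge> 0"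
    and le: "AE x in lebesgue_on \<Omega>. norm (u x) \<le> B * S x"
    and t: "(\<integral>\<^sup>+x. ennreal (S x powr p) \<partial>lborel) \<le> ennreal t"
  shows "u \<in> Lp_space \<Omega> p" "Lp_norm \<Omega> p u powr p \<le> B powr p * t"
proof -
  note [measurable] = S(1)
  have bound: "(\<integral>\<^sup>+x. indicator \<Omega> x * ennreal (norm (u x) powr p) \<partial>lborel) \<le> ennreal (B powr p * t)"
  proof -
    have "(\<integral>\<^sup>+x. indicator \<Omega> x * ennreal (norm (u x) powr p) \<partial>lborel) \<le> (\<integral>\<^sup>+x. ennreal (B powr p) * ennreal (S x powr p) \<partial>lborel)"
    proof (rule nn_integral_mono_AE)
      show "AE x in lborel. indicator \<Omega> x * ennreal (norm (u x) powr p) \<le> ennreal (B powr p) * ennreal (S x powr p)"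
        using le unfolding AE_lebesgue_on_iff[OF \<Omega>]
      proof eventually_elim
        case (elim x)
        show ?case
        proof (cases "x \<in> \<Omega>")
          case True
          then have "norm (u x) powr p \<le> (B * S x) powr p" using elim p by (intro powr_mono2) auto
          also have "\<dots> = B powr p * S x powr p" using B S by (simp add: powr_mult)
          finally show ?thesis using True by (simp add: ennreal_leI flip: ennreal_mult')
        qed simp
      qed
    qed
    also have "\<dots> = ennreal (B powr p) * (\<integral>\<^sup>+x. ennreal (S x powr p) \<partial>lborel)" by (rule nn_integral_cmult) measurable
    also have "\<dots> \<le> ennreal (B powr p) * ennreal t" by (intro mult_left_mono t) simp
    finally show ?thesis by (simp add: ennreal_mult')
  qed
  then have "(\<integral>\<^sup>+x. indicator \<Omega> x * ennreal (norm (u x) powr p) \<partial>lborel) < \<infinity>"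
    by (rule le_less_trans) simp
  then show L: "u \<in> Lp_space \<Omega> p" by (rule Lp_spaceI[OF \<Omega> u])
  show "Lp_norm \<Omega> p u powr p \<le> B powr p * t"
    using bound unfolding Lp_norm_powr[OF \<Omega> L p, symmetric] using B(2) by (simp add: ennreal_le_iff)
qed

lemma Lp_norm_diff_powr_le:
  fixes u v :: "'a::euclidean_space \<Rightarrow> real"
  assumes \<Omega>: "\<Omega> \<in> sets borel" and p: "p \<ge> 1" and u: "u \<in> Lp_space \<Omega> p" and v: "v \<in> Lp_space \<Omega> p"
  shows "(\<lambda>x. u x - v x) \<in> Lp_space \<Omega> p"
    "Lp_norm \<Omega> p (\<lambda>x. u x - v x) powr p \<le> 2 powr (p - 1) * (Lp_norm \<Omega> p u powr p + Lp_norm \<Omega> p v powr p)"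
proof -
  have um: "u \<in> borel_measurable (lebesgue_on \<Omega>)" "v \<in> borel_measurable (lebesgue_on \<Omega>)"
    and ui: "integrable (lebesgue_on \<Omega>) (\<lambda>x. norm (u x) powr p)" "integrable (lebesgue_on \<Omega>) (\<lambda>x. norm (v x) powr p)"
    using u v by (auto simp: Lp_space_def)
  have pt: "norm (u x - v x) powr p \<le> 2 powr (p - 1) * (norm (u x) powr p + norm (v x) powr p)" for x
  proof -
    have "norm (u x - v x) powr p \<le> (\<bar>u x\<bar> + \<bar>v x\<bar>) powr p" using p by (intro powr_mono2) auto
    also have "\<dots> \<le> 2 powr (p - 1) * (\<bar>u x\<bar> powr p + \<bar>v x\<bar> powr p)" by (rule add_powr_le) (use p in auto)
    finally show ?thesis by simp
  qed
  have i: "integrable (lebesgue_on \<Omega>) (\<lambda>x. norm (u x - v x) powr p)"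
  proof (rule Bochner_Integration.integrable_bound)
    show "integrable (lebesgue_on \<Omega>) (\<lambda>x. 2 powr (p - 1) * (norm (u x) powr p + norm (v x) powr p))"
      using ui by auto
    show "AE x in lebesgue_on \<Omega>. norm (norm (u x - v x) powr p) \<le> norm (2 powr (p - 1) * (norm (u x) powr p + norm (v x) powr p))"
      using pt by (intro AE_I2) simp
  qed (use um in simp)
  with um show L: "(\<lambda>x. u x - v x) \<in> Lp_space \<Omega> p" by (simp add: Lp_space_def)
  have N: "Lp_norm \<Omega> p w powr p = (\<integral>x. norm (w x) powr p \<partial>lebesgue_on \<Omega>)" for w :: "'a \<Rightarrow> real"
    using p Bochner_Integration.integral_nonneg[of "lebesgue_on \<Omega>" "\<lambda>x. norm (w x) powr p"]
    by (simp add: Lp_norm_def powr_powr)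
  have "(\<integral>x. norm (u x - v x) powr p \<partial>lebesgue_on \<Omega>) \<le> (\<integral>x. 2 powr (p - 1) * (norm (u x) powr p + norm (v x) powr p) \<partial>lebesgue_on \<Omega>)"
    using i ui pt by (intro integral_mono) auto
  also have "\<dots> = 2 powr (p - 1) * ((\<integral>x. norm (u x) powr p \<partial>lebesgue_on \<Omega>) + (\<integral>x. norm (v x) powr p \<partial>lebesgue_on \<Omega>))"
    using ui by simp
  finally show "Lp_norm \<Omega> p (\<lambda>x. u x - v x) powr p \<le> 2 powr (p - 1) * (Lp_norm \<Omega> p u powr p + Lp_norm \<Omega> p v powr p)"
    unfolding N .
qed

text \<open>The indicators serve as Jensen weights of total mass at most C, which gives C^(p-1);
  adding the right-hand sides over the overlapping pieces gives the remaining factor C.\<close>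

lemma overlap_sum_powr_le:
  fixes U :: "'j \<Rightarrow> 'a::euclidean_space set"
  assumes J: "finite J" "\<And>j. j \<in> J \<Longrightarrow> U j \<in> sets borel" "\<And>j. j \<in> J \<Longrightarrow> U j \<subseteq> \<Omega>" and \<Omega>: "\<Omega> \<in> sets borel"
    and ov: "\<And>x. (\<Sum>j\<in>J. indicator (U j) x :: real) \<le> C" and C: "C > 0" and A: "A \<ge> 0" and p: "p \<ge> 1"
    and f0: "f0 \<in> borel_measurable borel" and G: "G \<in> borel_measurable borel"
    and P: "\<And>j. j \<in> J \<Longrightarrow> (\<integral>\<^sup>+x. indicator (U j) x * ennreal (\<bar>f0 x - a j\<bar> powr p) \<partial>lborel)
       \<le> ennreal A * (\<integral>\<^sup>+x. indicator (U j) x * G x \<partial>lborel)"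
  shows "(\<integral>\<^sup>+x. ennreal ((\<Sum>j\<in>J. indicator (U j) x * \<bar>f0 x - a j\<bar>) powr p) \<partial>lborel)
    \<le> ennreal (C powr p * A) * (\<integral>\<^sup>+x. indicator \<Omega> x * G x \<partial>lborel)"
proof -
  note [measurable] = f0 G \<Omega>
  let ?c = "ennreal (C powr (p - 1))"
  have "(\<integral>\<^sup>+x. ennreal ((\<Sum>j\<in>J. indicator (U j) x * \<bar>f0 x - a j\<bar>) powr p) \<partial>lborel)
    \<le> (\<integral>\<^sup>+x. ?c * (\<Sum>j\<in>J. indicator (U j) x * ennreal (\<bar>f0 x - a j\<bar> powr p)) \<partial>lborel)"
  proof (rule nn_integral_mono)
    fix x
    have "(\<Sum>j\<in>J. indicator (U j) x * \<bar>f0 x - a j\<bar>) powr p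
      \<le> (\<Sum>j\<in>J. indicator (U j) x) powr (p - 1) * (\<Sum>j\<in>J. indicator (U j) x * \<bar>f0 x - a j\<bar> powr p)"
      using J(1) p by (intro sum_weighted_powr_le) auto
    also have "\<dots> \<le> C powr (p - 1) * (\<Sum>j\<in>J. indicator (U j) x * \<bar>f0 x - a j\<bar> powr p)"
      using p ov by (intro mult_right_mono powr_mono2 sum_nonneg) auto
    finally have "ennreal ((\<Sum>j\<in>J. indicator (U j) x * \<bar>f0 x - a j\<bar>) powr p)
       \<le> ennreal (C powr (p - 1) * (\<Sum>j\<in>J. indicator (U j) x * \<bar>f0 x - a j\<bar> powr p))"
      by (rule ennreal_leI)
    also have "\<dots> = ?c * (\<Sum>j\<in>J. ennreal (indicator (U j) x * \<bar>f0 x - a j\<bar> powr p))"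
      by (subst ennreal_mult') (auto simp: sum_ennreal)
    also have "(\<Sum>j\<in>J. ennreal (indicator (U j) x * \<bar>f0 x - a j\<bar> powr p)) = (\<Sum>j\<in>J. indicator (U j) x * ennreal (\<bar>f0 x - a j\<bar> powr p))"
      by (intro sum.cong refl) (simp add: indicator_def)
    finally show "ennreal ((\<Sum>j\<in>J. indicator (U j) x * \<bar>f0 x - a j\<bar>) powr p)
      \<le> ?c * (\<Sum>j\<in>J. indicator (U j) x * ennreal (\<bar>f0 x - a j\<bar> powr p))" .
  qed
  also have "\<dots> = ?c * (\<Sum>j\<in>J. \<integral>\<^sup>+x. indicator (U j) x * ennreal (\<bar>f0 x - a j\<bar> powr p) \<partial>lborel)"
    using J(2) by (subst nn_integral_cmult, simp, subst nn_integral_sum) auto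
  also have "\<dots> \<le> ?c * (\<Sum>j\<in>J. ennreal A * (\<integral>\<^sup>+x. indicator (U j) x * G x \<partial>lborel))"
    by (intro mult_left_mono sum_mono P) auto
  also have "\<dots> = ?c * (ennreal A * (\<integral>\<^sup>+x. (\<Sum>j\<in>J. indicator (U j) x * G x) \<partial>lborel))"
    using J(2) by (subst nn_integral_sum) (auto simp: sum_distrib_left)
  also have "\<dots> \<le> ?c * (ennreal A * (\<integral>\<^sup>+x. ennreal C * (indicator \<Omega> x * G x) \<partial>lborel))"
  proof (rule mult_left_mono[OF mult_left_mono[OF nn_integral_mono]])
    fix x
    show "(\<Sum>j\<in>J. indicator (U j) x * G x) \<le> ennreal C * (indicator \<Omega> x * G x)"
    proof (cases "x \<in> \<Omega>")
      case True
      have "(\<Sum>j\<in>J. indicator (U j) x :: ennreal) = ennreal (\<Sum>j\<in>J. indicator (U j) x)"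
        by (subst sum_ennreal[symmetric]) (auto simp: ennreal_indicator)
      also have "\<dots> \<le> ennreal C" by (intro ennreal_leI ov)
      finally have "(\<Sum>j\<in>J. indicator (U j) x) * G x \<le> ennreal C * G x" by (rule mult_right_mono) simp
      then show ?thesis using True by (simp add: sum_distrib_right)
    next
      case False
      then have "x \<notin> U j" if "j \<in> J" for j using J(3)[OF that] by blast
      then show ?thesis by simp
    qed
  qed auto
  also have "\<dots> = ennreal (C powr (p - 1) * A * C) * (\<integral>\<^sup>+x. indicator \<Omega> x * G x \<partial>lborel)"
    using C A by (subst nn_integral_cmult, simp, subst ennreal_mult, simp, simp, subst ennreal_mult) (simp_all add: mult.assoc)
  also have "C powr (p - 1) * A * C = C powr p * A" using C by (simp add: powr_diff)
  finally show ?thesis .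
qed

lemma K_functional_powr_le:
  fixes \<Omega> :: "'a::euclidean_space set" and U :: "'j \<Rightarrow> 'a set"
  assumes \<Omega>: "open \<Omega>" and p: "p \<ge> 1" and l: "0 < l" "l \<le> 1" and C: "C > 0" and A: "A \<ge> 0"
    and J: "finite J" and U: "\<And>j. j \<in> J \<Longrightarrow> John_domain (U j) lam k" "\<And>j. j \<in> J \<Longrightarrow> U j \<subseteq> \<Omega>"
    and ov: "\<And>x. (\<Sum>j\<in>J. indicator (U j) x :: real) \<le> C"
    and \<psi>: "\<And>j. j \<in> J \<Longrightarrow> \<psi> j \<in> W1inf_space \<Omega>" "\<And>j x. j \<in> J \<Longrightarrow> x \<in> \<Omega> - U j \<Longrightarrow> \<psi> j x = 0"
      "\<And>x. x \<in> \<Omega> \<Longrightarrow> (\<Sum>j\<in>J. \<psi> j x) = 1"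
      "\<And>j. j \<in> J \<Longrightarrow> Linf_norm \<Omega> (\<psi> j) \<le> ereal C"
      "\<And>j. j \<in> J \<Longrightarrow> Linf_norm \<Omega> (weak_gradient \<Omega> (\<psi> j)) \<le> ereal (C / l)"
    and f: "f \<in> Lp_space \<Omega> p" and f0: "f0 \<in> borel_measurable borel" "AE x in lebesgue_on \<Omega>. f x = f0 x"
    and G: "G \<in> borel_measurable borel"
    and P: "\<And>j. j \<in> J \<Longrightarrow> (\<integral>\<^sup>+x. indicator (U j) x * ennreal (\<bar>f0 x - a j\<bar> powr p) \<partial>lborel)
       \<le> ennreal A * (\<integral>\<^sup>+x. indicator (U j) x * G x \<partial>lborel)"
    and fin: "(\<integral>\<^sup>+x. indicator \<Omega> x * G x \<partial>lborel) < \<infinity>"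
  shows "ennreal (K_functional \<Omega> p l f powr p)
    \<le> ennreal (3 powr (p - 1) * (2 + 2 powr (p - 1)) * C powr p * (C powr p * A)) * (\<integral>\<^sup>+x. indicator \<Omega> x * G x \<partial>lborel)
      + ennreal (3 powr (p - 1) * 2 powr (p - 1) * Lp_norm \<Omega> p f powr p * l powr p)"
proof -
  have Ob: "\<Omega> \<in> sets borel" using \<Omega> by simp
  have Ub: "U j \<in> sets borel" if "j \<in> J" for j using U(1)[OF that] by (auto simp: John_domain_def domain_on_def)
  note [measurable] = f0(1)
  define S where "S x = (\<Sum>j\<in>J. indicator (U j) x * \<bar>f0 x - a j\<bar>)" for x
  have S0: "S x \<ge> 0" for x unfolding S_def by (intro sum_nonneg) auto
  have Sm: "S \<in> borel_measurable borel" unfolding S_def[abs_def] using Ub by (intro borel_measurable_sum) auto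
  define t where "t = enn2real (ennreal (C powr p * A) * (\<integral>\<^sup>+x. indicator \<Omega> x * G x \<partial>lborel))"
  have t: "ennreal t = ennreal (C powr p * A) * (\<integral>\<^sup>+x. indicator \<Omega> x * G x \<partial>lborel)" "t \<ge> 0"
    unfolding t_def using fin by (auto simp: ennreal_mult_less_top)
  have St: "(\<integral>\<^sup>+x. ennreal (S x powr p) \<partial>lborel) \<le> ennreal t"
    unfolding t(1) S_def by (rule overlap_sum_powr_le[OF J Ub U(2) Ob ov C A p f0(1) G P])
  define D where "D j = weak_gradient \<Omega> (\<psi> j)" for j
  have D: "\<And>j. j \<in> J \<Longrightarrow> is_weak_gradient \<Omega> (\<psi> j) (D j)"
    "\<And>j. j \<in> J \<Longrightarrow> D j \<in> borel_measurable (lebesgue_on \<Omega>)"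
    "AE x in lebesgue_on \<Omega>. (\<Sum>j\<in>J. D j x) = 0"
    "AE x in lebesgue_on \<Omega>. \<forall>j\<in>J. x \<notin> U j \<longrightarrow> D j x = 0"
    unfolding D_def by (rule partition_gradients[where U=U and lam=lam and k=k and J=J]; use \<Omega> J U \<psi> in blast)+
  define h where "h x = (\<Sum>j\<in>J. a j * \<psi> j x)" for x
  define H where "H x = (\<Sum>j\<in>J. a j *\<^sub>R D j x)" for x
  have \<psi>m: "\<psi> j \<in> borel_measurable (lebesgue_on \<Omega>)" if "j \<in> J" for j
    using \<psi>(1)[OF that] by (simp add: W1inf_space_def Linf_space_def)
  have fm: "f \<in> borel_measurable (lebesgue_on \<Omega>)" using f by (simp add: Lp_space_def)
  have hm: "h \<in> borel_measurable (lebesgue_on \<Omega>)" unfolding h_def[abs_def] using \<psi>m by (intro borel_measurable_sum) auto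
  have Hm: "H \<in> borel_measurable (lebesgue_on \<Omega>)" unfolding H_def[abs_def] using D(2) by (intro borel_measurable_sum) auto
  have hH: "is_weak_gradient \<Omega> h H" unfolding h_def[abs_def] H_def[abs_def] by (rule is_weak_gradient_sum[OF Ob J D(1)])
  have \<psi>C: "AE x in lebesgue_on \<Omega>. \<forall>j\<in>J. norm (\<psi> j x) \<le> C"
    using J \<psi>(4) by (intro AE_finite_allI Linf_norm_AE_le) auto
  have DC: "AE x in lebesgue_on \<Omega>. \<forall>j\<in>J. norm (D j x) \<le> C / l"
    unfolding D_def using J \<psi>(5) by (intro AE_finite_allI Linf_norm_AE_le) auto
  have inO: "AE x in lebesgue_on \<Omega>. x \<in> \<Omega>" unfolding AE_lebesgue_on_iff[OF Ob] by simp
  have g_le: "AE x in lebesgue_on \<Omega>. norm (f x - h x) \<le> C * S x"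
    using \<psi>C f0(2) inO
  proof eventually_elim
    case (elim x)
    have "f x - h x = (\<Sum>j\<in>J. (f0 x - a j) * \<psi> j x)"
      using \<psi>(3)[OF elim(3)] elim(2) by (simp add: h_def left_diff_distrib sum_subtractf flip: sum_distrib_left)
    then have "norm (f x - h x) \<le> (\<Sum>j\<in>J. norm ((f0 x - a j) * \<psi> j x))" by (simp only: norm_sum)
    also have "\<dots> \<le> (\<Sum>j\<in>J. C * (indicator (U j) x * \<bar>f0 x - a j\<bar>))"
    proof (rule sum_mono)
      fix j assume j: "j \<in> J"
      show "norm ((f0 x - a j) * \<psi> j x) \<le> C * (indicator (U j) x * \<bar>f0 x - a j\<bar>)"
      proof (cases "x \<in> U j")
        case True
        have "\<bar>f0 x - a j\<bar> * \<bar>\<psi> j x\<bar> \<le> \<bar>f0 x - a j\<bar> * C" using elim(1) j by (intro mult_left_mono) auto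
        then show ?thesis using True by (simp add: abs_mult mult.commute)
      qed (use \<psi>(2)[OF j] elim(3) in simp)
    qed
    also have "\<dots> = C * S x" by (simp add: S_def sum_distrib_left)
    finally show ?case .
  qed
  have H_le: "AE x in lebesgue_on \<Omega>. norm (H x) \<le> (C / l) * S x"
    using DC D(3) D(4)
  proof eventually_elim
    case (elim x)
    have "H x = (\<Sum>j\<in>J. (a j - f0 x) *\<^sub>R D j x)"
      using elim(2) by (simp add: H_def scaleR_left_diff_distrib sum_subtractf flip: scaleR_sum_right)
    then have "norm (H x) \<le> (\<Sum>j\<in>J. norm ((a j - f0 x) *\<^sub>R D j x))" by (simp only: norm_sum)
    also have "\<dots> \<le> (\<Sum>j\<in>J. (C / l) * (indicator (U j) x * \<bar>f0 x - a j\<bar>))"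
    proof (rule sum_mono)
      fix j assume j: "j \<in> J"
      show "norm ((a j - f0 x) *\<^sub>R D j x) \<le> (C / l) * (indicator (U j) x * \<bar>f0 x - a j\<bar>)"
      proof (cases "x \<in> U j")
        case True
        have "\<bar>f0 x - a j\<bar> * norm (D j x) \<le> \<bar>f0 x - a j\<bar> * (C / l)" using elim(1) j by (intro mult_left_mono) auto
        then show ?thesis using True by (simp add: abs_minus_commute mult.commute)
      qed (use elim(3) j in simp)
    qed
    also have "\<dots> = (C / l) * S x" by (simp add: S_def sum_distrib_left)
    finally show ?case .
  qed
  define g where "g x = f x - h x" for x
  have gm: "g \<in> borel_measurable (lebesgue_on \<Omega>)" unfolding g_def[abs_def] using fm hm by simp
  have g: "g \<in> Lp_space \<Omega> p" "Lp_norm \<Omega> p g powr p \<le> C powr p * t"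
    by (rule Lp_norm_le_dominated[OF Ob p gm Sm S0 less_imp_le[OF C] t(2) g_le[folded g_def] St])+
  have Cl: "C / l \<ge> 0" using C l by simp
  have HL: "H \<in> Lp_space \<Omega> p" "Lp_norm \<Omega> p H powr p \<le> (C / l) powr p * t"
    by (rule Lp_norm_le_dominated[OF Ob p Hm Sm S0 Cl t(2) H_le St])+
  \<comment> \<open>The W^{1,p} norm of h contains its L^p norm, which does not become small with l.
    It is estimated through f - g, and this is the origin of the separate term with the norm of f
    and \<open>l powr p\<close>.\<close>
  have "h = (\<lambda>x. f x - g x)" by (simp add: g_def)
  then have hL: "h \<in> Lp_space \<Omega> p" "Lp_norm \<Omega> p h powr p \<le> 2 powr (p - 1) * (Lp_norm \<Omega> p f powr p + Lp_norm \<Omega> p g powr p)"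
    using Lp_norm_diff_powr_le[OF Ob p f g(1)] by simp_all
  have hW: "h \<in> W1p_space \<Omega> p" using hL(1) HL(1) hH by (auto simp: W1p_space_def)
  define x y z where "x = Lp_norm \<Omega> p g" and "y = Lp_norm \<Omega> p h" and "z = Lp_norm \<Omega> p H"
  have xyz: "x \<ge> 0" "y \<ge> 0" "z \<ge> 0" by (auto simp: x_def y_def z_def Lp_norm_nonneg)
  have fs: "f \<in> sum_space \<Omega> p" by (rule Lp_subset_sum_space[OF Ob p f])
  have "K_functional \<Omega> p l f \<le> x + l * W1p_norm \<Omega> p h"
    unfolding x_def by (rule K_functional_le) (use l g(1) hW in \<open>auto simp: g_def\<close>)
  also have "W1p_norm \<Omega> p h = y + z"
    using weak_gradient_Lp(2)[OF \<Omega> hH HL(1)] by (simp add: W1p_norm_def y_def z_def)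
  finally have "K_functional \<Omega> p l f powr p \<le> (x + l * (y + z)) powr p"
    using K_functional_nonneg[OF fs, of l] l p by (intro powr_mono2) auto
  also have "x + l * (y + z) = (\<Sum>i\<in>{0,1,2::nat}. if i = 0 then x else if i = 1 then l * y else l * z)"
    by (simp add: distrib_left)
  also have "\<dots> powr p \<le> real (card {0,1,2::nat}) powr (p - 1) * (\<Sum>i\<in>{0,1,2::nat}. (if i = 0 then x else if i = 1 then l * y else l * z) powr p)"
    by (rule sum_powr_le) (use p xyz l in auto)
  also have "\<dots> = 3 powr (p - 1) * (x powr p + (l powr p * y powr p + l powr p * z powr p))"
    using l xyz by (simp add: powr_mult)
  \<comment> \<open>The factor 2 + 2^(p-1) collects one C^p t from g, one from the gradient, where
    l^p cancels the 1/l in its bound, and 2^(p-1) from the part of h controlled by g, where l <= 1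
    is used.\<close>
  also have "\<dots> \<le> 3 powr (p - 1) * (C powr p * t + ((2 powr (p - 1) * Lp_norm \<Omega> p f powr p * l powr p + 2 powr (p - 1) * (C powr p * t)) + C powr p * t))"
  proof (intro mult_left_mono add_mono)
    show "x powr p \<le> C powr p * t" unfolding x_def by (rule g(2))
    have lp: "l powr p \<le> 1" using l p powr_mono2[of p l 1] by simp
    have "l powr p * y powr p \<le> l powr p * (2 powr (p - 1) * (Lp_norm \<Omega> p f powr p + C powr p * t))"
    proof (intro mult_left_mono order_trans[OF hL(2)[folded y_def]])
      show "Lp_norm \<Omega> p f powr p + Lp_norm \<Omega> p g powr p \<le> Lp_norm \<Omega> p f powr p + C powr p * t" using g(2) by simp
    qed auto
    also have "\<dots> = 2 powr (p - 1) * Lp_norm \<Omega> p f powr p * l powr p + l powr p * (2 powr (p - 1) * (C powr p * t))"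
      by (simp add: algebra_simps)
    also have "l powr p * (2 powr (p - 1) * (C powr p * t)) \<le> 2 powr (p - 1) * (C powr p * t)"
      using lp t(2) by (intro mult_left_le_one_le) auto
    finally show "l powr p * y powr p \<le> 2 powr (p - 1) * Lp_norm \<Omega> p f powr p * l powr p + 2 powr (p - 1) * (C powr p * t)" by simp
    have "l powr p * z powr p \<le> l powr p * ((C / l) powr p * t)"
      unfolding z_def by (intro mult_left_mono HL(2)) simp
    also have "\<dots> = C powr p * t" using l C by (simp add: powr_divide)
    finally show "l powr p * z powr p \<le> C powr p * t" .
  qed simp
  also have "\<dots> = (3 powr (p - 1) * (2 + 2 powr (p - 1)) * C powr p) * t + 3 powr (p - 1) * 2 powr (p - 1) * Lp_norm \<Omega> p f powr p * l powr p"
    by (simp add: algebra_simps)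
  finally have "ennreal (K_functional \<Omega> p l f powr p) \<le> ennreal ((3 powr (p - 1) * (2 + 2 powr (p - 1)) * C powr p) * t + 3 powr (p - 1) * 2 powr (p - 1) * Lp_norm \<Omega> p f powr p * l powr p)"
    by (rule ennreal_leI)
  also have "\<dots> = ennreal (3 powr (p - 1) * (2 + 2 powr (p - 1)) * C powr p) * ennreal t + ennreal (3 powr (p - 1) * 2 powr (p - 1) * Lp_norm \<Omega> p f powr p * l powr p)"
    using t(2) by (subst ennreal_plus) (auto simp: ennreal_mult')
  also have "ennreal (3 powr (p - 1) * (2 + 2 powr (p - 1)) * C powr p) * ennreal t
      = ennreal (3 powr (p - 1) * (2 + 2 powr (p - 1)) * C powr p * (C powr p * A)) * (\<integral>\<^sup>+x. indicator \<Omega> x * G x \<partial>lborel)"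
  proof -
    have "ennreal (3 powr (p - 1) * (2 + 2 powr (p - 1)) * C powr p * (C powr p * A))
      = ennreal (3 powr (p - 1) * (2 + 2 powr (p - 1)) * C powr p) * ennreal (C powr p * A)"
      by (rule ennreal_mult') simp
    then show ?thesis unfolding t(1) by (simp add: mult.assoc)
  qed
  finally show ?thesis .
qed

text \<open>For fixed x and z the condition |x - z| < c l restricts l to l > |x - z| / c, where
  l^(-\<delta>-1) integrates to (c / |x - z|)^\<delta> / \<delta>. Integration over scales thus
  raises the kernel exponent from e to e + \<delta>.\<close>

lemma frac_density_layer_le:
  fixes f0 :: "'a::euclidean_space \<Rightarrow> real"
  assumes [measurable]: "f0 \<in> borel_measurable borel" "D \<in> borel_measurable borel" "\<Omega> \<in> sets borel"
    and c: "c > 0" and \<delta>: "\<delta> > 0" and p: "p \<ge> 1"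
  shows "(\<integral>\<^sup>+l. indicator {0<..} l * (ennreal (l powr (- \<delta> - 1)) *
      (\<integral>\<^sup>+x. indicator \<Omega> x * frac_density (\<lambda>x. min (D x) (c * l)) e p f0 x \<partial>lborel)) \<partial>lborel)
    \<le> ennreal (c powr \<delta> / \<delta>) * (\<integral>\<^sup>+x. indicator \<Omega> x * frac_density D (e + \<delta>) p f0 x \<partial>lborel)"
proof -
  let ?R = "\<lambda>x z. ennreal (\<bar>f0 x - f0 z\<bar> powr p / norm (x - z) powr e)"
  \<comment> \<open>All constraints are gathered in one jointly measurable integrand, so that l can
    be moved inside past x and then past z.\<close>
  define \<Phi> where "\<Phi> l x z = (if 0 < l \<and> x \<in> \<Omega> \<and> norm (x - z) < D x \<and> norm (x - z) < c * l
    then ennreal (l powr (- \<delta> - 1)) * ?R x z else 0)" for l x z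
  have "(\<integral>\<^sup>+l. indicator {0<..} l * (ennreal (l powr (- \<delta> - 1)) *
      (\<integral>\<^sup>+x. indicator \<Omega> x * frac_density (\<lambda>x. min (D x) (c * l)) e p f0 x \<partial>lborel)) \<partial>lborel)
    = (\<integral>\<^sup>+l. \<integral>\<^sup>+x. \<integral>\<^sup>+z. \<Phi> l x z \<partial>lborel \<partial>lborel \<partial>lborel)"
  proof (rule nn_integral_cong)
    fix l :: real
    show "indicator {0<..} l * (ennreal (l powr (- \<delta> - 1)) *
        (\<integral>\<^sup>+x. indicator \<Omega> x * frac_density (\<lambda>x. min (D x) (c * l)) e p f0 x \<partial>lborel))
      = (\<integral>\<^sup>+x. \<integral>\<^sup>+z. \<Phi> l x z \<partial>lborel \<partial>lborel)"
    proof (cases "l > 0")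
      case True
      have "(\<integral>\<^sup>+z. \<Phi> l x z \<partial>lborel) = ennreal (l powr (- \<delta> - 1)) * (indicator \<Omega> x * frac_density (\<lambda>x. min (D x) (c * l)) e p f0 x)" for x
      proof (cases "x \<in> \<Omega>")
        case xO: True
        have [measurable]: "{z. norm (x - z) < min (D x) (c * l)} \<in> sets borel" by measurable
        have "(\<integral>\<^sup>+z. \<Phi> l x z \<partial>lborel) = (\<integral>\<^sup>+z. ennreal (l powr (- \<delta> - 1)) *
            (indicator {z. norm (x - z) < min (D x) (c * l)} z * ?R x z) \<partial>lborel)"
          using True xO by (intro nn_integral_cong) (simp add: \<Phi>_def indicator_def)
        also have "\<dots> = ennreal (l powr (- \<delta> - 1)) * frac_density (\<lambda>x. min (D x) (c * l)) e p f0 x"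
          unfolding frac_density_def by (rule nn_integral_cmult) measurable
        finally show ?thesis using xO by simp
      qed (simp add: \<Phi>_def)
      then show ?thesis using True by (simp add: nn_integral_cmult)
    qed (simp add: \<Phi>_def)
  qed
  also have "\<dots> = (\<integral>\<^sup>+x. \<integral>\<^sup>+l. \<integral>\<^sup>+z. \<Phi> l x z \<partial>lborel \<partial>lborel \<partial>lborel)"
    unfolding \<Phi>_def by (rule lborel_pair.Fubini') measurable
  also have "\<dots> = (\<integral>\<^sup>+x. \<integral>\<^sup>+z. \<integral>\<^sup>+l. \<Phi> l x z \<partial>lborel \<partial>lborel \<partial>lborel)"
  proof (rule nn_integral_cong)
    fix x :: 'a
    show "(\<integral>\<^sup>+l. \<integral>\<^sup>+z. \<Phi> l x z \<partial>lborel \<partial>lborel) = (\<integral>\<^sup>+z. \<integral>\<^sup>+l. \<Phi> l x z \<partial>lborel \<partial>lborel)"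
      unfolding \<Phi>_def by (rule lborel_pair.Fubini') measurable
  qed
  also have "\<dots> \<le> (\<integral>\<^sup>+x. \<integral>\<^sup>+z. ennreal (c powr \<delta> / \<delta>) * (indicator {w. fst w \<in> \<Omega> \<and> norm (fst w - snd w) < D (fst w)} (x, z) *
      ennreal (\<bar>f0 x - f0 z\<bar> powr p / norm (x - z) powr (e + \<delta>))) \<partial>lborel \<partial>lborel)"
  proof (rule nn_integral_mono, rule nn_integral_mono)
    fix x z :: 'a
    show "(\<integral>\<^sup>+l. \<Phi> l x z \<partial>lborel) \<le> ennreal (c powr \<delta> / \<delta>) * (indicator {w. fst w \<in> \<Omega> \<and> norm (fst w - snd w) < D (fst w)} (x, z) *
      ennreal (\<bar>f0 x - f0 z\<bar> powr p / norm (x - z) powr (e + \<delta>)))"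
    proof (cases "x \<in> \<Omega> \<and> norm (x - z) < D x \<and> x \<noteq> z")
      case True
      define d where "d = norm (x - z)"
      have d: "d > 0" using True by (simp add: d_def)
      have "(\<integral>\<^sup>+l. \<Phi> l x z \<partial>lborel) \<le> (\<integral>\<^sup>+l. ennreal (1 / \<delta>) * ?R x z * (ennreal (\<delta> * l powr (- \<delta> - 1)) * indicator {d / c..} l) \<partial>lborel)"
      proof (rule nn_integral_mono)
        fix l :: real
        show "\<Phi> l x z \<le> ennreal (1 / \<delta>) * ?R x z * (ennreal (\<delta> * l powr (- \<delta> - 1)) * indicator {d / c..} l)"
        proof (cases "0 < l \<and> d < c * l")
          case lc: True
          then have "d / c \<le> l" using c by (simp add: divide_le_eq mult.commute)
          moreover have "ennreal (l powr (- \<delta> - 1)) * ?R x z = ennreal (1 / \<delta>) * ?R x z * ennreal (\<delta> * l powr (- \<delta> - 1))"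
            using \<delta> by (simp flip: ennreal_mult')
          ultimately show ?thesis using lc True by (simp add: \<Phi>_def d_def)
        qed (auto simp: \<Phi>_def d_def)
      qed
      also have "\<dots> = ennreal (1 / \<delta>) * ?R x z * (\<integral>\<^sup>+l. ennreal (\<delta> * l powr (- \<delta> - 1)) * indicator {d / c..} l \<partial>lborel)"
        by (rule nn_integral_cmult) measurable
      also have "\<dots> = ennreal (1 / \<delta>) * ?R x z * ennreal ((d / c) powr (- \<delta>))"
        using d c \<delta> by (subst nn_integral_powr_tail) auto
      also have "\<dots> = ennreal (1 / \<delta> * (\<bar>f0 x - f0 z\<bar> powr p / d powr e) * (d / c) powr (- \<delta>))"
        unfolding d_def[symmetric] using \<delta> by (simp add: mult.assoc flip: ennreal_mult'')
      also have "1 / \<delta> * (\<bar>f0 x - f0 z\<bar> powr p / d powr e) * (d / c) powr (- \<delta>)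
          = c powr \<delta> / \<delta> * (\<bar>f0 x - f0 z\<bar> powr p / d powr (e + \<delta>))"
        using d c \<delta> by (simp add: powr_divide powr_minus powr_add field_simps)
      also have "ennreal \<dots> = ennreal (c powr \<delta> / \<delta>) * ennreal (\<bar>f0 x - f0 z\<bar> powr p / d powr (e + \<delta>))"
        using \<delta> by (intro ennreal_mult) auto
      finally show ?thesis using True by (simp add: d_def)
    next
      case False
      have "\<Phi> l x z = 0" for l
        using False by (cases "x = z") (auto simp: \<Phi>_def)
      then show ?thesis by simp
    qed
  qed
  also have "\<dots> = ennreal (c powr \<delta> / \<delta>) * (\<integral>\<^sup>+x. indicator \<Omega> x * frac_density D (e + \<delta>) p f0 x \<partial>lborel)"
  proof -
    have "(\<integral>\<^sup>+z. ennreal (c powr \<delta> / \<delta>) * (indicator {w. fst w \<in> \<Omega> \<and> norm (fst w - snd w) < D (fst w)} (x, z) *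
        ennreal (\<bar>f0 x - f0 z\<bar> powr p / norm (x - z) powr (e + \<delta>))) \<partial>lborel)
      = ennreal (c powr \<delta> / \<delta>) * (indicator \<Omega> x * frac_density D (e + \<delta>) p f0 x)" for x
    proof (cases "x \<in> \<Omega>")
      case True
      have [measurable]: "{z. norm (x - z) < D x} \<in> sets borel" by measurable
      have "(\<integral>\<^sup>+z. ennreal (c powr \<delta> / \<delta>) * (indicator {w. fst w \<in> \<Omega> \<and> norm (fst w - snd w) < D (fst w)} (x, z) *
          ennreal (\<bar>f0 x - f0 z\<bar> powr p / norm (x - z) powr (e + \<delta>))) \<partial>lborel)
        = (\<integral>\<^sup>+z. ennreal (c powr \<delta> / \<delta>) * (indicator {z. norm (x - z) < D x} z *
          ennreal (\<bar>f0 x - f0 z\<bar> powr p / norm (x - z) powr (e + \<delta>))) \<partial>lborel)"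
        using True by (intro nn_integral_cong) (simp add: indicator_def)
      also have "\<dots> = ennreal (c powr \<delta> / \<delta>) * frac_density D (e + \<delta>) p f0 x"
        unfolding frac_density_def by (rule nn_integral_cmult) measurable
      finally show ?thesis using True by simp
    qed simp
    then show ?thesis by (simp add: nn_integral_cmult)
  qed
  finally show ?thesis .
qed

text \<open>Otherwise a step from x along a basis vector, of length strictly between the diameter
  and \<open>bdist\<close>, would end in U. This confines the density on a piece to distances of
  order l.\<close>

lemma bdist_le_diameter:
  fixes U :: "'a::euclidean_space set"
  assumes U: "open U" "bounded U" and x: "x \<in> U"
  shows "bdist U x \<le> diameter U"
proof (rule ccontr)
  assume "\<not> bdist U x \<le> diameter U"
  moreover define r where "r = (bdist U x + diameter U) / 2"
  ultimately have r: "diameter U < r" "r < bdist U x" by auto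
  obtain b :: 'a where b: "b \<in> Basis" using nonempty_Basis by blast
  have r0: "r \<ge> 0" using r(1) diameter_ge_0[OF U(2)] by simp
  have d: "dist x (x + r *\<^sub>R b) = r" using b r0 by (simp add: dist_norm)
  then have "x + r *\<^sub>R b \<in> U" using r(2) ball_bdist_subset[OF U(1) x] by auto
  then have "dist x (x + r *\<^sub>R b) \<le> diameter U" by (rule diameter_bounded_bound[OF U(2) x])
  then show False using d r(1) by simp
qed

lemma nn_integral_powr_near_0:
  assumes "a > 0"
  shows "(\<integral>\<^sup>+l. indicator {0..1} l * ennreal (l powr (a - 1)) \<partial>lborel) < \<infinity>"
proof -
  have "((\<lambda>l. l powr (a - 1)) has_integral (1 powr (a - 1 + 1) / (a - 1 + 1))) {0..1::real}"
    using assms by (intro has_integral_powr_from_0) auto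
  from nn_integral_has_integral_lebesgue[OF _ this]
  have "(\<integral>\<^sup>+l. ennreal (indicator {0..1} l * l powr (a - 1)) \<partial>lborel) = ennreal (1 powr (a - 1 + 1) / (a - 1 + 1))"
    by simp
  moreover have "(\<integral>\<^sup>+l. ennreal (indicator {0..1} l * l powr (a - 1)) \<partial>lborel) = (\<integral>\<^sup>+l. indicator {0..1} l * ennreal (l powr (a - 1)) \<partial>lborel)"
    by (intro nn_integral_cong) (simp add: indicator_def)
  ultimately show ?thesis by simp
qed

text \<open>The requirements of \<open>admissible_domain\<close> at a single scale l. Folding them
  into one constant allows the long existential statement to be handled as a unit.\<close>

definition John_partition ::
    "'a::euclidean_space set \<Rightarrow> real \<Rightarrow> real \<Rightarrow> real \<Rightarrow> real \<Rightarrow> real \<Rightarrow>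
     'j set \<Rightarrow> ('j \<Rightarrow> 'a set) \<Rightarrow> ('j \<Rightarrow> 'a \<Rightarrow> real) \<Rightarrow> bool"
  where "John_partition \<Omega> C lam k c l J U \<psi> \<longleftrightarrow>
     (\<forall>j\<in>J. domain_on (U j)) \<and> \<Omega> = (\<Union>j\<in>J. U j) \<and>
     (\<forall>j\<in>J. \<psi> j \<in> W1inf_space \<Omega>) \<and>
     (\<forall>j\<in>J. \<forall>x\<in>\<Omega> - U j. \<psi> j x = 0) \<and>
     (\<forall>x\<in>\<Omega>. ((\<lambda>j. \<psi> j x) has_sum 1) J) \<and>
     (\<forall>x. (\<Sum>\<^sub>\<infinity>j\<in>J. indicator (U j) x :: ennreal) \<le> ennreal C) \<and>
     (\<forall>j\<in>J. Linf_norm \<Omega> (\<psi> j) \<le> ereal C \<and>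
             Linf_norm \<Omega> (weak_gradient \<Omega> (\<psi> j)) \<le> ereal (C / l)) \<and>
     (\<forall>j\<in>J. John_domain (U j) (lam * l) (k * l)) \<and>
     (\<forall>j\<in>J. l / c \<le> diameter (U j) \<and> diameter (U j) \<le> c * l)"

theorem frac_space_subset_interp_space:
  fixes \<Omega> :: "'a::euclidean_space set" and s p :: real
  assumes adm: "admissible_domain \<Omega>" and p: "p \<ge> 1" and s: "0 < s" "s < 1"
  shows "frac_space \<Omega> s p \<subseteq> interp_space \<Omega> s p"
proof
  fix f assume ff: "f \<in> frac_space \<Omega> s p"
  obtain \<tau> C lam k c where \<Omega>d: "domain_on \<Omega>" and \<Omega>b: "bounded \<Omega>" and pos: "\<tau> > 0" "C > 0" "lam > 0" "k > 0" "c > 0" and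
    cover: "\<And>l. 0 < l \<Longrightarrow> l < \<tau> \<Longrightarrow> \<exists>(J :: nat set) U \<psi>. John_partition \<Omega> C lam k c l J U \<psi>"
    using adm unfolding admissible_domain_def John_partition_def[symmetric]
    by (elim exE conjE) (rule that, assumption+, drule spec, erule mp, erule conjI, assumption)
  have \<Omega>: "open \<Omega>" using \<Omega>d by (simp add: domain_on_def)
  have Ob [measurable]: "\<Omega> \<in> sets borel" using \<Omega> by simp
  have fL: "f \<in> Lp_space \<Omega> p" using ff by (simp add: frac_space_def)
  have fs: "f \<in> sum_space \<Omega> p" and zW: "(\<lambda>x. 0) \<in> W1p_space \<Omega> p" using Lp_subset_sum_space[OF Ob p fL] by auto
  obtain f0 where f0: "integrable lborel f0" "AE x in lebesgue_on \<Omega>. f x = f0 x" "\<And>x. x \<notin> \<Omega> \<Longrightarrow> f0 x = 0"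
    using Lp_borel_extension[OF Ob \<Omega>b fL p] by metis
  have f0m [measurable]: "f0 \<in> borel_measurable borel" using f0(1) by auto
  define \<sigma> where "\<sigma> = s / 2"
  \<comment> \<open>With \<sigma> = s/2 the gap (s - \<sigma>) p equals \<sigma> p, so the same
    \<delta> is the gain in the Poincare inequality and what is left of the weight: l^(-sp-1)
    l^\<delta> = l^(-\<delta>-1).\<close>
  define \<delta> where "\<delta> = \<sigma> * p"
  define e where "e = real DIM('a) + \<sigma> * p"
  have \<sigma>: "\<sigma> > 0" using s by (simp add: \<sigma>_def)
  have \<delta>: "\<delta> > 0" "s * p = 2 * \<delta>" using s p by (auto simp: \<delta>_def \<sigma>_def)
  \<comment> \<open>This is where s < 1 enters: the term of order l^p, weighted by l^(-sp-1), is
    integrable near 0.\<close>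
  have sp: "p - s * p > 0" using s p by simp
  obtain Cp where Cp: "Cp > 0"
    "\<And>l (U :: 'a set) f. l > 0 \<Longrightarrow> John_domain U (lam * l) (k * l) \<Longrightarrow> integrable lborel f \<Longrightarrow>
       \<exists>a. (\<integral>\<^sup>+y. indicator U y * ennreal (\<bar>f y - a\<bar> powr p) \<partial>lborel) \<le> ennreal (Cp * l powr (\<sigma> * p)) *
         (\<integral>\<^sup>+x. indicator U x * frac_density (\<lambda>x. bdist U x / 2) (real DIM('a) + \<sigma> * p) p f x \<partial>lborel)"
    by (rule John_Poincare[OF p \<sigma> pos(3,4), where 'a='a]) (rule that; blast)
  \<comment> \<open>On each piece \<open>bdist\<close> is at most that of \<Omega> and at most the
    diameter, hence at most c l. So G dominates the Poincare densities of all pieces at scale l,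
    while it depends on \<Omega> and l alone.\<close>
  define G where "G l = frac_density (\<lambda>x. min (bdist \<Omega> x / 2) (c * l)) e p f0" for l
  have Gm [measurable]: "G l \<in> borel_measurable borel" for l unfolding G_def by measurable
  define F where "F l = (\<integral>\<^sup>+x. indicator \<Omega> x * G l x \<partial>lborel)" for l
  \<comment> \<open>The bound on K at scale l assumes l <= 1.\<close>
  define \<tau>' where "\<tau>' = min \<tau> 1"
  have \<tau>': "\<tau>' > 0" "\<tau>' \<le> \<tau>" "\<tau>' \<le> 1" using pos by (auto simp: \<tau>'_def)
  define C1 where "C1 = 3 powr (p - 1) * (2 + 2 powr (p - 1)) * C powr p * (C powr p * Cp)"
  define C2 where "C2 = 3 powr (p - 1) * 2 powr (p - 1) * Lp_norm \<Omega> p f powr p"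
  have C1: "C1 > 0" unfolding C1_def using pos Cp(1) by (simp add: add_pos_pos)
  have C2: "C2 \<ge> 0" unfolding C2_def by simp
  have K0: "K_functional \<Omega> p l f \<ge> 0" if "l > 0" for l using K_functional_nonneg[OF fs, of l] that by simp
  have small: "ennreal (K_functional \<Omega> p l f powr p) \<le> ennreal (C1 * l powr \<delta>) * F l + ennreal (C2 * l powr p)"
    if l: "0 < l" "l < \<tau>'" for l
  proof (cases "F l < \<infinity>")
    case True
    have l\<tau>: "l < \<tau>" "l \<le> 1" using l \<tau>' by auto
    obtain J :: "nat set" and U \<psi> where JU: "John_partition \<Omega> C lam k c l J U \<psi>"
      using cover[OF l(1) l\<tau>(1)] by blast
    note JU' = JU[unfolded John_partition_def]
    have U1: "\<Omega> = (\<Union>j\<in>J. U j)" by (insert JU', elim conjE, assumption)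
    have "\<forall>j\<in>J. John_domain (U j) (lam * l) (k * l)"
      and "\<forall>j\<in>J. l / c \<le> diameter (U j) \<and> diameter (U j) \<le> c * l"
      and "\<forall>j\<in>J. \<psi> j \<in> W1inf_space \<Omega>" and "\<forall>j\<in>J. \<forall>x\<in>\<Omega> - U j. \<psi> j x = 0"
      and "\<forall>x\<in>\<Omega>. ((\<lambda>j. \<psi> j x) has_sum 1) J"
      and "\<forall>x. (\<Sum>\<^sub>\<infinity>j\<in>J. indicator (U j) x :: ennreal) \<le> ennreal C"
      and "\<forall>j\<in>J. Linf_norm \<Omega> (\<psi> j) \<le> ereal C \<and> Linf_norm \<Omega> (weak_gradient \<Omega> (\<psi> j)) \<le> ereal (C / l)"
      by (insert JU', (elim conjE, assumption)+)
    then have U: "\<And>j. j \<in> J \<Longrightarrow> John_domain (U j) (lam * l) (k * l)" "\<And>j. j \<in> J \<Longrightarrow> diameter (U j) \<le> c * l"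
      and \<psi>: "\<And>j. j \<in> J \<Longrightarrow> \<psi> j \<in> W1inf_space \<Omega>" "\<And>j x. j \<in> J \<Longrightarrow> x \<in> \<Omega> - U j \<Longrightarrow> \<psi> j x = 0"
        "\<And>x. x \<in> \<Omega> \<Longrightarrow> ((\<lambda>j. \<psi> j x) has_sum 1) J"
        "\<And>j. j \<in> J \<Longrightarrow> Linf_norm \<Omega> (\<psi> j) \<le> ereal C"
        "\<And>j. j \<in> J \<Longrightarrow> Linf_norm \<Omega> (weak_gradient \<Omega> (\<psi> j)) \<le> ereal (C / l)"
      and ov: "\<And>x. (\<Sum>\<^sub>\<infinity>j\<in>J. indicator (U j) x :: ennreal) \<le> ennreal C"
      by simp_all
    have sub: "U j \<subseteq> \<Omega>" if "j \<in> J" for j using U1 that by blast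
    have fin: "finite J"
      by (rule finite_cover_index[where \<Omega>=\<Omega> and U=U and lam="lam * l" and k="\<lambda>_. k * l" and C=C]) (use \<Omega> \<Omega>b U(1) sub ov pos l in auto)
    have "\<exists>a. (\<integral>\<^sup>+x. indicator (U j) x * ennreal (\<bar>f0 x - a\<bar> powr p) \<partial>lborel)
       \<le> ennreal (Cp * l powr \<delta>) * (\<integral>\<^sup>+x. indicator (U j) x * G l x \<partial>lborel)" if j: "j \<in> J" for j
    proof -
      obtain a where a: "(\<integral>\<^sup>+x. indicator (U j) x * ennreal (\<bar>f0 x - a\<bar> powr p) \<partial>lborel)
        \<le> ennreal (Cp * l powr \<delta>) * (\<integral>\<^sup>+x. indicator (U j) x * frac_density (\<lambda>x. bdist (U j) x / 2) e p f0 x \<partial>lborel)"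
        using Cp(2)[OF l(1) U(1)[OF j] f0(1)] unfolding e_def \<delta>_def by blast
      have Uj: "open (U j)" "bounded (U j)" using U(1)[OF j] by (auto simp: John_domain_def domain_on_def)
      have "(\<integral>\<^sup>+x. indicator (U j) x * frac_density (\<lambda>x. bdist (U j) x / 2) e p f0 x \<partial>lborel)
        \<le> (\<integral>\<^sup>+x. indicator (U j) x * G l x \<partial>lborel)"
      proof (rule nn_integral_mono)
        fix x
        show "indicator (U j) x * frac_density (\<lambda>x. bdist (U j) x / 2) e p f0 x \<le> indicator (U j) x * G l x"
        proof (cases "x \<in> U j")
          case xU: True
          have "bdist (U j) x \<le> bdist \<Omega> x" by (rule bdist_mono[OF Uj(1) sub[OF j] \<Omega> xU \<Omega>b])
          moreover have "bdist (U j) x \<le> c * l" using bdist_le_diameter[OF Uj xU] U(2)[OF j] by simp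
          moreover have "bdist (U j) x \<ge> 0" by (rule bdist_nonneg)
          ultimately have "bdist (U j) x / 2 \<le> min (bdist \<Omega> x / 2) (c * l)" by simp
          then have "frac_density (\<lambda>x. bdist (U j) x / 2) e p f0 x \<le> G l x"
            unfolding G_def by (rule frac_density_mono)
          then show ?thesis by (intro mult_left_mono) auto
        qed simp
      qed
      then have "ennreal (Cp * l powr \<delta>) * (\<integral>\<^sup>+x. indicator (U j) x * frac_density (\<lambda>x. bdist (U j) x / 2) e p f0 x \<partial>lborel)
        \<le> ennreal (Cp * l powr \<delta>) * (\<integral>\<^sup>+x. indicator (U j) x * G l x \<partial>lborel)"
        by (rule mult_left_mono) simp
      from order_trans[OF a this] show ?thesis by (rule exI)
    qed
    then obtain a where a: "\<And>j. j \<in> J \<Longrightarrow> (\<integral>\<^sup>+x. indicator (U j) x * ennreal (\<bar>f0 x - a j\<bar> powr p) \<partial>lborel)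
       \<le> ennreal (Cp * l powr \<delta>) * (\<integral>\<^sup>+x. indicator (U j) x * G l x \<partial>lborel)"
      by metis
    have sum1: "(\<Sum>j\<in>J. \<psi> j x) = 1" if "x \<in> \<Omega>" for x
      using \<psi>(3)[OF that] has_sum_finite[OF fin, of "\<lambda>j. \<psi> j x"] has_sum_unique by blast
    have ov': "(\<Sum>j\<in>J. indicator (U j) x :: real) \<le> C" for x
      by (rule finite_subset_overlap_le[OF ov fin order_refl]) (use pos in simp)
    have A: "Cp * l powr \<delta> \<ge> 0" using Cp(1) by simp
    have "ennreal (K_functional \<Omega> p l f powr p)
      \<le> ennreal (3 powr (p - 1) * (2 + 2 powr (p - 1)) * C powr p * (C powr p * (Cp * l powr \<delta>))) * F l
        + ennreal (3 powr (p - 1) * 2 powr (p - 1) * Lp_norm \<Omega> p f powr p * l powr p)"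
      unfolding F_def
      by (rule K_functional_powr_le[where \<Omega>=\<Omega> and p=p and l=l and C=C and f=f and A="Cp * l powr \<delta>" and G="G l" and J=J and U=U
            and \<psi>=\<psi> and lam="lam * l" and k="k * l" and ?f0.0=f0 and a=a])
         (use \<Omega> p l l\<tau> pos A fin U(1) sub ov' \<psi>(1,2,4,5) sum1 fL f0m f0(2) Gm a True[unfolded F_def] in auto)
    then show ?thesis by (simp add: C1_def C2_def mult.assoc)
  next
    \<comment> \<open>Here the right side is infinite, because its factor C1 l^\<delta> is
      positive.\<close>
    case False
    then have "F l = \<infinity>" by (simp add: not_less top_unique)
    then show ?thesis using C1 l by (simp add: ennreal_mult_top)
  qed
  \<comment> \<open>The decomposition g = f, h = 0 bounds K at scales where no covering is
    available.\<close>
  have large: "K_functional \<Omega> p l f \<le> Lp_norm \<Omega> p f" if "l > 0" for l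
  proof -
    have "W1p_norm \<Omega> p (\<lambda>x. 0 :: real) = 0"
    proof -
      have z: "(\<lambda>x. 0::'a) \<in> Lp_space \<Omega> p" by (auto simp: Lp_space_def)
      show ?thesis
        using weak_gradient_Lp(2)[OF \<Omega> is_weak_gradient_const[OF Ob, of 0] z] by (simp add: W1p_norm_def Lp_norm_def)
    qed
    then show ?thesis using K_functional_le[of l f \<Omega> p "\<lambda>x. 0" f] that fL zW by simp
  qed
  \<comment> \<open>P carries the fractional energy at small scales, Q the term of order l^p, with
    integral finite near 0, and R the tail l^(-sp-1) beyond \<tau>', with integral finite at
    infinity as s p > 0.\<close>
  let ?P = "\<lambda>l. indicator {0<..} l * (ennreal (l powr (- \<delta> - 1)) * F l)"
  let ?Q = "\<lambda>l. indicator {0..1} l * ennreal (l powr (p - s * p - 1))"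
  let ?R = "\<lambda>l. ennreal (s * p * l powr (- (s * p) - 1)) * indicator {\<tau>'..} l"
  have [measurable]: "F \<in> borel_measurable borel"
  proof -
    have "(\<lambda>l. \<integral>\<^sup>+x. indicator \<Omega> x * (\<integral>\<^sup>+z. (if norm (x - z) < min (bdist \<Omega> x / 2) (c * l)
        then ennreal (\<bar>f0 x - f0 z\<bar> powr p / norm (x - z) powr e) else 0) \<partial>lborel) \<partial>lborel) \<in> borel_measurable borel"
      by measurable
    also have "(\<lambda>l. \<integral>\<^sup>+x. indicator \<Omega> x * (\<integral>\<^sup>+z. (if norm (x - z) < min (bdist \<Omega> x / 2) (c * l)
        then ennreal (\<bar>f0 x - f0 z\<bar> powr p / norm (x - z) powr e) else 0) \<partial>lborel) \<partial>lborel) = F"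
      unfolding F_def[abs_def] G_def frac_density_def
      by (intro ext nn_integral_cong arg_cong2[where f="(*)"] refl) (simp add: indicator_def)
    finally show ?thesis .
  qed
  have bound: "ennreal ((l powr (- s) * K_functional \<Omega> p l f) powr p / l) * indicator {0<..} l
    \<le> ennreal C1 * ?P l + (ennreal C2 * ?Q l + ennreal (Lp_norm \<Omega> p f powr p / (s * p)) * ?R l)" for l
  proof (cases "l > 0")
    case True
    have eq: "(l powr (- s) * K_functional \<Omega> p l f) powr p / l = l powr (- (s * p) - 1) * K_functional \<Omega> p l f powr p"
      using True K0[OF True] by (simp add: powr_mult powr_powr powr_diff)
    show ?thesis
    proof (cases "l < \<tau>'")
      case lt: True
      have "ennreal ((l powr (- s) * K_functional \<Omega> p l f) powr p / l)
        = ennreal (l powr (- (s * p) - 1)) * ennreal (K_functional \<Omega> p l f powr p)"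
        unfolding eq by (rule ennreal_mult') simp
      also have "\<dots> \<le> ennreal (l powr (- (s * p) - 1)) * (ennreal (C1 * l powr \<delta>) * F l + ennreal (C2 * l powr p))"
        by (intro mult_left_mono small True lt) simp
      also have "\<dots> = ennreal (l powr (- (s * p) - 1) * (C1 * l powr \<delta>)) * F l + ennreal (l powr (- (s * p) - 1) * (C2 * l powr p))"
        using C1 C2 by (simp only: distrib_left ennreal_mult' mult.assoc powr_ge_zero)
      also have "l powr (- (s * p) - 1) * (C1 * l powr \<delta>) = C1 * l powr (- \<delta> - 1)"
        using \<delta>(2) by (simp flip: powr_add)
      also have "l powr (- (s * p) - 1) * (C2 * l powr p) = C2 * l powr (p - s * p - 1)"
        by (simp add: algebra_simps flip: powr_add)
      also have "ennreal (C1 * l powr (- \<delta> - 1)) * F l + ennreal (C2 * l powr (p - s * p - 1)) = ennreal C1 * ?P l + ennreal C2 * ?Q l"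
        using True lt \<tau>' C1 C2 by (simp add: ennreal_mult' mult.assoc)
      also have "\<dots> \<le> ennreal C1 * ?P l + (ennreal C2 * ?Q l + ennreal (Lp_norm \<Omega> p f powr p / (s * p)) * ?R l)"
        by (intro add_left_mono) simp
      finally show ?thesis using True by simp
    next
      case ge: False
      have "l powr (- (s * p) - 1) * K_functional \<Omega> p l f powr p \<le> l powr (- (s * p) - 1) * Lp_norm \<Omega> p f powr p"
        using K0[OF True] large[OF True] p by (intro mult_left_mono powr_mono2) auto
      also have "\<dots> = (Lp_norm \<Omega> p f powr p / (s * p)) * (s * p * l powr (- (s * p) - 1))"
        using s p by simp
      finally have "ennreal ((l powr (- s) * K_functional \<Omega> p l f) powr p / l) \<le> ennreal ((Lp_norm \<Omega> p f powr p / (s * p)) * (s * p * l powr (- (s * p) - 1)))"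
        unfolding eq by (rule ennreal_leI)
      also have "\<dots> = ennreal (Lp_norm \<Omega> p f powr p / (s * p)) * ?R l"
        using ge s p by (subst ennreal_mult') auto
      also have "\<dots> \<le> ennreal C1 * ?P l + (ennreal C2 * ?Q l + ennreal (Lp_norm \<Omega> p f powr p / (s * p)) * ?R l)"
        by (intro add_increasing order_refl) simp_all
      finally show ?thesis using True by simp
    qed
  qed simp
  have "(\<integral>\<^sup>+l\<in>{0<..}. ennreal ((l powr (- s) * K_functional \<Omega> p l f) powr p / l) \<partial>lborel)
    \<le> (\<integral>\<^sup>+l. ennreal C1 * ?P l + (ennreal C2 * ?Q l + ennreal (Lp_norm \<Omega> p f powr p / (s * p)) * ?R l) \<partial>lborel)"
    by (intro nn_integral_mono bound)
  also have "\<dots> = ennreal C1 * (\<integral>\<^sup>+l. ?P l \<partial>lborel) + (ennreal C2 * (\<integral>\<^sup>+l. ?Q l \<partial>lborel) + ennreal (Lp_norm \<Omega> p f powr p / (s * p)) * (\<integral>\<^sup>+l. ?R l \<partial>lborel))"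
    by (simp add: nn_integral_add nn_integral_cmult)
  also have "\<dots> < \<infinity>"
  proof -
    have "(\<integral>\<^sup>+l. ?P l \<partial>lborel) \<le> ennreal (c powr \<delta> / \<delta>) * (\<integral>\<^sup>+x. indicator \<Omega> x * frac_density (\<lambda>x. bdist \<Omega> x / 2) (e + \<delta>) p f0 x \<partial>lborel)"
      unfolding F_def G_def by (rule frac_density_layer_le) (use pos \<delta> p in auto)
    also have "e + \<delta> = real DIM('a) + s * p" by (simp add: e_def \<delta>_def \<sigma>_def)
    also have "ennreal (c powr \<delta> / \<delta>) * (\<integral>\<^sup>+x. indicator \<Omega> x * frac_density (\<lambda>x. bdist \<Omega> x / 2) (real DIM('a) + s * p) p f0 x \<partial>lborel) < \<infinity>"
      using ff frac_seminorm_finite_iff[OF \<Omega> f0(2), of s p] by (simp add: frac_space_def ennreal_mult_less_top)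
    finally have P: "(\<integral>\<^sup>+l. ?P l \<partial>lborel) < \<infinity>" .
    have Q: "(\<integral>\<^sup>+l. ?Q l \<partial>lborel) < \<infinity>" by (rule nn_integral_powr_near_0[OF sp])
    have R: "(\<integral>\<^sup>+l. ?R l \<partial>lborel) < \<infinity>"
      using nn_integral_powr_tail[OF \<tau>'(1), of "s * p"] s p by simp
    from P Q R show ?thesis by (simp add: ennreal_mult_less_top ennreal_add_less_top)
  qed
  finally have "interp_seminorm \<Omega> s p f < \<infinity>"
    unfolding interp_seminorm_def ennreal_root_finite_iff .
  then show "f \<in> interp_space \<Omega> s p" using fs by (simp add: interp_space_def)
qed

theorem theorem3p2:
  fixes \<Omega> :: "'a::euclidean_space set" and s p :: real
  assumes "DIM('a) \<ge> 2"
    and "1 \<le> p"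
    and "0 < s" and "s < 1"
    and "admissible_domain \<Omega>"
  shows "frac_space \<Omega> s p = interp_space \<Omega> s p"
proof (rule antisym)
  show "frac_space \<Omega> s p \<subseteq> interp_space \<Omega> s p"
    by (rule frac_space_subset_interp_space[OF assms(5,2-4)])
  show "interp_space \<Omega> s p \<subseteq> frac_space \<Omega> s p"
    by (rule interp_space_subset_frac_space)
       (use assms in \<open>auto simp: admissible_domain_def domain_on_def\<close>)
qed

end
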